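(* Let $K\in\{1,-1\}$ and let $R>0$. Using Algorithm 1 (written out in the context), we can compute an $\varepsilon$-minimizer of a (twice differentiable) function $F:\mathcal M_K\to\mathbb R$ that is $L$-smooth and $\mu$-strongly g-convex in $\mathcal B_R:=\exp_{x_0}(\bar B(0,R))$ by using $$\widetilde O\big(\sqrt{L(R_g+1)/\mu}\big)$$ queries to the gradient oracle. Here $x_0$ is the initial point and $R_g\ge d(x_0,x_g^\ast)$ for a global minimizer $x_g^\ast$ of $F$, which is assumed to exist.
   Context: $\mathcal M_K$ denotes any manifold that is a subset of an $n$-dimensional complete simply connected Riemannian manifold of constant sectional curvature $K$ (hyperbolic space if $K=-1$, the unit sphere if $K=1$), with the inherited metric, such that $\exp_{x_0}(\bar B(0,R_g))\subset\mathcal M_K$ and $\mathcal B_R\subset\mathcal M_K$, where $\bar B(0,r)\subset T_{x_0}\mathcal M_K$ is the closed ball. If $K=1$ one assumes $R<\pi/2$ and $R_g<\pi/2$. $d$ is the Riemannian distance. $F$ is $L$-smooth, resp. $\mu$-strongly g-convex ($\mu>0$), in $\mathcal B_R$ if $F(y)\le F(x)+\langle\nabla F(x),\exp_x^{-1}(y)\rangle+\frac L2d(x,y)^2$, resp. $F(y)\ge F(x)+\langle\nabla F(x),\exp_x^{-1}(y)\rangle+\frac\mu2d(x,y)^2$, for all $x,y\in\mathcal B_R$. An $\varepsilon$-minimizer is a point $\hat x$ with $F(\hat x)-F(x^\ast)\le\varepsilon$, where $x^\ast\in\arg\min_{\mathcal B_R}F$. $\widetilde O(\cdot)$ omits logarithmic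 factors and treats $R\sqrt{|K|}$ as $O(1)$. Algorithm 1, with center $c$, radius $r$, accuracy $\eta$. Let $h$ be the gnomonic ($K=1$) or Beltrami–Klein ($K=-1$) projection into $\mathbb R^n$ with $h(c)=0$, $\mathcal X$ the image under $h$ of the closed Riemannian ball of center $c$ and radius $r$, $f=F\circ h^{-1}$, $\Pi_{\mathcal X}$ the Euclidean projection onto $\mathcal X$; $\gamma_n=\cosh^{-2}(r)$, $\gamma_p=\cosh^{-3}(r)$ if $K=-1$, and $\gamma_n=\cos^3(r)$, $\gamma_p=\cos^2(r)$ if $K=1$; $\tilde L=O(L(R_g+1))$ a Lipschitz constant of $\nabla f$ on $\mathcal X$; $T=\lceil\sqrt{4\tilde L\|\tilde x^\ast\|^2/(\gamma_n^2\gamma_p\eta)}\,\rceil$ iterations, where $\tilde x^\ast\in\arg\min_{\mathcal X}f$. Set $\tilde x_0=\tilde z_0=0$, $A_0=0$. For $i=0,\dots,T-1$: $a_{i+1}=(i+1)\gamma_n^2\gamma_p/(2\tilde L)$; $A_{i+1}=A_i+a_{i+1}$; choose $\lambda$ as below; $\tilde\chi_i=(1-\lambda)\tilde x_i+\lambda\Pi_{\mathcal X}(\tilde z_i)$; $\tilde\zeta_i=\tilde z_i-\frac{a_{i+1}}{\gamma_n}\nabla f(\tilde\chi_i)$; $\tilde x_{i+1}=(1-\lambda)\tilde x_i+\lambda\Pi_{\mathcal X}(\tilde\zeta_i)$; $\tilde z_{i+1}=\tilde z_i-\frac{a_{i+1}}{\gamma_n}\nabla f(\tilde x_{i+1})$.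 Return $h^{-1}(\tilde x_T)$. Choice of $\lambda$: $\lambda=1$ for $i=0$; for $i\ge1$, $\lambda=\frac{a_{i+1}/\gamma_n}{A_i\hat\gamma+a_{i+1}/\gamma_n}$ with $\hat\gamma\in[\gamma_p,1/\gamma_n]$ such that $f(\tilde x_{i+1})-f(\tilde x_i)\le\hat\gamma\langle\nabla f(\tilde x_{i+1}),\tilde x_{i+1}-\tilde x_i\rangle+\frac{A_T\eta}{2(T-1)A_i}$, where $A_T=T(T+1)\gamma_n^2\gamma_p/(4\tilde L)$; one tries $\hat\gamma=1/\gamma_n$, then $\hat\gamma=\gamma_p$, and otherwise bisects over $\lambda$ between these two, keeping the half at whose endpoints $\langle\nabla f(\tilde x_{i+1}),\tilde x_{i+1}-\tilde x_i\rangle$ has opposite signs, until the inequality holds. Algorithm 1 is used in $\lceil\log_2(\mu R^2/\varepsilon)-1\rceil$ stages: stage $j$ starts at (and centers the geodesic map at) the output of the previous stage ($x_0$ for $j=1$), with radius $R_j$, $R_1=R$, $R_j=R_{j-1}/\sqrt2$, and target accuracy $\mu R_j^2/4$.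
   Formalization: The ball of each stage is intersected with B_R (it may leave B_R and even M_K, where F is undefined); at least one stage is always run (the stated count is ≤ 0 for ε ≥ μR²/2, where x_0 need not be an ε-minimizer); and n ≥ 2 is assumed. *)

theory Defs
  imports "HOL-Analysis.Analysis"
begin

text \<open>
  The Euclidean space of dimension \<open>n\<close> is an \<open>n\<close>-dimensional subspace \<open>V\<close> of an arbitrary,
  possibly infinite-dimensional, real inner product space. Unlike a type-indexed dimension, this
  allows \<open>n\<close> to be quantified after the constants hidden in the complexity bound, so that these
  do not depend on the dimension. Note that \<open>dim V = 0\<close> if \<open>V\<close> has no finite basis, so
  \<open>2 \<le> dim V\<close> implies that \<open>V\<close> is finite-dimensional.
\<close>

section \<open>Space forms of curvature 1 and -1\<close>

text \<open>
  Both space forms are realised in \<open>\<real> \<times> V\<close>: the unit sphere for \<open>K = 1\<close>, where \<open>form\<close> is the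
  Euclidean inner product, and the upper sheet of the hyperboloid for \<open>K = -1\<close>, where \<open>form\<close> is
  the Lorentzian one. The Riemannian metric is the restriction of \<open>form\<close> to the tangent spaces.
\<close>

definition form :: "real \<Rightarrow> real \<times> 'a::real_inner \<Rightarrow> real \<times> 'a \<Rightarrow> real" where
  "form K p q = K * fst p * fst q + snd p \<bullet> snd q"

definition space_form :: "real \<Rightarrow> 'a::real_inner set \<Rightarrow> (real \<times> 'a) set" where
  "space_form K V = {p. snd p \<in> V \<and> form K p p = K \<and> (K = -1 \<longrightarrow> 0 < fst p)}"

definition tangent :: "real \<Rightarrow> 'a::real_inner set \<Rightarrow> real \<times> 'a \<Rightarrow> (real \<times> 'a) set" where
  "tangent K V x = {v. snd v \<in> V \<and> form K x v = 0}"

definition rnorm :: "real \<Rightarrow> real \<times> 'a::real_inner \<Rightarrow> real" where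
  "rnorm K v = sqrt (form K v v)"

definition rdist :: "real \<Rightarrow> real \<times> 'a::real_inner \<Rightarrow> real \<times> 'a \<Rightarrow> real" where
  "rdist K x y = (if K = 1 then arccos (form K x y) else arcosh (- form K x y))"

definition cosK :: "real \<Rightarrow> real \<Rightarrow> real" where
  "cosK K t = (if K = 1 then cos t else cosh t)"

definition sinK :: "real \<Rightarrow> real \<Rightarrow> real" where
  "sinK K t = (if K = 1 then sin t else sinh t)"

definition exp_map :: "real \<Rightarrow> real \<times> 'a::real_inner \<Rightarrow> real \<times> 'a \<Rightarrow> real \<times> 'a" where
  "exp_map K x v = cosK K (rnorm K v) *\<^sub>R x + (sinK K (rnorm K v) / rnorm K v) *\<^sub>R v"

text \<open>On the sphere \<open>exp\<close> is not injective; \<open>exp_inv\<close> selects the minimising geodesic.\<close>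

definition exp_inv ::
    "real \<Rightarrow> 'a::real_inner set \<Rightarrow> real \<times> 'a \<Rightarrow> real \<times> 'a \<Rightarrow> real \<times> 'a" where
  "exp_inv K V x y = (THE v. v \<in> tangent K V x \<and> exp_map K x v = y \<and> rnorm K v = rdist K x y)"

definition rcball :: "real \<Rightarrow> 'a::real_inner set \<Rightarrow> real \<times> 'a \<Rightarrow> real \<Rightarrow> (real \<times> 'a) set" where
  "rcball K V x r = exp_map K x ` {v \<in> tangent K V x. rnorm K v \<le> r}"


section \<open>Functions on an open submanifold \<open>M\<close> of a space form\<close>

text \<open>
  Differentiability on \<open>M\<close> is differentiability within \<open>M\<close> as a subset of \<open>\<real> \<times> V\<close>. As \<open>M\<close> is an
  embedded submanifold, this is differentiability in the charts of \<open>M\<close>; for the gradient, seen as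
  a map into \<open>\<real> \<times> V\<close>, it is the existence of the covariant derivative.
\<close>

definition rgrad ::
    "real \<Rightarrow> 'a::real_inner set \<Rightarrow> (real \<times> 'a) set \<Rightarrow> (real \<times> 'a \<Rightarrow> real) \<Rightarrow> real \<times> 'a \<Rightarrow> real \<times> 'a"
  where
  "rgrad K V M F x = (THE g. g \<in> tangent K V x \<and> (F has_derivative form K g) (at x within M))"

definition twice_differentiable ::
    "real \<Rightarrow> 'a::real_inner set \<Rightarrow> (real \<times> 'a) set \<Rightarrow> (real \<times> 'a \<Rightarrow> real) \<Rightarrow> bool" where
  "twice_differentiable K V M F \<longleftrightarrow> F differentiable_on M \<and> rgrad K V M F differentiable_on M"

definition smooth_in ::
    "real \<Rightarrow> 'a::real_inner set \<Rightarrow> (real \<times> 'a) set \<Rightarrow> (real \<times> 'a \<Rightarrow> real) \<Rightarrow> real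
      \<Rightarrow> (real \<times> 'a) set \<Rightarrow> bool" where
  "smooth_in K V M F L S \<longleftrightarrow> (\<forall>x\<in>S. \<forall>y\<in>S.
     F y \<le> F x + form K (rgrad K V M F x) (exp_inv K V x y) + L / 2 * (rdist K x y)\<^sup>2)"

definition strongly_gconvex_in ::
    "real \<Rightarrow> 'a::real_inner set \<Rightarrow> (real \<times> 'a) set \<Rightarrow> (real \<times> 'a \<Rightarrow> real) \<Rightarrow> real
      \<Rightarrow> (real \<times> 'a) set \<Rightarrow> bool" where
  "strongly_gconvex_in K V M F \<mu> S \<longleftrightarrow> (\<forall>x\<in>S. \<forall>y\<in>S.
     F y \<ge> F x + form K (rgrad K V M F x) (exp_inv K V x y) + \<mu> / 2 * (rdist K x y)\<^sup>2)"

definition eps_minimizer :: "('b \<Rightarrow> real) \<Rightarrow> 'b set \<Rightarrow> real \<Rightarrow> 'b \<Rightarrow> bool" where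
  "eps_minimizer F S \<epsilon> y \<longleftrightarrow> (\<exists>xs. is_arg_min F (\<lambda>x. x \<in> S) xs \<and> F y - F xs \<le> \<epsilon>)"


section \<open>Gnomonic and Beltrami--Klein coordinates\<close>

text \<open>
  A frame at \<open>c\<close> is a linear isometry of \<open>V\<close> onto the tangent space at \<open>c\<close>. The projection \<open>h\<close>
  sends a point \<open>y\<close> to the \<open>u \<in> V\<close> for which \<open>c + E u\<close> is the intersection of the ray through \<open>y\<close>
  with the affine tangent space at \<open>c\<close>. Its inverse \<open>h_inv\<close> rescales \<open>c + E u\<close> to lie on the
  space form, and is defined where \<open>1 + K * (u \<bullet> u) > 0\<close>: on all of \<open>V\<close> for \<open>K = 1\<close> (its range is
  the open hemisphere around \<open>c\<close>), and on the open unit ball for \<open>K = -1\<close>.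
\<close>

definition frame ::
    "real \<Rightarrow> 'a::real_inner set \<Rightarrow> real \<times> 'a \<Rightarrow> ('a \<Rightarrow> real \<times> 'a) \<Rightarrow> bool" where
  "frame K V c E \<longleftrightarrow> linear E \<and> E ` V = tangent K V c \<and>
     (\<forall>u\<in>V. \<forall>v\<in>V. form K (E u) (E v) = u \<bullet> v)"

definition h_inv :: "real \<Rightarrow> real \<times> 'a::real_inner \<Rightarrow> ('a \<Rightarrow> real \<times> 'a) \<Rightarrow> 'a \<Rightarrow> real \<times> 'a" where
  "h_inv K c E u = (1 / sqrt (1 + K * (u \<bullet> u))) *\<^sub>R (c + E u)"

text \<open>The image under \<open>h\<close> of a set \<open>S\<close>.\<close>

definition h_image ::
    "real \<Rightarrow> 'a::real_inner set \<Rightarrow> real \<times> 'a \<Rightarrow> ('a \<Rightarrow> real \<times> 'a) \<Rightarrow> (real \<times> 'a) set \<Rightarrow> 'a set"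
  where
  "h_image K V c E S = {u \<in> V. 0 < 1 + K * (u \<bullet> u) \<and> h_inv K c E u \<in> S}"

definition grad_in :: "'a::real_inner set \<Rightarrow> ('a \<Rightarrow> real) \<Rightarrow> 'a \<Rightarrow> 'a" where
  "grad_in V f u = (THE g. g \<in> V \<and> (f has_derivative (\<lambda>v. g \<bullet> v)) (at u within V))"

definition gamma_n :: "real \<Rightarrow> real \<Rightarrow> real" where
  "gamma_n K r = (if K = 1 then (cos r) ^ 3 else 1 / (cosh r) ^ 2)"

definition gamma_p :: "real \<Rightarrow> real \<Rightarrow> real" where
  "gamma_p K r = (if K = 1 then (cos r) ^ 2 else 1 / (cosh r) ^ 3)"


section \<open>The accelerated algorithm in coordinates\<close>

context
  fixes X :: "'a::real_inner set" and f :: "'a \<Rightarrow> real" and gf :: "'a \<Rightarrow> 'a"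
    and \<gamma>n \<gamma>p Lt \<eta> :: real and T :: nat
begin

text \<open>\<open>step_coeff i\<close> and \<open>sum_coeff i\<close> are \<open>a\<^sub>i\<close> and \<open>A\<^sub>i\<close>.\<close>

definition step_coeff :: "nat \<Rightarrow> real" where
  "step_coeff i = real i * \<gamma>n\<^sup>2 * \<gamma>p / (2 * Lt)"

definition sum_coeff :: "nat \<Rightarrow> real" where
  "sum_coeff i = (\<Sum>j = 1..i. step_coeff j)"

definition proj :: "'a \<Rightarrow> 'a" where
  "proj z = arg_min_on (dist z) X"

definition chi_pt :: "'a \<Rightarrow> 'a \<Rightarrow> real \<Rightarrow> 'a" where
  "chi_pt x z l = (1 - l) *\<^sub>R x + l *\<^sub>R proj z"

definition zeta_pt :: "nat \<Rightarrow> 'a \<Rightarrow> 'a \<Rightarrow> real \<Rightarrow> 'a" where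
  "zeta_pt i x z l = z - (step_coeff (Suc i) / \<gamma>n) *\<^sub>R gf (chi_pt x z l)"

definition next_x :: "nat \<Rightarrow> 'a \<Rightarrow> 'a \<Rightarrow> real \<Rightarrow> 'a" where
  "next_x i x z l = (1 - l) *\<^sub>R x + l *\<^sub>R proj (zeta_pt i x z l)"

definition lam_of :: "nat \<Rightarrow> real \<Rightarrow> real" where
  "lam_of i \<gamma> = (step_coeff (Suc i) / \<gamma>n) / (sum_coeff i * \<gamma> + step_coeff (Suc i) / \<gamma>n)"

definition slope :: "nat \<Rightarrow> 'a \<Rightarrow> 'a \<Rightarrow> real \<Rightarrow> real" where
  "slope i x z l = gf (next_x i x z l) \<bullet> (next_x i x z l - x)"

definition acceptable :: "nat \<Rightarrow> 'a \<Rightarrow> 'a \<Rightarrow> real \<Rightarrow> bool" where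
  "acceptable i x z l \<longleftrightarrow> (\<exists>\<gamma>. \<gamma>p \<le> \<gamma> \<and> \<gamma> \<le> 1 / \<gamma>n \<and> l = lam_of i \<gamma> \<and>
     f (next_x i x z l) - f x
       \<le> \<gamma> * slope i x z l + sum_coeff T * \<eta> / (2 * (real T - 1) * sum_coeff i))"

text \<open>
  In the following relations the last argument counts the values of \<open>l\<close> that are tried, resp. the
  gradient queries. They are big-step: a non-terminating bisection is related to no result.
\<close>

inductive bisection :: "nat \<Rightarrow> 'a \<Rightarrow> 'a \<Rightarrow> real \<Rightarrow> real \<Rightarrow> real \<Rightarrow> nat \<Rightarrow> bool" for i x z where
  stop: "acceptable i x z ((a + b) / 2) \<Longrightarrow> bisection i x z a b ((a + b) / 2) 1"
| left: "\<not> acceptable i x z ((a + b) / 2) \<Longrightarrow> slope i x z a * slope i x z ((a + b) / 2) < 0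
    \<Longrightarrow> bisection i x z a ((a + b) / 2) l k \<Longrightarrow> bisection i x z a b l (Suc k)"
| right: "\<not> acceptable i x z ((a + b) / 2) \<Longrightarrow> slope i x z ((a + b) / 2) * slope i x z b < 0
    \<Longrightarrow> bisection i x z ((a + b) / 2) b l k \<Longrightarrow> bisection i x z a b l (Suc k)"

inductive choose_lam :: "nat \<Rightarrow> 'a \<Rightarrow> 'a \<Rightarrow> real \<Rightarrow> nat \<Rightarrow> bool" where
  first: "choose_lam 0 x z 1 1"
| try_n: "0 < i \<Longrightarrow> acceptable i x z (lam_of i (1 / \<gamma>n))
    \<Longrightarrow> choose_lam i x z (lam_of i (1 / \<gamma>n)) 1"
| try_p: "0 < i \<Longrightarrow> \<not> acceptable i x z (lam_of i (1 / \<gamma>n)) \<Longrightarrow> acceptable i x z (lam_of i \<gamma>p)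
    \<Longrightarrow> choose_lam i x z (lam_of i \<gamma>p) 2"
| bisect: "0 < i \<Longrightarrow> \<not> acceptable i x z (lam_of i (1 / \<gamma>n)) \<Longrightarrow> \<not> acceptable i x z (lam_of i \<gamma>p)
    \<Longrightarrow> bisection i x z (lam_of i (1 / \<gamma>n)) (lam_of i \<gamma>p) l k \<Longrightarrow> choose_lam i x z l (k + 2)"

text \<open>
  \<open>iterate i x z q\<close>: after \<open>i\<close> iterations the state is \<open>(x, z)\<close> and \<open>q\<close> gradients have been
  queried. Trying one value \<open>l\<close> costs two queries, at \<open>chi_pt\<close> and at \<open>next_x\<close>; the update of \<open>z\<close>
  reuses the gradient at the accepted \<open>next_x\<close>.
\<close>

inductive iterate :: "nat \<Rightarrow> 'a \<Rightarrow> 'a \<Rightarrow> nat \<Rightarrow> bool" where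
  start: "iterate 0 0 0 0"
| step: "iterate i x z q \<Longrightarrow> choose_lam i x z l k
    \<Longrightarrow> iterate (Suc i) (next_x i x z l)
          (z - (step_coeff (Suc i) / \<gamma>n) *\<^sub>R gf (next_x i x z l)) (q + 2 * k)"

end


section \<open>Algorithm 1 and its restarts\<close>

text \<open>
  \<open>algorithm1 K V M F D Lt c r \<eta> y q\<close>: on \<open>F\<close>, with center \<open>c\<close>, radius \<open>r\<close>, accuracy \<open>\<eta>\<close> and
  Lipschitz constant \<open>Lt\<close>, the algorithm returns \<open>y\<close> after \<open>q\<close> gradient queries. \<open>D\<close> is the set
  in which \<open>F\<close> is known to be smooth and strongly g-convex, and the closed ball of center \<open>c\<close> and
  radius \<open>r\<close> is taken in the metric space \<open>D\<close>: a ball of the whole space form need not be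
  contained in \<open>D\<close>, or even in the domain \<open>M\<close> of \<open>F\<close>, once \<open>c\<close> is no longer the center of \<open>D\<close>.
\<close>

definition num_iterations :: "real \<Rightarrow> real \<Rightarrow> real \<Rightarrow> real \<Rightarrow> 'a::real_inner \<Rightarrow> nat" where
  "num_iterations \<gamma>n \<gamma>p Lt \<eta> xs = nat \<lceil>sqrt (4 * Lt * (norm xs)\<^sup>2 / (\<gamma>n\<^sup>2 * \<gamma>p * \<eta>))\<rceil>"

definition algorithm1 ::
    "real \<Rightarrow> 'a::real_inner set \<Rightarrow> (real \<times> 'a) set \<Rightarrow> (real \<times> 'a \<Rightarrow> real) \<Rightarrow> (real \<times> 'a) set
      \<Rightarrow> real \<Rightarrow> real \<times> 'a \<Rightarrow> real \<Rightarrow> real \<Rightarrow> real \<times> 'a \<Rightarrow> nat \<Rightarrow> bool" where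
  "algorithm1 K V M F D Lt c r \<eta> y q \<longleftrightarrow>
    (\<exists>E X f \<gamma>n \<gamma>p xs T x z.
       frame K V c E \<and>
       X = h_image K V c E (rcball K V c r \<inter> D) \<and>
       f = F \<circ> h_inv K c E \<and>
       \<gamma>n = gamma_n K r \<and> \<gamma>p = gamma_p K r \<and>
       Lt-lipschitz_on X (grad_in V f) \<and>
       is_arg_min f (\<lambda>u. u \<in> X) xs \<and>
       T = num_iterations \<gamma>n \<gamma>p Lt \<eta> xs \<and>
       iterate X f (grad_in V f) \<gamma>n \<gamma>p Lt \<eta> T T x z q \<and>
       y = h_inv K c E x)"

text \<open>
  \<open>stages K V M F \<mu> Lt x0 R j y q\<close>: the first \<open>j\<close> stages output \<open>y\<close>, using \<open>q\<close> queries in total.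
\<close>

inductive stages ::
    "real \<Rightarrow> 'a::real_inner set \<Rightarrow> (real \<times> 'a) set \<Rightarrow> (real \<times> 'a \<Rightarrow> real) \<Rightarrow> real \<Rightarrow> real
      \<Rightarrow> real \<times> 'a \<Rightarrow> real \<Rightarrow> nat \<Rightarrow> real \<times> 'a \<Rightarrow> nat \<Rightarrow> bool"
  for K V M F \<mu> Lt x0 R where
  start: "stages K V M F \<mu> Lt x0 R 0 x0 0"
| stage: "stages K V M F \<mu> Lt x0 R j c q \<Longrightarrow> r = R / sqrt 2 ^ j
    \<Longrightarrow> algorithm1 K V M F (rcball K V x0 R) Lt c r (\<mu> * r\<^sup>2 / 4) y k
    \<Longrightarrow> stages K V M F \<mu> Lt x0 R (Suc j) y (q + k)"

text \<open>
  At least one stage is run: for \<open>\<epsilon> \<ge> \<mu> * R\<^sup>2 / 2\<close> the expression inside \<open>nat\<close> is not positive, but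
  the starting point need not be an \<open>\<epsilon>\<close>-minimizer.
\<close>

definition num_stages :: "real \<Rightarrow> real \<Rightarrow> real \<Rightarrow> nat" where
  "num_stages \<mu> R \<epsilon> = max 1 (nat \<lceil>log 2 (\<mu> * R\<^sup>2 / \<epsilon>) - 1\<rceil>)"

end

theory Submission
  imports Defs
begin

text \<open>
  In gnomonic or Beltrami--Klein coordinates \<open>exp_inv x y\<close> is a multiple of the straight segment,
  with a factor between \<open>gamma_p\<close> and \<open>1 / gamma_n\<close>. Hence \<open>f\<close> is convex up to this factor, and
  the factor tends to \<open>1\<close> linearly, so that \<open>f\<close> has a second-order expansion with error
  \<open>O(L + |grad F|)\<close>; the gradient of \<open>f\<close> is then Lipschitz with a constant of this order, first
  near interior points and then on the whole convex set.

  No bound on \<open>grad F\<close> can be taken from the global minimizer, which may lie outside the ball where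
  \<open>F\<close> is smooth. It comes from curvature and \<open>dim V \<ge> 2\<close>: a function whose Hessian is \<open>O(L)\<close> is
  affine along geodesics up to \<open>O(L)\<close>, and on a curved triangle this forces the gradient to be
  \<open>O(L)\<close>.

  In coordinates the iteration is analysed by a potential \<open>A\<^sub>i (f x\<^sub>i - f x\<^sup>*) + \<psi>(z\<^sub>i)\<close>, where \<open>\<psi>\<close> is
  a Fenchel gap. A value of \<open>\<lambda>\<close> can only be rejected if the slope is bounded away from \<open>0\<close>, and
  the slope is Lipschitz in \<open>\<lambda>\<close>, which bounds the number of bisection steps by a logarithm. Strong
  convexity and the first-order condition at the constrained minimizer make the distance to it
  shrink by the factor \<open>sqrt 2\<close> in each stage.
\<close>

section \<open>Finite-dimensional subspaces of an inner product space\<close>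

text \<open>The factor between \<open>exp_inv\<close> and the straight segment varies with the pair
  of points, and only its range is known. Towards a point of lower value the gradient pairs
  nonpositively, so \<open>1 / gamma_n\<close> is the worst factor whatever the pair. Towards the
  previous iterate the sign is unknown. The search for \<lambda> finds a factor that serves there;
  it succeeds because a sign change of the slope traps a point where the slope is so small that the
  factor no longer matters. Restarts move the center, possibly to the boundary of the ball on which
  \<open>F\<close> is controlled. Each subproblem thus lives on an intersection of two balls, whose
  center need not be interior and whose minimizer may have a nonzero gradient. The estimates
  therefore hold uniformly up to the boundary and are expressed through \<open>kappa K R\<close>,
  which serves every stage. Finite dimension provides compactness and representing vectors, but
  never a constant: the constants are built from \<open>K\<close>, \<open>R\<close> and the midpoint
  distance \<sigma> alone.\<close>

definition orthonormal :: "'a::real_inner set \<Rightarrow> bool" where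
  "orthonormal B \<longleftrightarrow> finite B \<and> (\<forall>e\<in>B. \<forall>e'\<in>B. e \<bullet> e' = (if e = e' then 1 else 0))"

definition coord_proj :: "'a::real_inner set \<Rightarrow> 'a \<Rightarrow> 'a" where
  "coord_proj B u = (\<Sum>e\<in>B. (u \<bullet> e) *\<^sub>R e)"

lemma orthonormal_inner_sum:
  assumes "orthonormal B" "e \<in> B"
  shows "(\<Sum>e'\<in>B. c e' *\<^sub>R e') \<bullet> e = c e"
proof -
  have "(\<Sum>e'\<in>B. c e' *\<^sub>R e') \<bullet> e = (\<Sum>e'\<in>B. if e' = e then c e else 0)"
    unfolding inner_sum_left using assms by (intro sum.cong) (auto simp: orthonormal_def)
  then show ?thesis using assms by (simp add: orthonormal_def)
qed

lemma coord_proj_span: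
  assumes "orthonormal B" "u \<in> span B"
  shows "coord_proj B u = u"
proof -
  have fin: "finite B" using assms(1) by (simp add: orthonormal_def)
  obtain c where u: "u = (\<Sum>e\<in>B. c e *\<^sub>R e)"
    using assms(2) by (auto simp: span_finite[OF fin])
  show ?thesis
    unfolding coord_proj_def using orthonormal_inner_sum[OF assms(1)] u by (auto intro!: sum.cong)
qed

lemma coord_proj_inner_basis:
  assumes "orthonormal B" "e \<in> B"
  shows "coord_proj B u \<bullet> e = u \<bullet> e"
  unfolding coord_proj_def by (rule orthonormal_inner_sum[OF assms])

lemma coord_proj_in_span: "coord_proj B u \<in> span B"
  unfolding coord_proj_def by (intro span_sum span_scale span_base)

lemma norm_coord_le:
  assumes "orthonormal B" "e \<in> B"
  shows "\<bar>u \<bullet> e\<bar> \<le> norm u"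
proof -
  have "e \<bullet> e = 1" using assms by (auto simp: orthonormal_def)
  then have "norm e = 1" by (simp add: norm_eq_sqrt_inner)
  then show ?thesis using Cauchy_Schwarz_ineq2[of u e] by simp
qed

text \<open>Gram-Schmidt: the residual \<open>b\<close> of the new vector is normalised and added,
  unless it vanishes.\<close>

lemma orthonormal_basis_finite_span:
  fixes A :: "'a::real_inner set"
  assumes "finite A"
  shows "\<exists>B. orthonormal B \<and> span B = span A"
  using assms
proof (induction A)
  case empty
  show ?case by (intro exI[of _ "{}"]) (auto simp: orthonormal_def)
next
  case (insert a A)
  then obtain B where B: "orthonormal B" "span B = span A" by blast
  have fin: "finite B" using B(1) by (simp add: orthonormal_def)
  define b where "b = a - coord_proj B a"
  have orth: "b \<bullet> e = 0" "e \<bullet> b = 0" if "e \<in> B" for e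
    using coord_proj_inner_basis[OF B(1) that] 
    by (simp_all add: b_def inner_diff_left inner_diff_right inner_commute[of e])
  have sp: "span (insert a A) = span (insert b B)"
  proof -
    have "span (insert a A) = span (insert a B)"
      using B(2) by (simp add: span_insert)
    also have "\<dots> = span (insert b B)"
    proof (intro antisym span_minimal subspace_span)
      show "insert a B \<subseteq> span (insert b B)"
      proof -
        have "b + coord_proj B a \<in> span (insert b B)"
          by (intro span_add) (auto intro: span_base subsetD[OF span_mono coord_proj_in_span])
        then show ?thesis by (auto simp: b_def intro: span_base)
      qed
      show "insert b B \<subseteq> span (insert a B)"
      proof -
        have "a - coord_proj B a \<in> span (insert a B)"
          by (intro span_diff) (auto intro: span_base subsetD[OF span_mono coord_proj_in_span])
        then show ?thesis by (auto simp: b_def intro: span_base)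
      qed
    qed
    finally show ?thesis .
  qed
  show ?case
  proof (cases "b = 0")
    case True
    then show ?thesis using B(1) sp by (auto simp: span_insert_0)
  next
    case False
    define e where "e = (1 / norm b) *\<^sub>R b"
    have ee: "e \<bullet> e = 1" using False by (simp add: e_def dot_square_norm power2_eq_square)
    have eB: "e \<bullet> e' = 0" "e' \<bullet> e = 0" if "e' \<in> B" for e'
      using orth[OF that] by (auto simp: e_def)
    have "orthonormal (insert e B)"
      using B(1) fin ee eB unfolding orthonormal_def by auto
    moreover have "span (insert e B) = span (insert b B)"
    proof (intro antisym span_minimal subspace_span)
      show "insert e B \<subseteq> span (insert b B)"
        by (auto simp: e_def intro: span_base span_scale)
      have "b = norm b *\<^sub>R e" using False by (simp add: e_def)
      then have "b \<in> span (insert e B)" by (metis insertI1 span_base span_scale)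
      then show "insert b B \<subseteq> span (insert e B)" by (auto intro: span_base)
    qed
    ultimately show ?thesis using sp by auto
  qed
qed

text \<open>A nonzero \<open>dim V\<close> excludes an infinite basis, whose \<open>card\<close>
  would be 0 by convention.\<close>

lemma orthonormal_basis_exists:
  fixes V :: "'a::real_inner set"
  assumes "subspace V" "dim V \<noteq> 0"
  obtains B where "orthonormal B" "span B = V"
proof -
  obtain A where A: "A \<subseteq> V" "V \<subseteq> span A" "card A = dim V"
    by (rule real_vector.basis_exists[of V]) 
  have "finite A" using A(3) assms(2) by (metis card.infinite)
  then obtain B where B: "orthonormal B" "span B = span A"
    using orthonormal_basis_finite_span by blast
  have "span A = V" using A assms(1) by (simp add: span_subspace)
  then show ?thesis using that B by auto
qed

lemma exists_orthogonal_unit: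
  fixes V :: "'a::real_inner set"
  assumes V: "subspace V" "2 \<le> dim V" and a: "a \<in> V"
  obtains w where "w \<in> V" "w \<bullet> a = 0" "w \<bullet> w = 1"
proof -
  have "\<not> V \<subseteq> span {a}"
    using dim_le_card[of V "{a}"] V(2) by auto
  then obtain b where b: "b \<in> V" "b \<notin> span {a}" by blast
  define w where "w = b - ((b \<bullet> a) / (a \<bullet> a)) *\<^sub>R a"
  have w0: "w \<noteq> 0"
  proof
    assume "w = 0"
    then have "b = ((b \<bullet> a) / (a \<bullet> a)) *\<^sub>R a" by (simp add: w_def)
    then have "b \<in> span {a}" by (metis insertI1 span_base span_scale)
    then show False using b by blast
  qed
  have wV: "w \<in> V" unfolding w_def using V(1) b(1) a by (intro subspace_diff subspace_scale)
  have wa: "w \<bullet> a = 0" by (cases "a = 0") (auto simp: w_def inner_diff_left)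
  show ?thesis
    by (rule that[of "(1 / norm w) *\<^sub>R w"])
      (use V(1) wV wa w0 in \<open>auto simp: subspace_scale dot_square_norm power2_eq_square\<close>)
qed

text \<open>Heine-Borel inside a space that may be infinite-dimensional: a coordinate box is compact
  as an iterated sum of compact segments, and the ball of the span is a closed part of it.\<close>

lemma compact_orthonormal_span_cball:
  fixes B :: "'a::real_inner set"
  assumes "orthonormal B"
  shows "compact (span B \<inter> cball 0 r)"
proof -
  have fin: "finite B" using assms by (simp add: orthonormal_def)
  have box: "compact {\<Sum>e\<in>A. c e *\<^sub>R e | c. \<forall>e\<in>A. \<bar>c e\<bar> \<le> r}" if "finite A" for A :: "'a set"
    using that
  proof (induction A)
    case empty
    then show ?case by simp
  next
    case (insert a A)
    have "compact ((\<lambda>t. t *\<^sub>R a) ` {- r..r})"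
      by (intro compact_continuous_image continuous_intros) auto
    then have "compact {x + y | x y. x \<in> (\<lambda>t. t *\<^sub>R a) ` {- r..r} \<and>
        y \<in> {\<Sum>e\<in>A. c e *\<^sub>R e | c. \<forall>e\<in>A. \<bar>c e\<bar> \<le> r}}"
      using insert.IH by (rule compact_sums)
    also have "{x + y | x y. x \<in> (\<lambda>t. t *\<^sub>R a) ` {- r..r} \<and>
        y \<in> {\<Sum>e\<in>A. c e *\<^sub>R e | c. \<forall>e\<in>A. \<bar>c e\<bar> \<le> r}}
      = {\<Sum>e\<in>insert a A. c e *\<^sub>R e | c. \<forall>e\<in>insert a A. \<bar>c e\<bar> \<le> r}" (is "?S = ?T")
    proof (intro set_eqI iffI)
      fix x assume "x \<in> ?S"
      then obtain t c where t: "\<bar>t\<bar> \<le> r" "\<forall>e\<in>A. \<bar>c e\<bar> \<le> r" "x = t *\<^sub>R a + (\<Sum>e\<in>A. c e *\<^sub>R e)"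
        by (force simp: abs_le_iff)
      have "(\<Sum>e\<in>A. c e *\<^sub>R e) = (\<Sum>e\<in>A. (c(a := t)) e *\<^sub>R e)"
        using insert.hyps by (intro sum.cong) auto
      then have "x = (\<Sum>e\<in>insert a A. (c(a := t)) e *\<^sub>R e)"
        using t(3) insert.hyps by simp
      moreover have "\<forall>e\<in>insert a A. \<bar>(c(a := t)) e\<bar> \<le> r" using t by auto
      ultimately show "x \<in> ?T" by blast
    next
      fix x assume "x \<in> ?T"
      then obtain c where c: "\<forall>e\<in>insert a A. \<bar>c e\<bar> \<le> r" "x = (\<Sum>e\<in>insert a A. c e *\<^sub>R e)"
        by blast
      have "x = c a *\<^sub>R a + (\<Sum>e\<in>A. c e *\<^sub>R e)" using c insert.hyps by simp
      moreover have "c a *\<^sub>R a \<in> (\<lambda>t. t *\<^sub>R a) ` {- r..r}" using c(1) by (auto simp: abs_le_iff)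
      moreover have "\<forall>e\<in>A. \<bar>c e\<bar> \<le> r" using c(1) by auto
      ultimately show "x \<in> ?S" by blast
    qed
    finally show ?case .
  qed
  define P where "P = {\<Sum>e\<in>B. c e *\<^sub>R e | c. \<forall>e\<in>B. \<bar>c e\<bar> \<le> r}"
  have "span B \<inter> cball 0 r = P \<inter> cball 0 r"
  proof (intro set_eqI iffI)
    fix x assume x: "x \<in> span B \<inter> cball 0 r"
    have "x = (\<Sum>e\<in>B. (x \<bullet> e) *\<^sub>R e)"
      using coord_proj_span[OF assms] x by (simp add: coord_proj_def)
    moreover have "\<forall>e\<in>B. \<bar>x \<bullet> e\<bar> \<le> r" using norm_coord_le[OF assms, of _ x] x by fastforce
    ultimately show "x \<in> P \<inter> cball 0 r" using x unfolding P_def by blast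
  next
    fix x assume "x \<in> P \<inter> cball 0 r"
    then show "x \<in> span B \<inter> cball 0 r"
      unfolding P_def by (auto intro!: span_sum intro: span_scale span_base)
  qed
  then show ?thesis using box[OF fin] by (metis P_def compact_Int_closed closed_cball)
qed

section \<open>Euclidean projection onto a compact convex set\<close>

lemma
  fixes X :: "'a::real_inner set"
  assumes "compact X" "X \<noteq> {}"
  shows proj_in: "proj X z \<in> X"
    and proj_le: "v \<in> X \<Longrightarrow> dist z (proj X z) \<le> dist z v"
proof -
  have "continuous_on X (dist z)" by (intro continuous_intros)
  then obtain p where "p \<in> X" "\<forall>y\<in>X. dist z p \<le> dist z y"
    using continuous_attains_inf[OF assms, of "dist z"] by blast
  then have "is_arg_min (dist z) (\<lambda>x. x \<in> X) p" by (auto simp: is_arg_min_def not_less)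
  then have "is_arg_min (dist z) (\<lambda>x. x \<in> X) (proj X z)"
    unfolding proj_def arg_min_on_def arg_min_def by (rule someI)
  then show "proj X z \<in> X" "v \<in> X \<Longrightarrow> dist z (proj X z) \<le> dist z v"
    by (auto simp: is_arg_min_def not_less)
qed

lemma proj_obtuse:
  fixes X :: "'a::real_inner set"
  assumes "compact X" "convex X" "v \<in> X"
  shows "(z - proj X z) \<bullet> (v - proj X z) \<le> 0"
proof (rule any_closest_point_dot[OF assms(2) compact_imp_closed[OF assms(1)] _ assms(3)])
  have "X \<noteq> {}" using assms(3) by auto
  then show "proj X z \<in> X" "\<forall>v\<in>X. dist z (proj X z) \<le> dist z v"
    using proj_in[OF assms(1)] proj_le[OF assms(1)] by auto
qed

text \<open>The two obtuse-angle inequalities, each tested at the other projection, are added;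
  Cauchy-Schwarz finishes.\<close>

lemma proj_nonexpansive:
  fixes X :: "'a::real_inner set"
  assumes "compact X" "convex X" "X \<noteq> {}"
  shows "norm (proj X z - proj X z') \<le> norm (z - z')"
proof -
  define d where "d = proj X z - proj X z'"
  have "(z - proj X z) \<bullet> (- d) \<le> 0" "(z' - proj X z') \<bullet> d \<le> 0"
    using proj_obtuse[OF assms(1,2) proj_in[OF assms(1,3)]] by (auto simp: d_def)
  then have "d \<bullet> d \<le> (z - z') \<bullet> d"
    by (simp add: d_def inner_diff_left inner_diff_right inner_commute)
  also have "\<dots> \<le> norm (z - z') * norm d" by (rule norm_cauchy_schwarz)
  finally have "norm d * norm d \<le> norm (z - z') * norm d"
    by (simp add: dot_square_norm power2_eq_square)
  then have "norm d \<le> norm (z - z')"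
    by (cases "norm d = 0") (auto simp: mult_le_cancel_right)
  then show ?thesis by (simp add: d_def)
qed

lemma proj_fixes:
  fixes X :: "'a::real_inner set"
  assumes "compact X" "z \<in> X"
  shows "proj X z = z"
  using proj_le[OF assms(1) _ assms(2), of z] assms(2) by force

text \<open>The projection of \<open>z\<close> maximises
  \<open>z \<bullet> v - (v \<bullet> v) / 2\<close> over \<open>X\<close>. This function is
  1-strongly concave, so other values fall below the maximum by half the squared distance.\<close>

lemma proj_three_point:
  fixes X :: "'a::real_inner set"
  assumes "compact X" "convex X" "v \<in> X"
  shows "z \<bullet> v - (v \<bullet> v) / 2 \<le> z \<bullet> proj X z - (proj X z \<bullet> proj X z) / 2
    - ((v - proj X z) \<bullet> (v - proj X z)) / 2"
  using proj_obtuse[OF assms, of z]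
  by (simp add: inner_diff_left inner_diff_right inner_commute field_simps)

section \<open>Geometry of the space forms\<close>

lemma form_commute: "form K p q = form K q p"
  by (simp add: form_def inner_commute)

lemma form_linear [simp]:
  "form K (p + q) w = form K p w + form K q w"
  "form K (p - q) w = form K p w - form K q w"
  "form K (c *\<^sub>R p) w = c * form K p w"
  "form K w (p + q) = form K w p + form K w q"
  "form K w (p - q) = form K w p - form K w q"
  "form K w (c *\<^sub>R p) = c * form K w p"
  "form K (- p) w = - form K p w"
  "form K w (- p) = - form K w p"
  "form K 0 w = 0"
  "form K w 0 = 0"
  by (simp_all add: form_def algebra_simps inner_add_left inner_add_right inner_diff_left
      inner_diff_right)

lemma form_sum_right: "form K w (sum f A) = (\<Sum>i\<in>A. form K w (f i))"
  by (induction A rule: infinite_finite_induct) auto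

lemma form_sum_left: "form K (sum f A) w = (\<Sum>i\<in>A. form K (f i) w)"
  by (induction A rule: infinite_finite_induct) auto

lemma bounded_linear_form: "bounded_linear (form K p)"
  unfolding form_def
  by (intro bounded_linear_add bounded_linear_compose[OF bounded_linear_mult_right bounded_linear_fst]
      bounded_linear_compose[OF bounded_linear_inner_right bounded_linear_snd])

lemma continuous_on_form [continuous_intros]:
  assumes "continuous_on S f" "continuous_on S g"
  shows "continuous_on S (\<lambda>x. form K (f x) (g x))"
  unfolding form_def by (intro continuous_intros assms)

text \<open>An orthonormal basis of \<open>V\<close> is fixed, so that representing vectors and
  bounded extensions of frames can be written as finite sums.\<close>

locale curved =
  fixes K :: real and V :: "'a::real_inner set" and B :: "'a set"
  assumes K: "K = 1 \<or> K = - 1" and V: "subspace V" and B: "orthonormal B" "span B = V"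
begin

abbreviation "S \<equiv> space_form K V"
abbreviation "frm \<equiv> form K"
abbreviation "Tan \<equiv> tangent K V"

lemma KK [simp]: "K * K = 1" "K * (K * a) = a"
  using K by auto

lemma K_nonzero: "K \<noteq> 0"
  using K by auto

lemma cos_sin: "(cosK K t)\<^sup>2 + K * (sinK K t)\<^sup>2 = 1"
  using K by (auto simp: cosK_def sinK_def cosh_square_eq)

lemma S_form: "x \<in> S \<Longrightarrow> frm x x = K"
  by (simp add: space_form_def)

lemma S_V: "x \<in> S \<Longrightarrow> snd x \<in> V"
  by (simp add: space_form_def)

text \<open>Puts the argument of \<open>arccos\<close> or \<open>arcosh\<close> in
  \<open>rdist\<close> into its domain, together with \<open>form_ge\<close> on the sphere. For
  \<open>K = 1\<close> this is Cauchy-Schwarz, for \<open>K = - 1\<close> the reversed inequality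
  for points of one sheet.\<close>

lemma form_le:
  assumes "x \<in> S" "y \<in> S"
  shows "frm x y \<le> K"
proof (cases "K = 1")
  case True
  have "0 \<le> form 1 (x - y) (x - y)" by (simp add: form_def flip: power2_eq_square)
  then have "2 * form 1 x y \<le> form 1 x x + form 1 y y" by (simp add: form_commute)
  then show ?thesis using S_form[OF assms(1)] S_form[OF assms(2)] True by simp
next
  case False
  then have K1: "K = - 1" using K by simp
  define a where "a = norm (snd x)"
  define b where "b = norm (snd y)"
  have x: "(fst x)\<^sup>2 = 1 + a\<^sup>2" "0 < fst x" and y: "(fst y)\<^sup>2 = 1 + b\<^sup>2" "0 < fst y"
    using assms K1 by (auto simp: space_form_def form_def a_def b_def dot_square_norm power2_eq_square)
  have "(1 + a * b)\<^sup>2 \<le> (1 + a\<^sup>2) * (1 + b\<^sup>2)"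
    using zero_le_power2[of "a - b"] by (simp add: power2_eq_square algebra_simps)
  also have "\<dots> = (fst x * fst y)\<^sup>2" by (simp add: power_mult_distrib x y)
  finally have "1 + a * b \<le> fst x * fst y" by (rule power2_le_imp_le) (use x y in auto)
  moreover have "snd x \<bullet> snd y \<le> a * b" by (simp add: a_def b_def norm_cauchy_schwarz)
  ultimately show ?thesis by (simp add: form_def K1)
qed

lemma form_ge: 
  assumes "K = 1" "x \<in> S" "y \<in> S"
  shows "- 1 \<le> frm x y"
proof -
  have "0 \<le> form 1 (x + y) (x + y)" by (simp add: form_def flip: power2_eq_square)
  then have "- 2 * form 1 x y \<le> form 1 x x + form 1 y y" by (simp add: form_commute)
  then show ?thesis using S_form[OF assms(2)] S_form[OF assms(3)] assms(1) by simp
qed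

lemma rdist_nonneg: "x \<in> S \<Longrightarrow> y \<in> S \<Longrightarrow> 0 \<le> rdist K x y"
  using form_le[of x y] form_ge[of x y] K
  by (auto simp: rdist_def intro: arccos_lbound arcosh_nonneg_real)

lemma rdist_le_pi: "K = 1 \<Longrightarrow> x \<in> S \<Longrightarrow> y \<in> S \<Longrightarrow> rdist K x y \<le> pi"
  using form_le[of x y] form_ge[of x y] by (auto simp: rdist_def intro: arccos_ubound)

lemma cosK_rdist: "x \<in> S \<Longrightarrow> y \<in> S \<Longrightarrow> cosK K (rdist K x y) = K * frm x y"
  using form_le[of x y] form_ge[of x y] K
  by (auto simp: rdist_def cosK_def cosh_arcosh_real)

lemma rdist_commute: "rdist K x y = rdist K y x"
  by (simp add: rdist_def form_commute)

lemma rdist_eqI: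
  assumes "0 \<le> t" "K = 1 \<Longrightarrow> t \<le> pi" "cosK K t = K * frm x y"
  shows "rdist K x y = t"
proof (cases "K = 1")
  case True
  then have "form 1 x y = cos t" using assms(3) by (simp add: cosK_def)
  then show ?thesis using True assms(1,2) by (simp add: rdist_def arccos_cos)
next
  case False
  then have "K = - 1" using K by simp
  then have "- frm x y = cosh t" using assms(3) by (simp add: cosK_def)
  then show ?thesis using False assms(1) by (simp add: rdist_def arcosh_cosh_real)
qed

lemma rdist_self: "x \<in> S \<Longrightarrow> rdist K x x = 0"
  by (rule rdist_eqI) (auto simp: S_form cosK_def)

lemma rdist_le_iff:
  assumes "x \<in> S" "y \<in> S" "0 \<le> r" "K = 1 \<Longrightarrow> r \<le> pi"
  shows "rdist K x y \<le> r \<longleftrightarrow> K * cosK K r \<le> frm x y"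
proof (cases "K = 1")
  case True
  have "rdist K x y \<le> r \<longleftrightarrow> cos r \<le> cos (rdist K x y)"
    using rdist_nonneg[OF assms(1,2)] rdist_le_pi[OF True assms(1,2)] assms(3,4) True
    by (subst cos_mono_le_eq) auto
  then show ?thesis using cosK_rdist[OF assms(1,2)] True by (simp add: cosK_def)
next
  case False
  then have K1: "K = - 1" using K by simp
  have "rdist K x y \<le> r \<longleftrightarrow> cosh (rdist K x y) \<le> cosh r"
    using rdist_nonneg[OF assms(1,2)] assms(3) by (subst cosh_real_nonneg_le_iff) auto
  then show ?thesis using cosK_rdist[OF assms(1,2)] K1 by (auto simp: cosK_def)
qed

subsection \<open>Frames and tangent spaces\<close>

lemma tangent_subspace: "subspace (Tan x)"
  using V unfolding subspace_def tangent_def by auto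

text \<open>\<open>E\<close> is parallel transport from the pole \<open>(1, 0)\<close> to
  \<open>b\<close> along a geodesic; for \<open>K = - 1\<close> it is a Lorentz boost. Replacing
  \<open>c\<close> by \<open>- c\<close> where needed keeps the tangent space and avoids the
  antipode of the pole, where the formula would divide by zero.\<close>

lemma frame_exists:
  assumes c: "c \<in> S"
  obtains E where "frame K V c E"
proof -
  define b where "b = (if 0 \<le> fst c then c else - c)"
  have b: "0 \<le> fst b" "frm b b = K" "snd b \<in> V" "Tan b = Tan c"
    using c V K by (auto simp: b_def space_form_def tangent_def subspace_neg)
  define b0 where "b0 = fst b"
  define b' where "b' = snd b"
  have nb: "b' \<bullet> b' = K * (1 - b0\<^sup>2)"
    using b(2) by (simp add: form_def b0_def b'_def power2_eq_square algebra_simps)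
  define k where "k = K / (1 + b0)"
  have b0: "1 + b0 \<noteq> 0" using b(1) by (simp add: b0_def)
  have kb: "k * (b' \<bullet> b') = 1 - b0" "k * (1 + b0) = K"
    unfolding k_def nb using b0 by (simp_all add: field_simps power2_eq_square)
  define E where "E u = (- K * (b' \<bullet> u), u - (k * (b' \<bullet> u)) *\<^sub>R b')" for u
  have lin: "linear E"
    by (rule linearI) (simp_all add: E_def algebra_simps inner_add_right)
  have iso: "frm (E u) (E v) = u \<bullet> v" for u v
  proof -
    have "frm (E u) (E v) = u \<bullet> v + (b' \<bullet> u) * (b' \<bullet> v) * (K - 2 * k + k * (k * (b' \<bullet> b')))"
      by (simp add: E_def form_def inner_diff_left inner_diff_right inner_commute algebra_simps)
    also have "K - 2 * k + k * (k * (b' \<bullet> b')) = K - k * (1 + b0)"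
      unfolding kb(1) by (simp add: algebra_simps)
    finally show ?thesis using kb(2) by simp
  qed
  have "E ` V = Tan b"
  proof (intro equalityI subsetI)
    fix v assume "v \<in> E ` V"
    then obtain u where u: "u \<in> V" "v = E u" by blast
    have "frm b v = (b' \<bullet> u) * (1 - b0 - k * (b' \<bullet> b'))"
      unfolding u(2) E_def form_def b0_def[symmetric] b'_def[symmetric]
      by (simp add: inner_diff_right algebra_simps)
    then have "frm b v = 0" using kb(1) by simp
    then show "v \<in> Tan b"
      using V b(3) u by (auto simp: tangent_def E_def b'_def intro!: subspace_diff subspace_scale)
  next
    fix v assume v: "v \<in> Tan b"
    define u where "u = snd v - (fst v / (1 + b0)) *\<^sub>R b'"
    have fv: "b' \<bullet> snd v = - K * b0 * fst v"
      using v by (simp add: tangent_def form_def b0_def b'_def)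
    have bu: "b' \<bullet> u = - K * fst v"
      unfolding u_def inner_diff_right inner_scaleR_right fv nb using b0
      by (simp add: field_simps power2_eq_square)
    have "E u = v"
      unfolding E_def bu by (simp add: prod_eq_iff u_def k_def)
    moreover have "u \<in> V"
      using V v b(3) by (auto simp: u_def tangent_def b'_def intro!: subspace_diff subspace_scale)
    ultimately show "v \<in> E ` V" by blast
  qed
  then have "frame K V c E" using lin iso b(4) by (simp add: frame_def)
  then show ?thesis using that by blast
qed

text \<open>For \<open>K = - 1\<close> the form is indefinite on the ambient space, but a frame
  identifies its restriction to the tangent space with the inner product of
  \<open>V\<close>.\<close>

lemma
  assumes x: "x \<in> S" and v: "v \<in> Tan x"
  shows tangent_form_nonneg: "0 \<le> frm v v"
    and tangent_form_zero: "frm v v = 0 \<Longrightarrow> v = 0"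
proof -
  obtain E where E: "frame K V x E" by (rule frame_exists[OF x])
  then have "v \<in> E ` V" using v by (simp add: frame_def)
  then obtain u where u: "u \<in> V" "v = E u" by blast
  then have eq: "frm v v = u \<bullet> u" using E by (simp add: frame_def)
  then show "0 \<le> frm v v" by simp
  have "E 0 = 0" using E by (simp add: frame_def linear_0)
  then show "frm v v = 0 \<Longrightarrow> v = 0" using eq u by simp
qed

lemma tangent_cauchy_schwarz:
  assumes x: "x \<in> S" and vw: "v \<in> Tan x" "w \<in> Tan x"
  shows "\<bar>frm v w\<bar> \<le> rnorm K v * rnorm K w"
proof -
  obtain E where E: "frame K V x E" by (rule frame_exists[OF x])
  then have "v \<in> E ` V" "w \<in> E ` V" using vw by (simp_all add: frame_def)
  then obtain u u' where u: "u \<in> V" "v = E u" "u' \<in> V" "w = E u'" by blast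
  then have "frm v v = u \<bullet> u" "frm w w = u' \<bullet> u'" "frm v w = u \<bullet> u'" using E by (simp_all add: frame_def)
  then show ?thesis
    unfolding rnorm_def using Cauchy_Schwarz_ineq2[of u u'] by (simp add: norm_eq_sqrt_inner)
qed

lemma rnorm_sq: "x \<in> S \<Longrightarrow> v \<in> Tan x \<Longrightarrow> (rnorm K v)\<^sup>2 = frm v v"
  using tangent_form_nonneg by (simp add: rnorm_def)

lemma normal_part:
  assumes "x \<in> S" "snd y \<in> V"
  shows "y - (K * frm x y) *\<^sub>R x \<in> Tan x"
  using assms V by (auto simp: tangent_def S_form S_V intro!: subspace_diff subspace_scale)

lemma normal_part_form:
  assumes "x \<in> S"
  shows "frm (y - (K * frm x y) *\<^sub>R x) (y - (K * frm x y) *\<^sub>R x) = frm y y - K * (frm x y)\<^sup>2"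
  using assms by (simp add: S_form form_commute[of K y x] power2_eq_square algebra_simps)

lemma sinK_rdist_sq:
  assumes "x \<in> S" "y \<in> S"
  shows "(sinK K (rdist K x y))\<^sup>2 = K * (1 - (frm x y)\<^sup>2)"
proof -
  have "K * (K * (sinK K (rdist K x y))\<^sup>2) = K * (1 - (K * frm x y)\<^sup>2)"
    using cos_sin[of "rdist K x y"] cosK_rdist[OF assms] by algebra
  moreover have "(K * frm x y)\<^sup>2 = (frm x y)\<^sup>2"
    by (simp add: power_mult_distrib) (simp add: power2_eq_square)
  ultimately show ?thesis by simp
qed

lemma sinK_nonneg: "0 \<le> t \<Longrightarrow> (K = 1 \<Longrightarrow> t \<le> pi) \<Longrightarrow> 0 \<le> sinK K t"
  by (auto simp: sinK_def sin_ge_zero)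

lemma sinK_pos: "0 < t \<Longrightarrow> (K = 1 \<Longrightarrow> t < pi) \<Longrightarrow> 0 < sinK K t"
  by (auto simp: sinK_def sin_gt_zero)

lemma rdist_eq_0:
  assumes "x \<in> S" "y \<in> S" "rdist K x y = 0"
  shows "x = y"
proof -
  have f: "K * frm x y = 1" using cosK_rdist[OF assms(1,2)] assms(3) by (auto simp: cosK_def split: if_splits)
  then have fx: "frm x y = K" using KK(2)[of "frm x y"] by simp
  have "frm (y - x) (y - x) = 0"
    using assms by (simp add: S_form form_commute[of K y x] fx)
  moreover have "y - x \<in> Tan x"
    using normal_part[OF assms(1) S_V[OF assms(2)]] f by simp
  ultimately have "y - x = 0" using tangent_form_zero[OF assms(1)] by blast
  then show ?thesis by simp
qed

subsection \<open>Exponential map and metric balls\<close>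

text \<open>On both sheets the first component dominates the norm of the second, so it decides the
  sign of the form: points of opposite sheets pair positively.\<close>

lemma upper_sheet:
  assumes K1: "K = - 1" and x: "x \<in> S" and z: "frm z z = K" "frm x z < 0"
  shows "0 < fst z"
proof -
  have x0: "0 < fst x" "frm x x = - 1" using x K1 by (auto simp: space_form_def)
  have "norm (snd x) < fst x" "norm (snd z) < \<bar>fst z\<bar>"
    using x0 z(1) K1 by (auto simp: form_def dot_square_norm power2_eq_square[symmetric]
        intro: power2_less_imp_less abs_square_less_1 simp flip: abs_le_square_iff)
  then have "\<bar>snd x \<bullet> snd z\<bar> \<le> fst x * \<bar>fst z\<bar>"
    using Cauchy_Schwarz_ineq2[of "snd x" "snd z"] mult_mono[of "norm (snd x)" "fst x" "norm (snd z)" "\<bar>fst z\<bar>"]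
      x0 by auto
  then have "snd x \<bullet> snd z \<ge> - (fst x * \<bar>fst z\<bar>)" by linarith
  moreover have "0 < fst x * fst z - snd x \<bullet> snd z" using z(2) by (simp add: form_def K1)
  ultimately have "0 < fst x * (fst z + \<bar>fst z\<bar>)" unfolding distrib_left by linarith
  then have "0 < fst z + \<bar>fst z\<bar>" using x0 by (simp add: zero_less_mult_iff)
  then show ?thesis by simp
qed

lemma exp_map_in:
  assumes x: "x \<in> S" and v: "v \<in> Tan x"
  shows "exp_map K x v \<in> S" "frm x (exp_map K x v) = K * cosK K (rnorm K v)"
proof -
  define t where "t = rnorm K v"
  define k where "k = sinK K t / t"
  have y: "exp_map K x v = cosK K t *\<^sub>R x + k *\<^sub>R v" by (simp add: exp_map_def t_def k_def)
  have xv: "frm x v = 0" using v by (simp add: tangent_def)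
  have vv: "frm v v = t\<^sup>2" using rnorm_sq[OF x v] by (simp add: t_def)
  have kt: "k\<^sup>2 * t\<^sup>2 = (sinK K t)\<^sup>2"
    by (cases "t = 0") (auto simp: k_def sinK_def power_divide)
  show fx: "frm x (exp_map K x v) = K * cosK K (rnorm K v)"
    unfolding y using xv x by (simp add: S_form t_def)
  have "frm (exp_map K x v) (exp_map K x v) = (cosK K t)\<^sup>2 * K + k\<^sup>2 * t\<^sup>2"
    unfolding y using xv x vv by (simp add: S_form form_commute[of K v x] power2_eq_square)
  also have "\<dots> = K * ((cosK K t)\<^sup>2 + K * (sinK K t)\<^sup>2)" unfolding kt by (simp add: algebra_simps)
  also have "\<dots> = K" using cos_sin by simp
  finally have form: "frm (exp_map K x v) (exp_map K x v) = K" .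
  have V': "snd (exp_map K x v) \<in> V"
    unfolding y using V x v by (auto simp: tangent_def S_V intro!: subspace_add subspace_scale)
  have "0 < fst (exp_map K x v)" if K1: "K = - 1"
  proof (rule upper_sheet[OF K1 x])
    show "frm (exp_map K x v) (exp_map K x v) = K" by (rule form)
    show "frm x (exp_map K x v) < 0"
      unfolding fx using K1 cosh_real_pos by (simp add: cosK_def)
  qed
  then show "exp_map K x v \<in> S" using form V' by (simp add: space_form_def)
qed

text \<open>\<open>v\<close> is the component of \<open>y\<close> tangent at \<open>x\<close>,
  rescaled from length \<open>sinK K t\<close> to length \<open>t\<close>. Below distance
  \<open>pi\<close> a tangent vector of length \<open>t\<close> is determined by its image, which
  resolves the description in \<open>exp_inv\<close>. For \<open>t = 0\<close> the quotient is 0 / 0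
  = 0, and \<open>v = 0\<close> is the right vector.\<close>

lemma
  assumes x: "x \<in> S" and y: "y \<in> S" and lt: "K = 1 \<longrightarrow> rdist K x y < pi"
  defines "t \<equiv> rdist K x y"
  defines "v \<equiv> (t / sinK K t) *\<^sub>R (y - (K * frm x y) *\<^sub>R x)"
  shows exp_inv_eq: "exp_inv K V x y = v" and exp_inv_tangent: "v \<in> Tan x"
    and exp_inv_exp: "exp_map K x v = y" and exp_inv_norm: "rnorm K v = t"
proof -
  define P where "P = y - (K * frm x y) *\<^sub>R x"
  have P: "P \<in> Tan x" unfolding P_def by (rule normal_part[OF x S_V[OF y]])
  have t0: "0 \<le> t" unfolding t_def by (rule rdist_nonneg[OF x y])
  have st: "0 < sinK K t" if "t \<noteq> 0" using that t0 lt by (intro sinK_pos) (auto simp: t_def)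
  have vP: "v = (t / sinK K t) *\<^sub>R P" by (simp add: v_def P_def)
  show tan: "v \<in> Tan x" unfolding vP using P by (intro subspace_scale tangent_subspace)
  have PP: "frm P P = (sinK K t)\<^sup>2"
    unfolding P_def normal_part_form[OF x] t_def sinK_rdist_sq[OF x y]
    using y by (simp add: S_form algebra_simps)
  have "frm v v = (t / sinK K t)\<^sup>2 * (sinK K t)\<^sup>2"
    unfolding vP by (simp add: PP power2_eq_square)
  also have "\<dots> = t\<^sup>2" using st by (cases "t = 0") (auto simp: power_divide)
  finally show nv: "rnorm K v = t" using t0 by (simp add: rnorm_def)
  have c: "cosK K t = K * frm x y" unfolding t_def by (rule cosK_rdist[OF x y])
  show ev: "exp_map K x v = y"
  proof (cases "t = 0")
    case True
    then have "x = y" using rdist_eq_0[OF x y] by (simp add: t_def)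
    then show ?thesis unfolding exp_map_def nv vP using True by (simp add: cosK_def rnorm_def)
  next
    case False
    then have "(sinK K t / t) * (t / sinK K t) = 1" using st by simp
    then show ?thesis
      unfolding exp_map_def nv c unfolding vP P_def scaleR_scaleR by simp
  qed
  have uniq: "w = v" if w: "w \<in> Tan x" "exp_map K x w = y" "rnorm K w = t" for w
  proof (cases "t = 0")
    case True
    then have "frm w w = 0" "frm v v = 0"
      using w(3) nv by (simp_all flip: rnorm_sq[OF x w(1)] rnorm_sq[OF x tan])
    then have "w = 0" "v = 0" using tangent_form_zero[OF x] w(1) tan by blast+
    then show ?thesis by simp
  next
    case False
    have "(sinK K t / t) *\<^sub>R w = (sinK K t / t) *\<^sub>R v"
      using w(2) ev unfolding exp_map_def w(3) nv by (metis add_left_cancel)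
    then show ?thesis using st[OF False] False by simp
  qed
  show "exp_inv K V x y = v"
    unfolding exp_inv_def t_def[symmetric]
  proof (rule the_equality)
    show "v \<in> Tan x \<and> exp_map K x v = y \<and> rnorm K v = t" using tan ev nv by blast
  qed (use uniq in blast)
qed

text \<open>A ball is cut out of the space form by one linear inequality of the ambient space; in
  charts it is used only in this form.\<close>

lemma rcball_eq:
  assumes x: "x \<in> S" and r: "0 \<le> r" "K = 1 \<Longrightarrow> r < pi"
  shows "rcball K V x r = {y \<in> S. K * cosK K r \<le> frm x y}"
proof (intro equalityI subsetI)
  fix y assume "y \<in> rcball K V x r"
  then obtain v where v: "v \<in> Tan x" "rnorm K v \<le> r" "y = exp_map K x v"
    by (auto simp: rcball_def)
  have y: "y \<in> S" "frm x y = K * cosK K (rnorm K v)"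
    unfolding v(3) by (rule exp_map_in[OF x v(1)])+
  have n0: "0 \<le> rnorm K v" using tangent_form_nonneg[OF x v(1)] by (simp add: rnorm_def)
  have "rdist K x y = rnorm K v"
    by (rule rdist_eqI) (use n0 v r y in auto)
  then show "y \<in> {y \<in> S. K * cosK K r \<le> frm x y}"
    using rdist_le_iff[OF x y(1), of r] r v y by (simp add: less_imp_le)
next
  fix y assume "y \<in> {y \<in> S. K * cosK K r \<le> frm x y}"
  then have y: "y \<in> S" "rdist K x y \<le> r" using rdist_le_iff[OF x, of y r] r by (simp_all add: less_imp_le)
  then have lt: "K = 1 \<longrightarrow> rdist K x y < pi" using r by auto
  show "y \<in> rcball K V x r"
    using exp_inv_tangent[OF x y(1) lt] exp_inv_exp[OF x y(1) lt] exp_inv_norm[OF x y(1) lt] y(2)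
    unfolding rcball_def by (metis (mono_tags, lifting) image_eqI mem_Collect_eq)
qed

text \<open>A tangent \<open>g\<close> annihilates the \<open>x\<close>-component of
  \<open>exp_inv\<close>. Up to a scalar that depends only on the distance, the pairing is therefore
  linear in the endpoint \<open>y\<close>.\<close>

lemma form_exp_inv:
  assumes x: "x \<in> S" and y: "y \<in> S" and lt: "K = 1 \<longrightarrow> rdist K x y < pi" and g: "g \<in> Tan x"
  shows "frm g (exp_inv K V x y) = rdist K x y / sinK K (rdist K x y) * frm g y"
proof -
  have "frm g x = 0" using g form_commute[of K g x] by (simp add: tangent_def)
  then show ?thesis unfolding exp_inv_eq[OF x y lt] by simp
qed

end

section \<open>Trigonometric estimates\<close>

lemma x_cos_le_sin:
  assumes "0 \<le> x" "x \<le> pi"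
  shows "x * cos x \<le> sin x"
proof -
  have "sin 0 - 0 * cos 0 \<le> sin x - x * cos x"
  proof (rule DERIV_nonneg_imp_nondecreasing[OF assms(1), where f = "\<lambda>x. sin x - x * cos x"])
    fix t assume t: "0 \<le> t" "t \<le> x"
    have "((\<lambda>x. sin x - x * cos x) has_real_derivative t * sin t) (at t)"
      by (auto intro!: derivative_eq_intros)
    moreover have "0 \<le> t * sin t" using t assms by (intro mult_nonneg_nonneg sin_ge_zero) auto
    ultimately show "\<exists>y. ((\<lambda>x. sin x - x * cos x) has_real_derivative y) (at t) \<and> 0 \<le> y" by blast
  qed
  then show ?thesis by simp
qed

lemma sinh_le_x_cosh:
  fixes x :: real
  assumes "0 \<le> x"
  shows "sinh x \<le> x * cosh x"
proof -
  have "0 * cosh 0 - sinh 0 \<le> x * cosh x - sinh x"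
  proof (rule DERIV_nonneg_imp_nondecreasing[OF assms(1), where f = "\<lambda>x. x * cosh x - sinh x"])
    fix t assume t: "0 \<le> t" "t \<le> x"
    have "((\<lambda>x. x * cosh x - sinh x) has_real_derivative t * sinh t) (at t)"
      by (auto intro!: derivative_eq_intros)
    moreover have "0 \<le> t * sinh t" using t by simp
    ultimately show "\<exists>y. ((\<lambda>x. x * cosh x - sinh x) has_real_derivative y) (at t) \<and> 0 \<le> y" by blast
  qed
  then show ?thesis by simp
qed

lemma x_le_sinh:
  fixes x :: real
  assumes "0 \<le> x"
  shows "x \<le> sinh x"
proof -
  have "sinh 0 - 0 \<le> sinh x - x"
  proof (rule DERIV_nonneg_imp_nondecreasing[OF assms, where f = "\<lambda>x. sinh x - x"])
    fix t :: real
    have "((\<lambda>x. sinh x - x) has_real_derivative cosh t - 1) (at t)"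
      by (auto intro!: derivative_eq_intros)
    then show "\<exists>y. ((\<lambda>x. sinh x - x) has_real_derivative y) (at t) \<and> 0 \<le> y"
      using cosh_real_ge_1[of t] by fastforce
  qed
  then show ?thesis by simp
qed

lemma sin_ratio_antimono:
  assumes "0 < a" "a \<le> b" "b \<le> pi"
  shows "a * sin b \<le> b * sin a"
proof -
  have "sin b / b \<le> sin a / a"
  proof (rule DERIV_nonpos_imp_nonincreasing[OF assms(2), where f = "\<lambda>x. sin x / x"])
    fix t assume t: "a \<le> t" "t \<le> b"
    have "((\<lambda>x. sin x / x) has_real_derivative (cos t * t - sin t * 1) / (t * t)) (at t)"
      using t assms by (auto intro!: derivative_eq_intros)
    moreover have "(cos t * t - sin t * 1) / (t * t) \<le> 0"
      using x_cos_le_sin[of t] t assms by (intro divide_nonpos_pos) (auto simp: mult.commute)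
    ultimately show "\<exists>y. ((\<lambda>x. sin x / x) has_real_derivative y) (at t) \<and> y \<le> 0" by blast
  qed
  then show ?thesis using assms by (simp add: field_simps)
qed

lemma sinh_ratio_mono:
  fixes a b :: real
  assumes "0 < a" "a \<le> b"
  shows "b * sinh a \<le> a * sinh b"
proof -
  have "sinh a / a \<le> sinh b / b"
  proof (rule DERIV_nonneg_imp_nondecreasing[OF assms(2), where f = "\<lambda>x. sinh x / x"])
    fix t assume t: "a \<le> t" "t \<le> b"
    have "((\<lambda>x. sinh x / x) has_real_derivative (cosh t * t - sinh t * 1) / (t * t)) (at t)"
      using t assms by (auto intro!: derivative_eq_intros)
    moreover have "(cosh t * t - sinh t * 1) / (t * t) \<ge> 0"
      using sinh_le_x_cosh[of t] t assms by (intro divide_nonneg_pos) (auto simp: mult.commute)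
    ultimately show "\<exists>y. ((\<lambda>x. sinh x / x) has_real_derivative y) (at t) \<and> 0 \<le> y" by blast
  qed
  then show ?thesis using assms by (simp add: field_simps)
qed

text \<open>\<alpha> and \<beta> stand for the distances of two points from the center and \<theta>
  for their mutual distance; \<open>tri\<close> encodes the triangle inequality \<theta> \<le>
  \<alpha> + \<beta>. Since sin x / x decreases, the upper bound reduces to \<theta> = \<alpha> +
  \<beta>, where \<open>x_cos_le_sin\<close> applies to each summand of the addition
  formula.\<close>

lemma spherical_tilt_bounds:
  assumes r: "r < pi / 2" and \<alpha>: "0 \<le> \<alpha>" "\<alpha> \<le> r" and \<beta>: "0 \<le> \<beta>" "\<beta> \<le> r"
    and \<theta>: "0 < \<theta>" "\<theta> < pi" and tri: "cos (\<alpha> + \<beta>) \<le> cos \<theta>"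
  shows "(cos r)\<^sup>2 \<le> \<theta> / sin \<theta> * (cos \<beta> / cos \<alpha>)" "\<theta> / sin \<theta> * (cos \<beta> / cos \<alpha>) \<le> 1 / (cos r) ^ 3"
proof -
  have le: "\<theta> \<le> \<alpha> + \<beta>"
    using tri \<theta> \<alpha> \<beta> r by (subst (asm) cos_mono_le_eq) auto
  have pos: "0 < cos r" "0 < cos \<alpha>" "0 < cos \<beta>" "0 < sin \<theta>"
    using r \<alpha> \<beta> \<theta> by (auto intro!: cos_gt_zero_pi sin_gt_zero)
  have mono: "cos r \<le> cos \<alpha>" "cos r \<le> cos \<beta>" "cos \<alpha> \<le> 1"
    using r \<alpha> \<beta> by (auto intro!: cos_monotone_0_pi_le)
  have sins: "sin \<theta> \<le> \<theta>" by (rule sin_x_le_x) (use \<theta> in auto)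
  have ratio: "cos r \<le> cos \<beta> / cos \<alpha>"
  proof -
    have "cos r * cos \<alpha> \<le> cos \<beta> * 1" using pos mono by (intro mult_mono) auto
    then show ?thesis using pos by (simp add: field_simps)
  qed
  have "(cos r)\<^sup>2 \<le> 1 * cos r" using pos unfolding power2_eq_square by (intro mult_right_mono) auto
  also have "\<dots> \<le> \<theta> / sin \<theta> * (cos \<beta> / cos \<alpha>)"
    using sins pos ratio by (intro mult_mono) auto
  finally show "(cos r)\<^sup>2 \<le> \<theta> / sin \<theta> * (cos \<beta> / cos \<alpha>)" .
  have c2: "(cos r)\<^sup>2 \<le> cos \<alpha>" "(cos r)\<^sup>2 \<le> cos \<beta>"
  proof -
    have "(cos r)\<^sup>2 \<le> cos r" using pos unfolding power2_eq_square by (simp add: mult_left_le)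
    then show "(cos r)\<^sup>2 \<le> cos \<alpha>" "(cos r)\<^sup>2 \<le> cos \<beta>" using mono by auto
  qed
  have xc: "\<alpha> * cos \<alpha> \<le> sin \<alpha>" "\<beta> * cos \<beta> \<le> sin \<beta>"
    using \<alpha> \<beta> r by (auto intro!: x_cos_le_sin)
  have "\<alpha> * (cos r)\<^sup>2 * cos \<beta> \<le> sin \<alpha> * cos \<beta>"
  proof -
    have "\<alpha> * (cos r)\<^sup>2 \<le> \<alpha> * cos \<alpha>" using c2 \<alpha> by (intro mult_left_mono) auto
    then show ?thesis using xc pos by (intro mult_right_mono) auto
  qed
  moreover have "\<beta> * (cos r)\<^sup>2 * cos \<beta> \<le> cos \<alpha> * sin \<beta>"
  proof -
    have "(cos r)\<^sup>2 * (\<beta> * cos \<beta>) \<le> cos \<alpha> * sin \<beta>"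
      using c2 xc pos \<beta> by (intro mult_mono) auto
    then show ?thesis by (simp add: mult_ac)
  qed
  ultimately have key: "(\<alpha> + \<beta>) * ((cos r)\<^sup>2 * cos \<beta>) \<le> sin (\<alpha> + \<beta>)"
    by (simp add: sin_add algebra_simps)
  have ab: "0 < \<alpha> + \<beta>" "\<alpha> + \<beta> \<le> pi" using le \<theta> \<alpha> \<beta> r by auto
  have "(\<alpha> + \<beta>) * (\<theta> * ((cos r)\<^sup>2 * cos \<beta>)) = \<theta> * ((\<alpha> + \<beta>) * ((cos r)\<^sup>2 * cos \<beta>))" by (simp add: mult_ac)
  also have "\<dots> \<le> \<theta> * sin (\<alpha> + \<beta>)" using key \<theta> by (intro mult_left_mono) auto
  also have "\<dots> \<le> (\<alpha> + \<beta>) * sin \<theta>" by (rule sin_ratio_antimono[OF \<theta>(1) le ab(2)])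
  finally have "\<theta> * ((cos r)\<^sup>2 * cos \<beta>) \<le> sin \<theta>" using ab by simp
  then have "\<theta> * ((cos r)\<^sup>2 * cos \<beta>) * cos r \<le> sin \<theta> * cos \<alpha>"
    using pos mono \<theta> by (intro mult_mono) auto
  then have "\<theta> * cos \<beta> * (cos r) ^ 3 \<le> sin \<theta> * cos \<alpha>"
    by (simp add: power2_eq_square power3_eq_cube mult_ac)
  then show "\<theta> / sin \<theta> * (cos \<beta> / cos \<alpha>) \<le> 1 / (cos r) ^ 3"
    using pos by (simp add: field_simps)
qed

text \<open>The same reduction with sinh x / x increasing. Now it is the lower bound that uses the
  triangle inequality.\<close>

lemma hyperbolic_tilt_bounds:
  fixes r :: real
  assumes \<alpha>: "0 \<le> \<alpha>" "\<alpha> \<le> r" and \<beta>: "0 \<le> \<beta>" "\<beta> \<le> r"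
    and \<theta>: "0 < \<theta>" and tri: "cosh \<theta> \<le> cosh (\<alpha> + \<beta>)"
  shows "1 / (cosh r) ^ 3 \<le> \<theta> / sinh \<theta> * (cosh \<beta> / cosh \<alpha>)" "\<theta> / sinh \<theta> * (cosh \<beta> / cosh \<alpha>) \<le> (cosh r)\<^sup>2"
proof -
  have le: "\<theta> \<le> \<alpha> + \<beta>"
    using tri \<theta> \<alpha> \<beta> by (subst (asm) cosh_real_nonneg_le_iff) auto
  have ge1: "1 \<le> cosh r" "1 \<le> cosh \<alpha>" "1 \<le> cosh \<beta>" by (auto intro: cosh_real_ge_1)
  have mono: "cosh \<alpha> \<le> cosh r" "cosh \<beta> \<le> cosh r"
    using \<alpha> \<beta> by (auto simp: cosh_real_nonneg_le_iff)
  have sp: "0 < sinh \<theta>" using \<theta> by simp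
  have "\<theta> \<le> sinh \<theta>" using \<theta> by (intro x_le_sinh) simp
  then have "\<theta> / sinh \<theta> \<le> 1" using sp by simp
  moreover have "cosh \<beta> / cosh \<alpha> \<le> cosh r / 1" using ge1 mono by (intro frac_le) auto
  ultimately have "\<theta> / sinh \<theta> * (cosh \<beta> / cosh \<alpha>) \<le> 1 * cosh r"
    using \<theta> sp ge1 by (intro mult_mono) auto
  also have "\<dots> \<le> (cosh r)\<^sup>2" using ge1 unfolding power2_eq_square by (intro mult_right_mono) auto
  finally show "\<theta> / sinh \<theta> * (cosh \<beta> / cosh \<alpha>) \<le> (cosh r)\<^sup>2" .
  have xc: "sinh \<alpha> \<le> \<alpha> * cosh \<alpha>" "sinh \<beta> \<le> \<beta> * cosh \<beta>" using \<alpha> \<beta> by (auto intro: sinh_le_x_cosh)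
  have "sinh \<alpha> * cosh \<beta> * cosh \<alpha> \<le> (\<alpha> * cosh r) * cosh \<beta> * (cosh r * cosh r)"
  proof -
    have "\<alpha> * cosh \<alpha> \<le> \<alpha> * cosh r" using mono \<alpha> by (intro mult_left_mono) auto
    then have a: "sinh \<alpha> \<le> \<alpha> * cosh r" using xc by linarith
    have "cosh \<alpha> * 1 \<le> cosh r * cosh r" using mono ge1 by (intro mult_mono) auto
    then show ?thesis using a ge1 \<alpha> by (intro mult_mono) (auto intro: mult_nonneg_nonneg)
  qed
  moreover have "cosh \<alpha> * sinh \<beta> * cosh \<alpha> \<le> cosh r * (\<beta> * cosh \<beta>) * (cosh r * cosh r)"
  proof -
    have "cosh \<alpha> * 1 \<le> cosh r * cosh r" using mono ge1 by (intro mult_mono) auto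
    then show ?thesis using xc mono ge1 \<beta> by (intro mult_mono) auto
  qed
  moreover have "sinh (\<alpha> + \<beta>) * cosh \<alpha> = sinh \<alpha> * cosh \<beta> * cosh \<alpha> + cosh \<alpha> * sinh \<beta> * cosh \<alpha>"
    by (simp add: sinh_add algebra_simps)
  moreover have "(\<alpha> + \<beta>) * (cosh \<beta> * (cosh r) ^ 3) =
      (\<alpha> * cosh r) * cosh \<beta> * (cosh r * cosh r) + cosh r * (\<beta> * cosh \<beta>) * (cosh r * cosh r)"
    by (simp add: power3_eq_cube algebra_simps)
  ultimately have key: "sinh (\<alpha> + \<beta>) * cosh \<alpha> \<le> (\<alpha> + \<beta>) * (cosh \<beta> * (cosh r) ^ 3)"
    by linarith
  have ab: "0 < \<alpha> + \<beta>" using le \<theta> by linarith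
  have "(\<alpha> + \<beta>) * (sinh \<theta> * cosh \<alpha>) \<le> \<theta> * sinh (\<alpha> + \<beta>) * cosh \<alpha>"
    using mult_right_mono[OF sinh_ratio_mono[OF \<theta> le], of "cosh \<alpha>"] ge1 by (simp add: mult_ac)
  also have "\<dots> \<le> \<theta> * ((\<alpha> + \<beta>) * (cosh \<beta> * (cosh r) ^ 3))"
    using key \<theta> unfolding mult.assoc by (intro mult_left_mono) auto
  finally have "sinh \<theta> * cosh \<alpha> \<le> \<theta> * (cosh \<beta> * (cosh r) ^ 3)"
    using ab by (simp add: mult.left_commute[of \<theta>])
  then show "1 / (cosh r) ^ 3 \<le> \<theta> / sinh \<theta> * (cosh \<beta> / cosh \<alpha>)"
    using sp ge1 by (simp add: field_simps)
qed

text \<open>A linear error is enough: in the expansion of \<open>f\<close> it multiplies a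
  first-order term and so becomes quadratic.\<close>

lemma sin_ratio_near_1:
  fixes t :: real
  assumes "0 < t" "t \<le> 1"
  shows "\<bar>t / sin t - 1\<bar> \<le> t"
proof -
  have s: "0 < sin t" using assms pi_gt3 by (intro sin_gt_zero) linarith+
  have "1 - 2 * (sin (t / 2))\<^sup>2 = cos t" using cos_double_sin[of "t / 2"] by simp
  moreover have "(sin (t / 2))\<^sup>2 \<le> (t / 2)\<^sup>2"
    using abs_sin_x_le_abs_x[of "t / 2"] unfolding abs_le_square_iff .
  ultimately have "1 - t\<^sup>2 / 2 \<le> cos t" by (simp add: power_divide)
  then have "(1 + t) * (1 - t\<^sup>2 / 2) \<le> (1 + t) * cos t" using assms by (intro mult_left_mono) auto
  moreover have "1 \<le> (1 + t) * (1 - t\<^sup>2 / 2)"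
  proof -
    have "t * t \<le> t * 1" "t * (t * t) \<le> t * 1"
      using assms by (auto intro!: mult_left_mono mult_le_one)
    moreover have "(1 + t) * (1 - t\<^sup>2 / 2) = 1 + t - (t * t) / 2 - (t * (t * t)) / 2"
      by (simp add: power2_eq_square field_simps)
    ultimately show ?thesis by linarith
  qed
  ultimately have "1 \<le> (1 + t) * cos t" by linarith
  then have "t * 1 \<le> t * ((1 + t) * cos t)" using assms by (intro mult_left_mono) auto
  also have "\<dots> = (1 + t) * (t * cos t)" by simp
  also have "\<dots> \<le> (1 + t) * sin t"
    using assms pi_gt3 by (intro mult_left_mono x_cos_le_sin) auto
  finally have "t / sin t \<le> 1 + t" using s by (simp add: field_simps)
  moreover have "1 \<le> t / sin t" using sin_x_le_x[of t] assms s by simp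
  ultimately show ?thesis by linarith
qed

lemma sinh_ratio_near_1:
  fixes t :: real
  assumes "0 < t"
  shows "\<bar>t / sinh t - 1\<bar> \<le> t"
proof -
  have s: "0 < sinh t" using assms by simp
  have "(1 - t) * cosh t \<le> 1"
  proof (cases "1 \<le> t")
    case True
    then have "(1 - t) * cosh t \<le> 0" by (intro mult_nonpos_nonneg) auto
    then show ?thesis by simp
  next
    case False
    have "cosh t \<le> exp t" using assms by (simp add: cosh_def)
    moreover have "1 - t \<le> exp (- t)" using exp_ge_add_one_self[of "- t"] by simp
    ultimately have "(1 - t) * cosh t \<le> exp (- t) * exp t" by (intro mult_mono) auto
    then show ?thesis by (simp flip: exp_add)
  qed
  then have "t * ((1 - t) * cosh t) \<le> t * 1" using assms by (intro mult_left_mono) auto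
  moreover have "(1 - t) * sinh t \<le> max 0 ((1 - t) * (t * cosh t))"
  proof (cases "1 \<le> t")
    case True
    then have "(1 - t) * sinh t \<le> 0" using s by (intro mult_nonpos_nonneg) auto
    then show ?thesis by simp
  next
    case False
    then have "(1 - t) * sinh t \<le> (1 - t) * (t * cosh t)"
      using assms sinh_le_x_cosh[of t] by (intro mult_left_mono) auto
    then show ?thesis by simp
  qed
  moreover have "(1 - t) * (t * cosh t) = t * ((1 - t) * cosh t)" by simp
  ultimately have "(1 - t) * sinh t \<le> t" using assms by linarith
  then have "1 - t \<le> t / sinh t" using s by (simp add: field_simps)
  moreover have "t / sinh t \<le> 1" using x_le_sinh[of t] assms s by simp
  ultimately show ?thesis using assms by linarith
qed

section \<open>Gnomonic and Beltrami--Klein charts\<close>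

text \<open>\<open>kappa\<close> controls all distortions of the chart of radius \<open>r\<close>, and \<open>tau\<close> is the Euclidean
  radius of the image of the ball.\<close>

definition kappa :: "real \<Rightarrow> real \<Rightarrow> real" where
  "kappa K r = (if K = 1 then 1 / cos r else cosh r)"

definition tau :: "real \<Rightarrow> real \<Rightarrow> real" where
  "tau K r = sinK K r / cosK K r"

locale chart = curved +
  fixes c :: "real \<times> 'a" and E :: "'a \<Rightarrow> real \<times> 'a" and r :: real
  assumes c: "c \<in> S" and frame: "frame K V c E" and r: "0 < r" "K = 1 \<longrightarrow> r < pi / 2"
begin

text \<open>The factor that normalises \<open>c + E u\<close>. It is the reciprocal of
  \<open>cosK\<close> of the distance from \<open>c\<close> to \<open>pt u\<close>.\<close>

definition s :: "'a \<Rightarrow> real" where "s u = sqrt (1 + K * (u \<bullet> u))"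

abbreviation "pt \<equiv> h_inv K c E"
abbreviation "\<kappa> \<equiv> kappa K r"
abbreviation "\<tau> \<equiv> tau K r"

definition U :: "'a set" where "U = {u \<in> V. norm u \<le> \<tau>}"

lemma cosK_pos: "0 < cosK K r"
  using r by (auto simp: cosK_def intro!: cos_gt_zero_pi)

lemma kappa_ge_1: "1 \<le> \<kappa>"
  using cosK_pos by (auto simp: kappa_def cosK_def cosh_real_ge_1)

lemma tau_nonneg: "0 \<le> \<tau>"
  unfolding tau_def using cosK_pos r sinK_nonneg[of r] by auto

lemma tau_pos: "0 < \<tau>"
  unfolding tau_def using cosK_pos r sinK_pos[of r] by auto

lemma one_plus_tau: "1 + K * \<tau>\<^sup>2 = 1 / (cosK K r)\<^sup>2"
proof -
  have "1 + K * \<tau>\<^sup>2 = ((cosK K r)\<^sup>2 + K * (sinK K r)\<^sup>2) / (cosK K r)\<^sup>2"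
    unfolding tau_def using cosK_pos by (simp add: power_divide add_divide_distrib)
  then show ?thesis using cos_sin[of r] by simp
qed

lemma tau_le: "\<tau> \<le> \<kappa> * r"
proof (cases "K = 1")
  case True
  have "sin r \<le> r" using r by (intro sin_x_le_x) auto
  then show ?thesis using True cosK_pos by (simp add: tau_def kappa_def sinK_def cosK_def divide_right_mono)
next
  case False
  then have K1: "K = - 1" using K by simp
  have "sinh r \<le> r * cosh r" using r by (intro sinh_le_x_cosh) auto
  then have "\<tau> \<le> r" using K1 cosh_real_pos[of r] by (simp add: tau_def sinK_def cosK_def field_simps)
  also have "\<dots> \<le> \<kappa> * r" using kappa_ge_1 r by simp
  finally show ?thesis .
qed

lemma U_dom:
  assumes "u \<in> U"
  shows "1 / \<kappa>\<^sup>2 \<le> 1 + K * (u \<bullet> u)" "1 + K * (u \<bullet> u) \<le> \<kappa>\<^sup>2"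
proof -
  have "(norm u)\<^sup>2 \<le> \<tau>\<^sup>2" using assms by (simp add: U_def power_mono)
  then have uu: "0 \<le> u \<bullet> u" "u \<bullet> u \<le> \<tau>\<^sup>2" by (simp_all add: dot_square_norm)
  have k: "1 \<le> \<kappa>\<^sup>2" "1 / \<kappa>\<^sup>2 \<le> 1" using kappa_ge_1 by (auto simp: one_le_power)
  have "1 / \<kappa>\<^sup>2 \<le> 1 + K * (u \<bullet> u) \<and> 1 + K * (u \<bullet> u) \<le> \<kappa>\<^sup>2"
  proof (cases "K = 1")
    case True
    have "1 + \<tau>\<^sup>2 = \<kappa>\<^sup>2" using one_plus_tau True by (simp add: kappa_def cosK_def power_divide)
    moreover have "K * (u \<bullet> u) = u \<bullet> u" using True by simp
    ultimately show ?thesis using uu k by linarith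
  next
    case False
    then have K1: "K = - 1" using K by simp
    have "1 - \<tau>\<^sup>2 = 1 / \<kappa>\<^sup>2" using one_plus_tau K1 by (simp add: kappa_def cosK_def)
    moreover have "K * (u \<bullet> u) = - (u \<bullet> u)" using K1 by simp
    ultimately show ?thesis using uu k by linarith
  qed
  then show "1 / \<kappa>\<^sup>2 \<le> 1 + K * (u \<bullet> u)" "1 + K * (u \<bullet> u) \<le> \<kappa>\<^sup>2" by auto
qed

lemma U_dom_pos: "u \<in> U \<Longrightarrow> 0 < 1 + K * (u \<bullet> u)"
  using U_dom(1)[of u] kappa_ge_1 by (smt (verit) divide_pos_pos zero_less_power)

lemma s_bounds:
  assumes "u \<in> U"
  shows "1 / \<kappa> \<le> s u" "s u \<le> \<kappa>" "0 < s u" "(s u)\<^sup>2 = 1 + K * (u \<bullet> u)"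
proof -
  have "sqrt (1 / \<kappa>\<^sup>2) \<le> s u" "s u \<le> sqrt (\<kappa>\<^sup>2)"
    unfolding s_def real_sqrt_le_iff using U_dom[OF assms] by auto
  then show "1 / \<kappa> \<le> s u" "s u \<le> \<kappa>" using kappa_ge_1 by (simp_all add: real_sqrt_divide)
  show "0 < s u" "(s u)\<^sup>2 = 1 + K * (u \<bullet> u)" unfolding s_def using U_dom_pos[OF assms] by auto
qed

lemma tau_le_kappa: "\<tau> \<le> \<kappa>"
proof (cases "K = 1")
  case True
  then show ?thesis using cosK_pos by (simp add: tau_def kappa_def sinK_def cosK_def divide_right_mono)
next
  case False
  then have "\<tau> < 1" using K cosh_real_pos[of r] sinh_less_cosh_real[of r]
    by (auto simp: tau_def sinK_def cosK_def)
  then show ?thesis using kappa_ge_1 by simp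
qed

lemma E_linear: "linear E"
  using frame by (simp add: frame_def)

lemma E_tangent: "u \<in> V \<Longrightarrow> E u \<in> Tan c"
  using frame unfolding frame_def by blast

lemma E_form: "u \<in> V \<Longrightarrow> v \<in> V \<Longrightarrow> frm (E u) (E v) = u \<bullet> v"
  using frame by (simp add: frame_def)

lemma form_c_E: "u \<in> V \<Longrightarrow> frm c (E u) = 0" "u \<in> V \<Longrightarrow> frm (E u) c = 0"
  using E_tangent form_commute[of K c] by (auto simp: tangent_def)

lemma form_cE: "u \<in> V \<Longrightarrow> v \<in> V \<Longrightarrow> frm (c + E u) (c + E v) = K + u \<bullet> v"
  using c by (simp add: S_form form_c_E E_form)

lemma U_V: "u \<in> U \<Longrightarrow> u \<in> V"
  by (simp add: U_def)

lemma pt_eq: "pt u = (1 / s u) *\<^sub>R (c + E u)"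
  by (simp add: h_inv_def s_def)

lemma form_pt_pt: "u \<in> V \<Longrightarrow> v \<in> V \<Longrightarrow> frm (pt u) (pt v) = (K + u \<bullet> v) / (s u * s v)"
  using form_cE[of u v] unfolding pt_eq form_linear(3) form_linear(6) by simp

lemma form_c_pt: "u \<in> V \<Longrightarrow> frm c (pt u) = K / s u"
  using c by (simp add: pt_eq S_form form_c_E)

lemma pt_in_S:
  assumes "u \<in> V" "0 < 1 + K * (u \<bullet> u)"
  shows "pt u \<in> S"
proof -
  have s: "0 < s u" "(s u)\<^sup>2 = 1 + K * (u \<bullet> u)" using assms by (auto simp: s_def)
  have "frm (pt u) (pt u) = (K + u \<bullet> u) / (s u)\<^sup>2"
    unfolding form_pt_pt[OF assms(1,1)] by (simp add: power2_eq_square)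
  also have "\<dots> = K" using s assms(2) by (simp add: field_simps)
  finally have f: "frm (pt u) (pt u) = K" .
  moreover have "snd (pt u) \<in> V"
    using V c E_tangent[OF assms(1)] by (auto simp: pt_eq tangent_def S_V intro!: subspace_scale subspace_add)
  moreover have "0 < fst (pt u)" if "K = - 1"
  proof (rule upper_sheet[OF that c f])
    have "K < 0" using that by simp
    then show "frm c (pt u) < 0" unfolding form_c_pt[OF assms(1)] using s(1) by (rule divide_neg_pos)
  qed
  ultimately show ?thesis by (simp add: space_form_def)
qed

lemma pt_S: "u \<in> U \<Longrightarrow> pt u \<in> S"
  by (intro pt_in_S U_dom_pos U_V)

text \<open>Both sides carry the factor \<open>K\<close> because \<open>cosK\<close> decreases with
  the radius on the sphere and increases in hyperbolic space.\<close>

lemma chart_radius_iff: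
  assumes "0 < 1 + K * (u \<bullet> u)"
  shows "K * cosK K r \<le> K / s u \<longleftrightarrow> norm u \<le> \<tau>"
proof -
  have s: "0 < s u" "(s u)\<^sup>2 = 1 + K * (u \<bullet> u)" using assms by (auto simp: s_def)
  have "norm u \<le> \<tau> \<longleftrightarrow> u \<bullet> u \<le> \<tau>\<^sup>2"
    using tau_nonneg by (simp add: dot_square_norm abs_le_square_iff[symmetric])
  also have "\<dots> \<longleftrightarrow> K * (1 + K * (u \<bullet> u)) \<le> K * (1 + K * \<tau>\<^sup>2)"
    by (simp add: distrib_left)
  also have "\<dots> \<longleftrightarrow> K * (s u)\<^sup>2 \<le> K * (1 / cosK K r)\<^sup>2"
    unfolding one_plus_tau s(2) by (simp add: power_divide)
  also have "\<dots> \<longleftrightarrow> K * s u \<le> K * (1 / cosK K r)"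
    using K s(1) cosK_pos by (auto simp: abs_le_square_iff[symmetric] power_divide[symmetric] simp del: power_divide)
  also have "\<dots> \<longleftrightarrow> K * cosK K r \<le> K / s u"
    using K s(1) cosK_pos by (auto simp: field_simps)
  finally show ?thesis by simp
qed

lemma pt_surj:
  assumes y: "y \<in> S" "K * cosK K r \<le> frm c y"
  obtains u where "u \<in> U" "pt u = y"
proof -
  \<comment> \<open>\<open>k\<close> is \<open>cosK\<close> of the distance from \<open>c\<close> to
    \<open>y\<close>; dividing \<open>y\<close> by it lands on the affine tangent space at
    \<open>c\<close>.\<close>
  define k where "k = K * frm c y"
  have k: "0 < k"
    using y(2) cosK_pos K form_le[OF c y(1)] by (auto simp: k_def)
  define P where "P = y - k *\<^sub>R c"
  have P: "P \<in> Tan c" unfolding P_def k_def by (rule normal_part[OF c S_V[OF y(1)]])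
  then have "(1 / k) *\<^sub>R P \<in> E ` V"
    using subspace_scale[OF tangent_subspace P] frame by (simp add: frame_def)
  then obtain u where u: "u \<in> V" "E u = (1 / k) *\<^sub>R P" by (auto simp: eq_commute)
  have kk: "K * (frm c y)\<^sup>2 = K * k\<^sup>2" by (simp add: k_def power2_eq_square)
  have "u \<bullet> u = frm P P / k\<^sup>2"
    using E_form[OF u(1,1)] unfolding u(2) by (simp add: power2_eq_square)
  also have "frm P P = K - K * k\<^sup>2"
    unfolding P_def k_def normal_part_form[OF c] using y(1) by (simp add: S_form power2_eq_square)
  finally have uu: "u \<bullet> u = (K - K * k\<^sup>2) / k\<^sup>2" .
  have one: "1 + K * (u \<bullet> u) = (1 / k)\<^sup>2"
    unfolding uu using k by (simp add: field_simps)
  have s: "s u = 1 / k" unfolding s_def one using k by simp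
  have "c + E u = (1 / k) *\<^sub>R y"
    unfolding u(2) P_def using k by (simp add: algebra_simps)
  then have pt: "pt u = y" unfolding pt_eq s using k by simp
  have pos: "0 < 1 + K * (u \<bullet> u)" unfolding one using k by simp
  have "K * cosK K r \<le> K / s u" using y(2) form_c_pt[OF u(1)] pt by simp
  then have "u \<in> U" using chart_radius_iff[OF pos] u(1) by (simp add: U_def)
  then show ?thesis using pt that by blast
qed

lemma pt_inj:
  assumes "u \<in> U" "v \<in> U" "pt u = pt v"
  shows "u = v"
proof -
  have uv: "u \<in> V" "v \<in> V" using assms U_V by auto
  have "K / s u = K / s v" by (metis form_c_pt uv assms(3))
  then have ss: "s u = s v" by (metis K_nonzero divide_cancel_left)
  then have "E u = E v" using assms(3) s_bounds(3)[OF assms(2)] by (simp add: pt_eq)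
  then have "E (u - v) = 0" using E_linear by (simp add: linear_diff)
  then have "(u - v) \<bullet> (u - v) = 0" using E_form[of "u - v" "u - v"] uv V by (simp add: subspace_diff)
  then show ?thesis by simp
qed

text \<open>The first factor comes from the rescaling in \<open>exp_inv\<close>, and
  \<open>s u / s v\<close> from the two central projections. The product is the factor that turns
  the Euclidean pairing of the gradient with \<open>v - u\<close> into the Riemannian one with
  \<open>exp_inv\<close>.\<close>

definition ratio :: "'a \<Rightarrow> 'a \<Rightarrow> real" where
  "ratio u v = rdist K (pt u) (pt v) / sinK K (rdist K (pt u) (pt v)) * (s u / s v)"

lemma rdist_pt_bounds:
  assumes "u \<in> U" "v \<in> U" "u \<noteq> v"
  shows "0 < rdist K (pt u) (pt v)" "K = 1 \<longrightarrow> rdist K (pt u) (pt v) < pi"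
proof -
  note S' = pt_S[OF assms(1)] pt_S[OF assms(2)]
  show "0 < rdist K (pt u) (pt v)"
    using rdist_nonneg[OF S'] rdist_eq_0[OF S'] pt_inj[OF assms(1,2)] assms(3) by force
  \<comment> \<open>The chart covers only an open hemisphere, so there are no antipodal pairs: one
    would make \<open>u \<bullet> v\<close> smaller than \<open>- (s u * s v)\<close>.\<close>
  have "rdist K (pt u) (pt v) \<noteq> pi" if K1: "K = 1"
  proof
    assume "rdist K (pt u) (pt v) = pi"
    then have "frm (pt u) (pt v) = - 1" using cosK_rdist[OF S'] K1 by (simp add: cosK_def)
    then have "1 + u \<bullet> v = - (s u * s v)"
      using form_pt_pt[of u v] s_bounds(3)[OF assms(1)] s_bounds(3)[OF assms(2)] assms U_V K1
      by (simp add: field_simps)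
    moreover have "\<bar>u \<bullet> v\<bar> \<le> s u * s v"
    proof -
      have "norm w \<le> s w" for w
        unfolding s_def norm_eq_sqrt_inner real_sqrt_le_iff using K1 by simp
      then have "norm u * norm v \<le> s u * s v" using s_bounds(3)[OF assms(1)] by (intro mult_mono) auto
      then show ?thesis using Cauchy_Schwarz_ineq2[of u v] by linarith
    qed
    ultimately show False by linarith
  qed
  then show "K = 1 \<longrightarrow> rdist K (pt u) (pt v) < pi" using rdist_le_pi[OF _ S'] by fastforce
qed

lemma ratio_bounds:
  assumes "u \<in> U" "v \<in> U" "u \<noteq> v"
  shows "gamma_p K r \<le> ratio u v" "ratio u v \<le> 1 / gamma_n K r"
proof -
  define \<theta> where "\<theta> = rdist K (pt u) (pt v)"
  define \<alpha> where "\<alpha> = rdist K c (pt u)"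
  define \<beta> where "\<beta> = rdist K c (pt v)"
  note uS = pt_S[OF assms(1)] and vS = pt_S[OF assms(2)]
  note su = s_bounds[OF assms(1)] and sv = s_bounds[OF assms(2)]
  have \<theta>: "0 < \<theta>" "K = 1 \<longrightarrow> \<theta> < pi" unfolding \<theta>_def by (rule rdist_pt_bounds[OF assms])+
  have rng: "0 \<le> rdist K c (pt w)" "rdist K c (pt w) \<le> r" "cosK K (rdist K c (pt w)) = 1 / s w"
      "sinK K (rdist K c (pt w)) = norm w / s w" if w: "w \<in> U" for w
  proof -
    note wS = pt_S[OF w]
    show "0 \<le> rdist K c (pt w)" by (rule rdist_nonneg[OF c wS])
    have "K * cosK K r \<le> K / s w" using chart_radius_iff[OF U_dom_pos[OF w]] w by (simp add: U_def)
    then show "rdist K c (pt w) \<le> r"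
      using rdist_le_iff[OF c wS, of r] r form_c_pt[OF U_V[OF w]] by auto
    show "cosK K (rdist K c (pt w)) = 1 / s w"
      using cosK_rdist[OF c wS] form_c_pt[OF U_V[OF w]] by simp
    have "(sinK K (rdist K c (pt w)))\<^sup>2 = K * (1 - (K / s w)\<^sup>2)"
      unfolding sinK_rdist_sq[OF c wS] form_c_pt[OF U_V[OF w]] ..
    also have "(K / s w)\<^sup>2 = 1 / (s w)\<^sup>2" by (simp add: power_divide) (simp add: power2_eq_square)
    also have "K * (1 - 1 / (s w)\<^sup>2) = (norm w / s w)\<^sup>2"
    proof -
      have n: "(norm w)\<^sup>2 = K * ((s w)\<^sup>2 - 1)" using s_bounds(4)[OF w] by (simp add: dot_square_norm)
      show ?thesis unfolding power_divide n using s_bounds(3)[OF w] by (simp add: field_simps)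
    qed
    finally show "sinK K (rdist K c (pt w)) = norm w / s w"
      using s_bounds(3)[OF w] sinK_nonneg[OF rdist_nonneg[OF c wS]] rdist_le_pi[OF _ c wS]
      by (simp add: power2_eq_iff_nonneg)
  qed
  have ab: "0 \<le> \<alpha>" "\<alpha> \<le> r" "0 \<le> \<beta>" "\<beta> \<le> r" "cosK K \<alpha> = 1 / s u" "cosK K \<beta> = 1 / s v"
      "sinK K \<alpha> = norm u / s u" "sinK K \<beta> = norm v / s v"
    unfolding \<alpha>_def \<beta>_def using rng[OF assms(1)] rng[OF assms(2)] by auto
  have ct: "cosK K \<theta> = (1 + K * (u \<bullet> v)) / (s u * s v)"
    unfolding \<theta>_def cosK_rdist[OF uS vS] form_pt_pt[OF U_V[OF assms(1)] U_V[OF assms(2)]]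
    by (simp add: distrib_left)
  have ss: "s u / s v = cosK K \<beta> / cosK K \<alpha>" unfolding ab using su sv by simp
  have rat: "ratio u v = \<theta> / sinK K \<theta> * (cosK K \<beta> / cosK K \<alpha>)"
    unfolding ratio_def \<theta>_def[symmetric] ss ..
  \<comment> \<open>Cauchy-Schwarz in coordinates is the triangle inequality through the center that
    both tilt lemmas require.\<close>
  have cs: "- (norm u * norm v) \<le> u \<bullet> v" using Cauchy_Schwarz_ineq2[of u v] by linarith
  have pos: "0 < s u * s v" using su sv by simp
  have "gamma_p K r \<le> ratio u v \<and> ratio u v \<le> 1 / gamma_n K r"
  proof (cases "K = 1")
    case True
    have "cos (\<alpha> + \<beta>) = (1 - norm u * norm v) / (s u * s v)"
      using ab True by (simp add: cos_add cosK_def sinK_def diff_divide_distrib)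
    also have "\<dots> \<le> cos \<theta>"
      using ct True cs pos by (simp add: cosK_def divide_right_mono)
    finally have "(cos r)\<^sup>2 \<le> \<theta> / sin \<theta> * (cos \<beta> / cos \<alpha>) \<and>
        \<theta> / sin \<theta> * (cos \<beta> / cos \<alpha>) \<le> 1 / (cos r) ^ 3"
      using spherical_tilt_bounds[of r \<alpha> \<beta> \<theta>] ab(1-4) \<theta> r True by blast
    then show ?thesis
      unfolding rat using True by (simp add: gamma_p_def gamma_n_def sinK_def cosK_def)
  next
    case False
    then have K1: "K = - 1" using K by simp
    have "cosh \<theta> \<le> (1 + norm u * norm v) / (s u * s v)"
      using ct K1 cs pos by (simp add: cosK_def divide_right_mono)
    also have "\<dots> = cosh (\<alpha> + \<beta>)"
      using ab K1 by (simp add: cosh_add cosK_def sinK_def add_divide_distrib)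
    finally have "1 / (cosh r) ^ 3 \<le> \<theta> / sinh \<theta> * (cosh \<beta> / cosh \<alpha>) \<and>
        \<theta> / sinh \<theta> * (cosh \<beta> / cosh \<alpha>) \<le> (cosh r)\<^sup>2"
      using hyperbolic_tilt_bounds[of \<alpha> r \<beta> \<theta>] ab(1-4) \<theta>(1) by blast
    then show ?thesis
      unfolding rat using K1 by (simp add: gamma_p_def gamma_n_def sinK_def cosK_def)
  qed
  then show "gamma_p K r \<le> ratio u v" "ratio u v \<le> 1 / gamma_n K r" by auto
qed

lemma gammas:
  shows "0 < gamma_n K r" "gamma_n K r \<le> 1" "0 < gamma_p K r" "gamma_p K r \<le> 1"
    and inv_gamma_le: "1 / gamma_n K r \<le> \<kappa> ^ 3" "1 / gamma_p K r \<le> \<kappa> ^ 3"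
proof -
  have "0 < gamma_n K r \<and> gamma_n K r \<le> 1 \<and> 0 < gamma_p K r \<and> gamma_p K r \<le> 1 \<and>
    1 / gamma_n K r \<le> \<kappa> ^ 3 \<and> 1 / gamma_p K r \<le> \<kappa> ^ 3"
  proof (cases "K = 1")
    case True
    have p: "0 < cos r" "cos r \<le> 1" using cosK_pos True by (auto simp: cosK_def)
    then have "cos r ^ 3 \<le> cos r ^ 2" by (intro power_decreasing) auto
    then have "1 / cos r ^ 2 \<le> 1 / cos r ^ 3" using p by (intro divide_left_mono) auto
    then show ?thesis using True p
      by (simp add: gamma_n_def gamma_p_def kappa_def power_divide power_le_one)
  next
    case False
    have p: "1 \<le> cosh r" "0 < cosh r" by (auto simp: cosh_real_ge_1)
    then have "cosh r ^ 2 \<le> cosh r ^ 3" by (intro power_increasing) auto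
    then show ?thesis using False p
      by (auto simp: gamma_n_def gamma_p_def kappa_def divide_le_eq one_le_power)
  qed
  then show "0 < gamma_n K r" "gamma_n K r \<le> 1" "0 < gamma_p K r" "gamma_p K r \<le> 1"
    "1 / gamma_n K r \<le> \<kappa> ^ 3" "1 / gamma_p K r \<le> \<kappa> ^ 3" by auto
qed

lemma ratio_pos: "u \<in> U \<Longrightarrow> v \<in> U \<Longrightarrow> u \<noteq> v \<Longrightarrow> 0 < ratio u v"
  using ratio_bounds(1) gammas(3) by force

text \<open>\<open>g\<close> is orthogonal to \<open>pt u\<close>, hence to \<open>c + E u\<close>,
  so its pairing with \<open>c + E v\<close> only sees \<open>E (v - u)\<close>.\<close>

lemma form_tangent_exp_inv:
  assumes "u \<in> U" "v \<in> U" and g: "g \<in> Tan (pt u)"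
  shows "frm g (exp_inv K V (pt u) (pt v)) = ratio u v * (frm g (E (v - u)) / s u)"
proof -
  note su = s_bounds(3)[OF assms(1)] and sv = s_bounds(3)[OF assms(2)]
  have lt: "K = 1 \<longrightarrow> rdist K (pt u) (pt v) < pi"
    using rdist_pt_bounds(2)[OF assms(1,2)] rdist_self[OF pt_S[OF assms(1)]] by (cases "u = v") auto
  have "frm g (pt u) = 0" using g form_commute[of K g "pt u"] by (simp add: tangent_def)
  then have gu: "frm g c = - frm g (E u)" using su by (simp add: pt_eq add_eq_0_iff)
  have "frm g (pt v) = (frm g c + frm g (E v)) / s v" by (simp add: pt_eq)
  also have "\<dots> = frm g (E (v - u)) / s v" using E_linear by (simp add: gu linear_diff)
  finally have "frm g (pt v) = frm g (E (v - u)) / s v" .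
  then show ?thesis
    unfolding form_exp_inv[OF pt_S[OF assms(1)] pt_S[OF assms(2)] lt g] ratio_def using su by simp
qed

text \<open>Unlike the distance, its squared sine is rational in the coordinates: multiplied by the
  square of \<open>s u * s v\<close>, it is the squared norm of \<open>w = v - u\<close> plus
  \<open>K\<close> times the Gram determinant of \<open>u\<close> and \<open>w\<close>.\<close>

lemma sinK_rdist_le:
  assumes "u \<in> U" "v \<in> U"
  shows "sinK K (rdist K (pt u) (pt v)) \<le> 2 * \<kappa> ^ 3 * norm (v - u)"
proof -
  note su = s_bounds[OF assms(1)] and sv = s_bounds[OF assms(2)]
  define w where "w = v - u"
  have v: "v = u + w" by (simp add: w_def)
  have k: "0 < \<kappa>" "1 \<le> \<kappa>" using kappa_ge_1 by auto
  have uk: "norm u \<le> \<kappa>" using assms(1) tau_le_kappa by (simp add: U_def)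
  have "(s u)\<^sup>2 * (s v)\<^sup>2 * (sinK K (rdist K (pt u) (pt v)))\<^sup>2 = K * ((s u)\<^sup>2 * (s v)\<^sup>2 - (K + u \<bullet> v)\<^sup>2)"
    unfolding sinK_rdist_sq[OF pt_S[OF assms(1)] pt_S[OF assms(2)]]
      form_pt_pt[OF U_V[OF assms(1)] U_V[OF assms(2)]] using su(3) sv(3)
    by (simp add: field_simps power_mult_distrib)
  also have "\<dots> = w \<bullet> w + K * ((u \<bullet> u) * (w \<bullet> w) - (u \<bullet> w)\<^sup>2)"
    unfolding su(4) sv(4) unfolding v inner_add_left inner_add_right inner_commute[of w u]
    using K by (elim disjE) (simp_all add: power2_eq_square algebra_simps)
  also have "\<dots> \<le> w \<bullet> w + (u \<bullet> u) * (w \<bullet> w)"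
  proof -
    have "K * (a - b) \<le> a" if "0 \<le> b" "b \<le> a" for a b :: real
      using that K by (elim disjE) auto
    from this[OF _ Cauchy_Schwarz_ineq[of u w]] show ?thesis by simp
  qed
  also have "\<dots> = (1 + (norm u)\<^sup>2) * (norm w)\<^sup>2" by (simp add: dot_square_norm algebra_simps)
  also have "\<dots> \<le> (2 * \<kappa>\<^sup>2) * (norm w)\<^sup>2"
  proof (intro mult_right_mono)
    have "(norm u)\<^sup>2 \<le> \<kappa>\<^sup>2" "1 \<le> \<kappa>\<^sup>2" using uk k by (auto simp: power_mono one_le_power)
    then show "1 + (norm u)\<^sup>2 \<le> 2 * \<kappa>\<^sup>2" by simp
  qed auto
  finally have main: "(s u * s v * sinK K (rdist K (pt u) (pt v)))\<^sup>2 \<le> 2 * \<kappa>\<^sup>2 * (norm w)\<^sup>2"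
    by (simp add: power_mult_distrib)
  have "(1 / \<kappa> * (1 / \<kappa>)) * \<bar>sinK K (rdist K (pt u) (pt v))\<bar> \<le> (s u * s v) * \<bar>sinK K (rdist K (pt u) (pt v))\<bar>"
    using su sv k by (intro mult_right_mono mult_mono) auto
  also have "\<dots> \<le> 2 * \<kappa> * norm w"
  proof (rule power2_le_imp_le)
    have "((s u * s v) * \<bar>sinK K (rdist K (pt u) (pt v))\<bar>)\<^sup>2 \<le> 2 * \<kappa>\<^sup>2 * (norm w)\<^sup>2"
      using main by (simp add: power_mult_distrib)
    also have "\<dots> \<le> (2 * \<kappa> * norm w)\<^sup>2" by (simp add: power_mult_distrib)
    finally show "((s u * s v) * \<bar>sinK K (rdist K (pt u) (pt v))\<bar>)\<^sup>2 \<le> (2 * \<kappa> * norm w)\<^sup>2" .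
  qed (use k in auto)
  finally have "\<bar>sinK K (rdist K (pt u) (pt v))\<bar> \<le> 2 * \<kappa> ^ 3 * norm w"
    using k by (simp add: field_simps power3_eq_cube)
  then show ?thesis by (simp add: w_def)
qed

text \<open>The bound on \<open>ratio\<close> converts the sine into the distance. On the sphere
  this also covers distances above \<open>pi / 2\<close>, where the sine decreases. The exponent is
  3 + 2 + 3.\<close>

lemma rdist_pt_le:
  assumes "u \<in> U" "v \<in> U"
  shows "rdist K (pt u) (pt v) \<le> 2 * \<kappa> ^ 8 * norm (v - u)"
proof (cases "u = v")
  case True
  then show ?thesis using rdist_self[OF pt_S[OF assms(1)]] by simp
next
  case False
  define \<theta> where "\<theta> = rdist K (pt u) (pt v)"
  note su = s_bounds[OF assms(1)] and sv = s_bounds[OF assms(2)]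
  have k: "0 < \<kappa>" "1 \<le> \<kappa>" using kappa_ge_1 by auto
  have \<theta>: "0 < \<theta>" "K = 1 \<longrightarrow> \<theta> < pi" unfolding \<theta>_def by (rule rdist_pt_bounds[OF assms False])+
  have sp: "0 < sinK K \<theta>" using sinK_pos \<theta> by auto
  have "\<theta> = ratio u v * (s v / s u) * sinK K \<theta>"
    unfolding ratio_def \<theta>_def[symmetric] using su sv sp by simp
  also have "\<dots> \<le> \<kappa> ^ 3 * (\<kappa> / (1 / \<kappa>)) * (2 * \<kappa> ^ 3 * norm (v - u))"
  proof (intro mult_mono frac_le)
    show "ratio u v \<le> \<kappa> ^ 3" using ratio_bounds(2)[OF assms False] inv_gamma_le(1) by linarith
    show "sinK K \<theta> \<le> 2 * \<kappa> ^ 3 * norm (v - u)" unfolding \<theta>_def by (rule sinK_rdist_le[OF assms])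
  qed (use su sv k sp ratio_pos[OF assms False] in auto)
  also have "\<dots> = 2 * \<kappa> ^ 8 * norm (v - u)" using k by (simp add: power_def)
  finally show ?thesis by (simp add: \<theta>_def)
qed

text \<open>The deviation splits into that of \<theta> / \<open>sinK K\<close> \<theta>, linear in
  the distance, and that of \<open>s u / s v\<close>, controlled through the difference of the
  squares of \<open>s\<close>.\<close>

lemma ratio_near_1:
  assumes "u \<in> U" "v \<in> U" "u \<noteq> v" and small: "rdist K (pt u) (pt v) \<le> 1"
  shows "\<bar>ratio u v - 1\<bar> \<le> 3 * \<kappa> ^ 10 * norm (v - u)"
proof -
  define \<theta> where "\<theta> = rdist K (pt u) (pt v)"
  define A where "A = \<theta> / sinK K \<theta>"
  define q where "q = s u / s v"
  note su = s_bounds[OF assms(1)] and sv = s_bounds[OF assms(2)]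
  have k: "0 < \<kappa>" "1 \<le> \<kappa>" using kappa_ge_1 by auto
  have \<theta>: "0 < \<theta>" unfolding \<theta>_def by (rule rdist_pt_bounds[OF assms(1-3)])
  have A: "\<bar>A - 1\<bar> \<le> \<theta>"
    using sin_ratio_near_1[OF \<theta>] sinh_ratio_near_1[OF \<theta>] small K by (auto simp: A_def sinK_def \<theta>_def)
  have q: "0 \<le> q" "q \<le> \<kappa>\<^sup>2"
  proof -
    have "q \<le> \<kappa> / (1 / \<kappa>)" unfolding q_def using su sv k by (intro frac_le) auto
    then show "q \<le> \<kappa>\<^sup>2" by (simp add: power2_eq_square)
  qed (use su sv in \<open>simp add: q_def\<close>)
  have un: "norm u \<le> \<kappa>" "norm v \<le> \<kappa>" using assms(1,2) tau_le_kappa by (auto simp: U_def)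
  have q1: "\<bar>q - 1\<bar> \<le> \<kappa> ^ 3 * norm (v - u)"
  proof -
    have "(s u - s v) * (s u + s v) = K * ((u - v) \<bullet> (u + v))"
      using su(4) sv(4) by (simp add: power2_eq_square inner_commute algebra_simps)
    then have "\<bar>s u - s v\<bar> * (s u + s v) = \<bar>(u - v) \<bullet> (u + v)\<bar>"
      using su(3) sv(3) K by (metis abs_mult abs_of_pos add_pos_pos abs_minus abs_1 mult_1 mult.commute)
    also have "\<dots> \<le> norm (u - v) * norm (u + v)" by (rule Cauchy_Schwarz_ineq2)
    also have "\<dots> \<le> norm (u - v) * (2 * \<kappa>)"
      using un norm_triangle_ineq[of u v] by (intro mult_left_mono) auto
    finally have a: "\<bar>s u - s v\<bar> * (s u + s v) \<le> 2 * \<kappa> * norm (v - u)"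
      by (simp add: norm_minus_commute mult_ac)
    have "\<bar>s u - s v\<bar> * (2 / \<kappa>) \<le> \<bar>s u - s v\<bar> * (s u + s v)"
      using su(1) sv(1) by (intro mult_left_mono) auto
    then have "\<bar>s u - s v\<bar> * (2 / \<kappa>) \<le> 2 * \<kappa> * norm (v - u)" using a by linarith
    then have b: "\<bar>s u - s v\<bar> \<le> \<kappa>\<^sup>2 * norm (v - u)"
      using k by (simp add: field_simps power2_eq_square)
    have "\<bar>q - 1\<bar> = \<bar>s u - s v\<bar> / s v"
      unfolding q_def using sv by (simp add: diff_divide_distrib[symmetric] abs_divide divide_eq_eq field_simps)
    also have "\<dots> \<le> (\<kappa>\<^sup>2 * norm (v - u)) / (1 / \<kappa>)" using b sv k by (intro frac_le) auto
    finally show ?thesis by (simp add: power2_eq_square power3_eq_cube mult_ac)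
  qed
  have "ratio u v - 1 = (A - 1) * q + (q - 1)"
    unfolding ratio_def A_def q_def \<theta>_def by (simp add: algebra_simps)
  then have "\<bar>ratio u v - 1\<bar> \<le> \<bar>A - 1\<bar> * q + \<bar>q - 1\<bar>"
    using q(1) abs_triangle_ineq[of "(A - 1) * q" "q - 1"] by (simp add: abs_mult)
  also have "\<dots> \<le> (2 * \<kappa> ^ 8 * norm (v - u)) * \<kappa>\<^sup>2 + \<kappa> ^ 3 * norm (v - u)"
  proof (intro add_mono mult_mono)
    show "\<bar>A - 1\<bar> \<le> 2 * \<kappa> ^ 8 * norm (v - u)"
      using A rdist_pt_le[OF assms(1,2)] by (simp add: \<theta>_def)
  qed (use q q1 k in auto)
  also have "\<dots> \<le> 2 * \<kappa> ^ 10 * norm (v - u) + \<kappa> ^ 10 * norm (v - u)"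
  proof (intro add_mono mult_right_mono)
    show "\<kappa> ^ 3 \<le> \<kappa> ^ 10" using k by (intro power_increasing) auto
    show "2 * \<kappa> ^ 8 * norm (v - u) * \<kappa>\<^sup>2 \<le> 2 * \<kappa> ^ 10 * norm (v - u)"
      by (simp add: power_def mult_ac)
  qed auto
  finally show ?thesis by linarith
qed

end

section \<open>Riemannian gradients in coordinates\<close>

text \<open>Restriction to the line through \<open>u\<close> in direction \<open>w\<close> gives an
  ordinary derivative at an interior point of the real line, which is unique.\<close>

lemma has_derivative_unique_subspace:
  fixes f :: "'a::real_inner \<Rightarrow> 'b::real_normed_vector"
  assumes V: "subspace V" and u: "u \<in> V" and w: "w \<in> V"
    and D: "(f has_derivative D1) (at u within V)" "(f has_derivative D2) (at u within V)"
  shows "D1 w = D2 w"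
proof -
  have l: "((\<lambda>t. u + t *\<^sub>R w) has_derivative (\<lambda>t. t *\<^sub>R w)) (at (0::real))"
    by (auto intro!: derivative_eq_intros)
  have sub: "(\<lambda>t. u + t *\<^sub>R w) ` UNIV \<subseteq> V" using V u w by (auto intro: subspace_add subspace_scale)
  have "((\<lambda>t. f (u + t *\<^sub>R w)) has_derivative (\<lambda>t. D (t *\<^sub>R w))) (at 0)"
    if "(f has_derivative D) (at u within V)" for D
    using has_derivative_in_compose[OF l, of f D] has_derivative_subset[OF that sub] by simp
  from has_derivative_unique[OF this[OF D(1)] this[OF D(2)]]
  have "D1 (1 *\<^sub>R w) = D2 (1 *\<^sub>R w)" by (rule fun_cong)
  then show ?thesis by simp
qed

lemma inner_eq_subspace:
  fixes V :: "'a::real_inner set"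
  assumes "subspace V" "g \<in> V" "g' \<in> V" "\<And>w. w \<in> V \<Longrightarrow> g \<bullet> w = g' \<bullet> w"
  shows "g = g'"
proof -
  have "(g - g') \<bullet> (g - g') = 0"
    using assms by (metis inner_diff_left right_minus_eq subspace_diff)
  then show ?thesis by simp
qed

context chart
begin

text \<open>In coordinates, membership in a ball compares a linear function with a multiple of
  \<open>K * s\<close>, so this is what makes coordinate domains convex. After squaring, the defect
  is the inequality \<open>form_le\<close> at \<open>pt u\<close> and \<open>pt v\<close>.\<close>

lemma s_convex:
  assumes u: "u \<in> V" "0 < 1 + K * (u \<bullet> u)" and v: "v \<in> V" "0 < 1 + K * (v \<bullet> v)"
    and t: "0 \<le> t" "t \<le> 1"
  shows "K * s ((1 - t) *\<^sub>R u + t *\<^sub>R v) \<le> K * ((1 - t) * s u + t * s v)"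
proof -
  define w where "w = (1 - t) *\<^sub>R u + t *\<^sub>R v"
  define m where "m = (1 - t) * s u + t * s v"
  have s: "0 < s u" "(s u)\<^sup>2 = 1 + K * (u \<bullet> u)" "0 < s v" "(s v)\<^sup>2 = 1 + K * (v \<bullet> v)"
    using u v by (auto simp: s_def)
  have "(K + u \<bullet> v) / (s u * s v) \<le> K"
    using form_le[OF pt_in_S[OF u] pt_in_S[OF v]] form_pt_pt[OF u(1) v(1)] by simp
  then have uv: "K + u \<bullet> v \<le> K * (s u * s v)" using s by (simp add: pos_divide_le_eq)
  have "K * m\<^sup>2 - K * (1 + K * (w \<bullet> w)) = 2 * (t * (1 - t)) * (K * (s u * s v) - (K + u \<bullet> v))"
  proof -
    have "K * m\<^sup>2 = (1 - t)\<^sup>2 * (K * (s u)\<^sup>2) + t\<^sup>2 * (K * (s v)\<^sup>2) + 2 * (t * (1 - t)) * (K * (s u * s v))"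
      by (simp add: m_def power2_eq_square algebra_simps)
    also have "K * (s u)\<^sup>2 = K + u \<bullet> u" unfolding s(2) by (simp add: distrib_left)
    also have "K * (s v)\<^sup>2 = K + v \<bullet> v" unfolding s(4) by (simp add: distrib_left)
    finally have 1: "K * m\<^sup>2 = (1 - t)\<^sup>2 * (K + u \<bullet> u) + t\<^sup>2 * (K + v \<bullet> v) + 2 * (t * (1 - t)) * (K * (s u * s v))" .
    have 2: "w \<bullet> w = (1 - t)\<^sup>2 * (u \<bullet> u) + t\<^sup>2 * (v \<bullet> v) + 2 * (t * (1 - t)) * (u \<bullet> v)"
      by (simp add: w_def inner_add_left inner_add_right inner_commute[of v u] power2_eq_square algebra_simps)
    have 3: "K * (1 + K * (w \<bullet> w)) = K + w \<bullet> w" by (simp add: distrib_left)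
    show ?thesis unfolding 1 3 unfolding 2 by (simp add: power2_eq_square algebra_simps)
  qed
  also have "\<dots> \<ge> 0" using uv t by simp
  finally have le: "K * (1 + K * (w \<bullet> w)) \<le> K * m\<^sup>2" by simp
  have m0: "0 \<le> m" unfolding m_def using s t by simp
  have "K * s w \<le> K * m"
  proof (cases "K = 1")
    case True
    then have "s w \<le> m" unfolding s_def using le m0 by (intro real_le_lsqrt) auto
    then show ?thesis using True by simp
  next
    case False
    then have K1: "K = - 1" using K by simp
    then have "m \<le> s w" unfolding s_def using le by (intro real_le_rsqrt) auto
    then show ?thesis using K1 by simp
  qed
  then show ?thesis by (simp add: w_def m_def)
qed

text \<open>A frame is only controlled on \<open>V\<close>; \<open>Ec\<close> is a bounded linear map agreeing with it there.\<close>

definition Ec :: "'a \<Rightarrow> real \<times> 'a" where "Ec u = (\<Sum>e\<in>B. (u \<bullet> e) *\<^sub>R E e)"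

lemma Ec_eq: "u \<in> V \<Longrightarrow> Ec u = E u"
proof -
  assume "u \<in> V"
  then have "u = (\<Sum>e\<in>B. (u \<bullet> e) *\<^sub>R e)"
    using coord_proj_span[OF B(1), of u] B(2) by (simp add: coord_proj_def)
  then have "E u = E (\<Sum>e\<in>B. (u \<bullet> e) *\<^sub>R e)" by simp
  also have "\<dots> = Ec u"
    unfolding Ec_def by (simp add: linear_sum[OF E_linear] linear_scale[OF E_linear])
  finally show ?thesis by simp
qed

lemma bounded_linear_Ec: "bounded_linear Ec"
  unfolding Ec_def
  by (intro bounded_linear_sum bounded_linear_compose[OF bounded_linear_scaleR_left]
      bounded_linear_inner_left)

lemma basis_in_V: "e \<in> B \<Longrightarrow> e \<in> V"
  using B(2) span_base by blast

definition ptc :: "'a \<Rightarrow> real \<times> 'a" where "ptc u = (1 / s u) *\<^sub>R (c + Ec u)"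

lemma ptc_eq: "u \<in> V \<Longrightarrow> ptc u = pt u"
  by (simp add: ptc_def pt_eq Ec_eq)

lemma continuous_on_s: "continuous_on A s"
  unfolding s_def by (intro continuous_intros)

definition dom :: "'a set" where "dom = {u. 0 < 1 + K * (u \<bullet> u)}"

lemma open_dom: "open dom"
  unfolding dom_def by (intro open_Collect_less continuous_intros)

lemma continuous_on_ptc: "continuous_on dom ptc"
  unfolding ptc_def
  by (intro continuous_intros continuous_on_s linear_continuous_on bounded_linear_Ec)
     (auto simp: s_def dom_def)

text \<open>The derivative of the normalising factor contributes a multiple of
  \<open>c + E u\<close>, that is of \<open>pt u\<close>, to which \<open>g\<close> is orthogonal.
  Only the derivative of the linear part survives.\<close>

lemma has_derivative_chart:
  assumes M: "openin (top_of_set S) M" and u: "u \<in> V" "u \<in> dom" "pt u \<in> M"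
    and F: "(F has_derivative frm g) (at (pt u) within M)" and g: "g \<in> Tan (pt u)"
  shows "((F \<circ> pt) has_derivative (\<lambda>w. frm g (Ec w) / s u)) (at u within V)"
proof -
  have pos: "0 < 1 + K * (u \<bullet> u)" and su: "0 < s u" using u(2) by (auto simp: dom_def s_def)
  have "((\<lambda>y. 1 / sqrt y) has_real_derivative
      ((0 * sqrt (1 + K * (u \<bullet> u)) - 1 * (inverse (sqrt (1 + K * (u \<bullet> u))) / 2)) /
       (sqrt (1 + K * (u \<bullet> u)) * sqrt (1 + K * (u \<bullet> u))))) (at (1 + K * (u \<bullet> u)))"
    using pos by (intro DERIV_divide DERIV_const DERIV_real_sqrt) auto
  then obtain d where d: "DERIV (\<lambda>y. 1 / sqrt y) (1 + K * (u \<bullet> u)) :> d" by blast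
  have "((\<lambda>v. 1 + K * (v \<bullet> v)) has_derivative (\<lambda>w. K * (u \<bullet> w + w \<bullet> u))) (at u within A)" for A
    by (auto intro!: derivative_eq_intros)
  from DERIV_compose_FDERIV[OF d this]
  have q: "((\<lambda>v. 1 / s v) has_derivative (\<lambda>w. K * (u \<bullet> w + w \<bullet> u) * d)) (at u within A)" for A
    unfolding s_def .
  have "((\<lambda>v. c + Ec v) has_derivative Ec) (at u within A)" for A
    using has_derivative_add[OF has_derivative_const bounded_linear_imp_has_derivative[OF bounded_linear_Ec]]
    by simp
  from has_derivative_scaleR[OF q this]
  have P: "(ptc has_derivative (\<lambda>w. (1 / s u) *\<^sub>R Ec w + (K * (u \<bullet> w + w \<bullet> u) * d) *\<^sub>R (c + Ec u))) (at u within A)" for A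
    unfolding ptc_def .
  obtain O' where O': "open O'" "M = S \<inter> O'" using M by (auto simp: openin_open)
  \<comment> \<open>Relative openness of \<open>M\<close> becomes an open set of the chart, so
    nearby points of \<open>V\<close> stay in the domain of \<open>F\<close>.\<close>
  define W where "W = dom \<inter> ptc -` O'"
  have W: "open W" unfolding W_def by (rule continuous_open_preimage[OF continuous_on_ptc open_dom O'(1)])
  have ptM: "ptc v \<in> M" if "v \<in> V \<inter> W" for v
    using that pt_in_S[of v] ptc_eq[of v] by (auto simp: W_def O'(2) dom_def)
  have uW: "u \<in> W" using u ptc_eq[OF u(1)] by (simp add: W_def O'(2))
  have "(F has_derivative frm g) (at (ptc u) within ptc ` (V \<inter> W))"
    using has_derivative_subset[OF F, of "ptc ` (V \<inter> W)"] ptM ptc_eq[OF u(1)] by auto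
  from has_derivative_in_compose[OF P this]
  have "((\<lambda>v. F (ptc v)) has_derivative
      (\<lambda>w. frm g ((1 / s u) *\<^sub>R Ec w + (K * (u \<bullet> w + w \<bullet> u) * d) *\<^sub>R (c + Ec u)))) (at u within (V \<inter> W))" .
  also have "(\<lambda>w. frm g ((1 / s u) *\<^sub>R Ec w + (K * (u \<bullet> w + w \<bullet> u) * d) *\<^sub>R (c + Ec u))) = (\<lambda>w. frm g (Ec w) / s u)"
  proof -
    have "frm g (pt u) = 0" using g form_commute[of K g "pt u"] by (simp add: tangent_def)
    then have "frm g (c + Ec u) = 0" using su by (simp add: pt_eq Ec_eq[OF u(1)])
    then show ?thesis by (intro ext) (simp only: form_linear, simp)
  qed
  finally have "((\<lambda>v. F (ptc v)) has_derivative (\<lambda>w. frm g (Ec w) / s u)) (at u within V)"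
    using at_within_nhd[OF uW W, of "V \<inter> W" V] by simp
  then show ?thesis
    by (rule has_derivative_transform[OF u(1), rotated]) (simp add: ptc_eq)
qed

end

context curved
begin

lemma abs_form_le: "\<bar>frm p p\<bar> \<le> (norm p)\<^sup>2"
  using K by (auto simp: form_def norm_prod_def abs_le_iff dot_square_norm power2_eq_square[symmetric])

lemma chart_at:
  assumes "x \<in> S" "frame K V x E"
  shows "chart K V B x E 1"
  using assms pi_half_gt_zero pi_gt3 by unfold_locales auto

text \<open>To first order only tangential increments count within \<open>M\<close>: for points of
  the space form, \<open>form K x (y - x)\<close> is quadratic in \<open>y - x\<close>. The given
  derivative may therefore be replaced by the form against a tangent vector, found by expanding in a
  frame. Uniqueness is read off in a chart at \<open>x\<close>.\<close>

lemma
  assumes M: "openin (top_of_set S) M" and x: "x \<in> M" and F: "F differentiable_on M"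
  shows rgrad_tangent: "rgrad K V M F x \<in> Tan x"
    and rgrad_derivative: "(F has_derivative frm (rgrad K V M F x)) (at x within M)"
proof -
  have MS: "M \<subseteq> S" using M by (rule openin_imp_subset)
  then have xS: "x \<in> S" using x by blast
  obtain E where E: "frame K V x E" by (rule frame_exists[OF xS])
  interpret ch: chart K V B x E 1 by (rule chart_at[OF xS E])
  obtain F' where F': "(F has_derivative F') (at x within M)"
    using F x by (auto simp: differentiable_on_def differentiable_def)
  have lin: "linear F'" using F' by (simp add: has_derivative_bounded_linear bounded_linear.linear)
  define g where "g = (\<Sum>e\<in>B. F' (E e) *\<^sub>R E e)"
  have gT: "g \<in> Tan x"
    unfolding g_def by (intro subspace_sum subspace_scale tangent_subspace ch.E_tangent ch.basis_in_V)
  have gv: "frm g v = F' v" if v: "v \<in> Tan x" for v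
  proof -
    have "v \<in> E ` V" using v E by (simp add: frame_def)
    then obtain u where u: "u \<in> V" "v = E u" by blast
    have "frm g v = (\<Sum>e\<in>B. F' (E e) * (e \<bullet> u))"
      unfolding g_def u(2) form_sum_left by (intro sum.cong) (auto simp: ch.E_form ch.basis_in_V u(1))
    also have "\<dots> = F' (ch.Ec u)"
      unfolding ch.Ec_def by (simp add: linear_sum[OF lin] linear_scale[OF lin] inner_commute mult.commute)
    finally show ?thesis by (simp add: ch.Ec_eq[OF u(1)] u(2))
  qed
  have gF: "(F has_derivative frm g) (at x within M)"
    unfolding has_derivative_within_alt
  proof (intro conjI bounded_linear_form allI impI)
    fix e :: real assume e: "0 < e"
    obtain d where d: "0 < d" "\<And>y. y \<in> M \<Longrightarrow> norm (y - x) < d \<Longrightarrow>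
        norm (F y - F x - F' (y - x)) \<le> e / 2 * norm (y - x)"
      using F' e unfolding has_derivative_within_alt by (meson half_gt_zero)
    define Q where "Q = \<bar>F' x\<bar> + 1"
    have Q: "0 < Q" by (simp add: Q_def)
    show "\<exists>d>0. \<forall>y\<in>M. norm (y - x) < d \<longrightarrow> norm (F y - F x - frm g (y - x)) \<le> e * norm (y - x)"
    proof (intro exI[of _ "min d (e / Q)"] conjI ballI impI)
      show "0 < min d (e / Q)" using d e Q by simp
      fix y assume y: "y \<in> M" "norm (y - x) < min d (e / Q)"
      have yS: "y \<in> S" using y MS by blast
      define n where "n = norm (y - x)"
      have two: "2 * frm x (y - x) = - frm (y - x) (y - x)"
        using xS yS by (simp add: S_form form_commute[of K y x])
      have fx: "\<bar>frm x (y - x)\<bar> \<le> n * n / 2"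
      proof -
        have "\<bar>2 * frm x (y - x)\<bar> \<le> n * n"
          using abs_form_le[of "y - x"] unfolding two n_def power2_eq_square by (simp only: abs_minus_cancel)
        then show ?thesis by linarith
      qed
      have "y - x - (K * frm x (y - x)) *\<^sub>R x \<in> Tan x"
        using V S_V[OF xS] S_V[OF yS] by (intro normal_part[OF xS]) (simp add: subspace_diff)
      then have "frm g (y - x - (K * frm x (y - x)) *\<^sub>R x) = F' (y - x - (K * frm x (y - x)) *\<^sub>R x)"
        by (rule gv)
      moreover have "frm g x = 0" using gT form_commute[of K g x] by (simp add: tangent_def)
      ultimately have "frm g (y - x) = F' (y - x) - K * frm x (y - x) * F' x"
        using linear_diff[OF lin, of "y - x" "(K * frm x (y - x)) *\<^sub>R x"] linear_scale[OF lin, of "K * frm x (y - x)" x]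
        by simp
      then have "F y - F x - frm g (y - x) = (F y - F x - F' (y - x)) + K * frm x (y - x) * F' x" by simp
      then have "\<bar>F y - F x - frm g (y - x)\<bar> \<le> \<bar>F y - F x - F' (y - x)\<bar> + \<bar>K * frm x (y - x) * F' x\<bar>"
        by (simp only: abs_triangle_ineq)
      also have "\<bar>F y - F x - F' (y - x)\<bar> \<le> e / 2 * n" using d(2)[OF y(1)] y(2) by (simp add: n_def)
      also have "\<bar>K * frm x (y - x) * F' x\<bar> = \<bar>frm x (y - x)\<bar> * \<bar>F' x\<bar>"
        using K by (auto simp: abs_mult)
      also have "\<dots> \<le> (n * n / 2) * Q" using fx by (intro mult_mono) (auto simp: Q_def)
      also have "\<dots> = n / 2 * (n * Q)" by simp
      also have "\<dots> \<le> n / 2 * e" using y(2) Q by (intro mult_left_mono) (auto simp: n_def field_simps)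
      finally show "norm (F y - F x - frm g (y - x)) \<le> e * norm (y - x)" by (simp add: n_def algebra_simps)
    qed
  qed
  have pt0: "h_inv K x E 0 = x" using ch.E_linear by (simp add: h_inv_def linear_0)
  have uniq: "g' = g" if g': "g' \<in> Tan x" "(F has_derivative frm g') (at x within M)" for g'
  proof -
    have z: "0 \<in> V" "0 \<in> ch.dom" using V by (auto simp: ch.dom_def subspace_0)
    have "frm g' (E w) = frm g (E w)" if w: "w \<in> V" for w
      using has_derivative_unique_subspace[OF V z(1) w
          ch.has_derivative_chart[OF M z, of F g'] ch.has_derivative_chart[OF M z, of F g]]
        g' gT gF x w by (simp add: pt0 ch.Ec_eq ch.s_def)
    moreover have "g' - g \<in> Tan x" using g'(1) gT by (intro subspace_diff tangent_subspace)
    moreover then have "g' - g \<in> E ` V" using E by (simp add: frame_def)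
    ultimately have "frm (g' - g) (g' - g) = 0" by (metis form_linear(2) imageE right_minus_eq)
    then have "g' - g = 0" using tangent_form_zero[OF xS \<open>g' - g \<in> Tan x\<close>] by blast
    then show ?thesis by simp
  qed
  have "rgrad K V M F x = g"
    unfolding rgrad_def using gT gF uniq by (intro the_equality) blast+
  then show "rgrad K V M F x \<in> Tan x" "(F has_derivative frm (rgrad K V M F x)) (at x within M)"
    using gT gF by auto
qed

end

context chart
begin

lemma
  assumes M: "openin (top_of_set S) M" and F: "F differentiable_on M"
    and u: "u \<in> V" "u \<in> dom" "pt u \<in> M"
  shows grad_in_eq: "grad_in V (F \<circ> pt) u = (\<Sum>e\<in>B. (frm (rgrad K V M F (pt u)) (E e) / s u) *\<^sub>R e)"
    and grad_in_V: "grad_in V (F \<circ> pt) u \<in> V"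
    and grad_in_derivative: "((F \<circ> pt) has_derivative (\<lambda>w. grad_in V (F \<circ> pt) u \<bullet> w)) (at u within V)"
    and grad_in_inner: "w \<in> V \<Longrightarrow> grad_in V (F \<circ> pt) u \<bullet> w = frm (rgrad K V M F (pt u)) (E w) / s u"
proof -
  define G where "G = rgrad K V M F (pt u)"
  define g where "g = (\<Sum>e\<in>B. (frm G (E e) / s u) *\<^sub>R e)"
  have gV: "g \<in> V" unfolding g_def using V by (intro subspace_sum subspace_scale basis_in_V)
  have gw: "g \<bullet> w = frm G (Ec w) / s u" for w
    unfolding g_def Ec_def form_sum_right inner_sum_left sum_divide_distrib
    by (intro sum.cong) (auto simp: inner_commute)
  have der: "((F \<circ> pt) has_derivative (\<lambda>w. g \<bullet> w)) (at u within V)"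
    unfolding gw G_def
    by (rule has_derivative_chart[OF M u rgrad_derivative[OF M u(3) F] rgrad_tangent[OF M u(3) F]])
  have "grad_in V (F \<circ> pt) u = g"
    unfolding grad_in_def
  proof (rule the_equality)
    fix g' assume g': "g' \<in> V \<and> ((F \<circ> pt) has_derivative (\<lambda>v. g' \<bullet> v)) (at u within V)"
    show "g' = g"
      by (rule inner_eq_subspace[OF V]) (use g' gV has_derivative_unique_subspace[OF V u(1) _ _ der] in auto)
  qed (use gV der in auto)
  then show "grad_in V (F \<circ> pt) u = (\<Sum>e\<in>B. (frm (rgrad K V M F (pt u)) (E e) / s u) *\<^sub>R e)"
    "grad_in V (F \<circ> pt) u \<in> V"
    "((F \<circ> pt) has_derivative (\<lambda>w. grad_in V (F \<circ> pt) u \<bullet> w)) (at u within V)"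
    "w \<in> V \<Longrightarrow> grad_in V (F \<circ> pt) u \<bullet> w = frm (rgrad K V M F (pt u)) (E w) / s u"
    using gV der gw[of w] by (auto simp: g_def G_def Ec_eq)
qed

lemma continuous_on_grad_in:
  assumes M: "openin (top_of_set S) M" and F: "F differentiable_on M"
    and G: "continuous_on M (rgrad K V M F)"
    and A: "A \<subseteq> V" "A \<subseteq> dom" "pt ` A \<subseteq> M"
  shows "continuous_on A (grad_in V (F \<circ> pt))"
proof -
  have p: "continuous_on A pt"
    using continuous_on_subset[OF continuous_on_ptc A(2)] A(1)
    by (subst continuous_on_cong[OF refl, of _ _ ptc]) (auto simp: ptc_eq)
  have "continuous_on A (\<lambda>u. \<Sum>e\<in>B. (frm (rgrad K V M F (pt u)) (E e) / s u) *\<^sub>R e)"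
    using A by (intro continuous_intros continuous_on_s continuous_on_compose2[OF G p]) (auto simp: s_def dom_def)
  then show ?thesis
    using A by (subst continuous_on_cong[OF refl]) (auto intro!: grad_in_eq M F)
qed

lemma continuous_on_chart:
  fixes F :: "real \<times> 'a \<Rightarrow> real"
  assumes M: "openin (top_of_set S) M" and F: "F differentiable_on M"
    and A: "A \<subseteq> V" "A \<subseteq> dom" "pt ` A \<subseteq> M"
  shows "continuous_on A (F \<circ> pt)"
  unfolding continuous_on_eq_continuous_within
proof
  fix u assume "u \<in> A"
  then have u: "u \<in> V" "u \<in> dom" "pt u \<in> M" using A by auto
  from has_derivative_continuous[OF grad_in_derivative[OF M F u]]
  show "continuous (at u within A) (F \<circ> pt)"
    using A(1) by (rule continuous_within_subset)
qed

end

section \<open>From second-order expansions to Lipschitz gradients\<close>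

text \<open>\<open>w\<close> has length \<rho> and points along the change of the gradient.
  Expanding \<open>f (u' + w)\<close> from \<open>u\<close> and from \<open>u'\<close> isolates the
  pairing of this change with \<open>w\<close>; the errors add up to 1 + 1 + 4 times
  \<open>M * \<rho>\<^sup>2\<close>, the 4 because \<open>u' + w\<close> is within
  \<open>2 * \<rho>\<close> of \<open>u\<close>.\<close>

lemma gradient_lipschitz_near:
  fixes f :: "'a::real_inner \<Rightarrow> real"
  assumes V: "subspace V" and X: "X \<subseteq> V" and gf: "gf u \<in> V" "gf u' \<in> V"
    and u: "u \<in> X" "u' \<in> X" and \<rho>: "norm (u' - u) = \<rho>" "2 * \<rho> \<le> d"
    and ball: "\<And>z. z \<in> V \<Longrightarrow> norm (z - u') \<le> \<rho> \<Longrightarrow> z \<in> X"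
    and M: "0 \<le> M" and taylor: "\<And>u v. u \<in> X \<Longrightarrow> v \<in> X \<Longrightarrow> norm (v - u) \<le> d \<Longrightarrow>
      \<bar>f v - f u - gf u \<bullet> (v - u)\<bar> \<le> M * (norm (v - u))\<^sup>2"
  shows "norm (gf u' - gf u) \<le> 6 * M * \<rho>"
proof (cases "gf u' = gf u \<or> \<rho> = 0")
  case True
  then show ?thesis using M \<rho>(1) by auto
next
  case False
  define D where "D = gf u' - gf u"
  have D: "D \<in> V" "0 < norm D" using False V gf by (auto simp: D_def subspace_diff)
  have r: "0 < \<rho>" using False \<rho>(1) by auto
  define w where "w = (\<rho> / norm D) *\<^sub>R D"
  have w: "w \<in> V" "norm w = \<rho>" using D V r by (auto simp: w_def subspace_scale)
  have Dw: "D \<bullet> w = \<rho> * norm D"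
    using D by (simp add: w_def dot_square_norm power2_eq_square)
  have v: "u' + w \<in> X" using w V X u by (intro ball) (auto intro: subspace_add)
  have 1: "\<bar>f (u' + w) - f u' - gf u' \<bullet> w\<bar> \<le> M * \<rho>\<^sup>2"
    using taylor[OF u(2) v] w r \<rho> by simp
  have 2: "\<bar>f u' - f u - gf u \<bullet> (u' - u)\<bar> \<le> M * \<rho>\<^sup>2"
    using taylor[OF u] r \<rho> by simp
  have n: "norm (u' + w - u) \<le> 2 * \<rho>" using norm_triangle_ineq[of "u' - u" w] w \<rho> by (simp add: algebra_simps)
  have "\<bar>f (u' + w) - f u - gf u \<bullet> (u' + w - u)\<bar> \<le> M * (norm (u' + w - u))\<^sup>2"
    using n \<rho> by (intro taylor[OF u(1) v]) simp
  also have "\<dots> \<le> M * (2 * \<rho>)\<^sup>2" using M n by (intro mult_left_mono power_mono) auto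
  finally have 3: "\<bar>f (u' + w) - f u - gf u \<bullet> (u' + w - u)\<bar> \<le> 4 * (M * \<rho>\<^sup>2)" by simp
  have "gf u \<bullet> (u' + w - u) = gf u \<bullet> (u' - u) + gf u \<bullet> w" by (simp add: inner_add_right inner_diff_right)
  then have "gf u' \<bullet> w - gf u \<bullet> w \<le> 6 * (M * \<rho>\<^sup>2)" using 1 2 3 by linarith
  then have "\<rho> * norm D \<le> \<rho> * (6 * M * \<rho>)"
    using Dw by (simp add: D_def inner_diff_left power2_eq_square algebra_simps)
  then show ?thesis using r by (simp add: D_def)
qed

text \<open>By convexity every point of the segment inherits the \<delta>-ball of its endpoints. The
  local estimate applies to steps shorter than \<delta> and at most \<open>d / 2\<close>, and
  summing it along a line loses no constant.\<close>

lemma gradient_lipschitz_interior: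
  fixes f :: "'a::real_inner \<Rightarrow> real"
  assumes V: "subspace V" and X: "X \<subseteq> V" "convex X" and gf: "\<And>u. u \<in> X \<Longrightarrow> gf u \<in> V"
    and u: "u \<in> X" "u' \<in> X" and \<delta>: "0 < \<delta>"
    and ball: "\<And>z. z \<in> V \<Longrightarrow> norm (z - u) < \<delta> \<Longrightarrow> z \<in> X" "\<And>z. z \<in> V \<Longrightarrow> norm (z - u') < \<delta> \<Longrightarrow> z \<in> X"
    and d: "0 < d" and M: "0 \<le> M" and taylor: "\<And>u v. u \<in> X \<Longrightarrow> v \<in> X \<Longrightarrow> norm (v - u) \<le> d \<Longrightarrow>
      \<bar>f v - f u - gf u \<bullet> (v - u)\<bar> \<le> M * (norm (v - u))\<^sup>2"
  shows "norm (gf u' - gf u) \<le> 6 * M * norm (u' - u)"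
proof -
  define e where "e = min (\<delta> / 2) (d / 2)"
  have e: "0 < e" using \<delta> d by (simp add: e_def)
  obtain n where n: "norm (u' - u) / e < real n" using reals_Archimedean2 by blast
  have n0: "0 < real n" using n e by (smt (verit) divide_nonneg_pos norm_ge_zero)
  define h where "h = norm (u' - u) / real n"
  have h: "h < \<delta>" "2 * h \<le> d"
  proof -
    have "h < e" using n n0 e by (simp add: h_def field_simps)
    then show "h < \<delta>" "2 * h \<le> d" using \<delta> d by (auto simp: e_def)
  qed
  define p where "p i = u + (real i / real n) *\<^sub>R (u' - u)" for i
  have pball: "z \<in> X" if z: "z \<in> V" "norm (z - p i) < \<delta>" and i: "i \<le> n" for z i
  proof -
    define t where "t = real i / real n"
    have t: "0 \<le> t" "t \<le> 1" using i n0 by (auto simp: t_def)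
    have pV: "p i \<in> V" unfolding p_def using V X(1) u by (intro subspace_add subspace_scale subspace_diff) auto
    have "v + (z - p i) \<in> V" if "v \<in> V" for v
      using z pV V that by (intro subspace_add subspace_diff)
    then have "u + (z - p i) \<in> V" "u' + (z - p i) \<in> V" using X(1) u by blast+
    then have "u + (z - p i) \<in> X" "u' + (z - p i) \<in> X"
      using z ball(1)[of "u + (z - p i)"] ball(2)[of "u' + (z - p i)"] by auto
    then have "(1 - t) *\<^sub>R (u + (z - p i)) + t *\<^sub>R (u' + (z - p i)) \<in> X"
      using X(2) t by (simp add: convex_alt)
    also have "(1 - t) *\<^sub>R (u + (z - p i)) + t *\<^sub>R (u' + (z - p i)) = z"
      by (simp add: p_def t_def[symmetric] algebra_simps)
    finally show ?thesis .
  qed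
  have pX: "p i \<in> X" if "i \<le> n" for i
  proof (rule pball[OF _ _ that])
    show "p i \<in> V" unfolding p_def using V X(1) u by (intro subspace_add subspace_scale subspace_diff) auto
  qed (use \<delta> in simp)
  have "i \<le> n \<Longrightarrow> norm (gf (p i) - gf u) \<le> real i * (6 * M * h)" for i
  proof (induction i)
    case 0
    then show ?case by (simp add: p_def)
  next
    case (Suc i)
    have "p (Suc i) - p i = (1 / real n) *\<^sub>R (u' - u)"
      by (simp add: p_def scaleR_diff_left[symmetric] diff_divide_distrib[symmetric])
    then have "norm (p (Suc i) - p i) = h" by (simp add: h_def)
    then have "norm (gf (p (Suc i)) - gf (p i)) \<le> 6 * M * h"
      using Suc.prems h pball[of _ "Suc i"]
      by (intro gradient_lipschitz_near[OF V X(1) gf gf _ _ _ _ _ M taylor] pX) auto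
    moreover have "norm (gf (p i) - gf u) \<le> real i * (6 * M * h)" using Suc by simp
    ultimately show ?case
      using norm_triangle_ineq[of "gf (p (Suc i)) - gf (p i)" "gf (p i) - gf u"]
      by (simp add: algebra_simps)
  qed
  from this[of n] show ?thesis using n0 by (simp add: p_def h_def)
qed

text \<open>The previous bound does not depend on \<delta>. Contracting both points towards the
  interior point \<open>c\<close> makes it applicable, and continuity of \<open>gf\<close> carries
  it to the boundary.\<close>

lemma gradient_lipschitz:
  fixes f :: "'a::real_inner \<Rightarrow> real"
  assumes V: "subspace V" and X: "X \<subseteq> V" "convex X" and gf: "\<And>u. u \<in> X \<Longrightarrow> gf u \<in> V"
    and cont: "continuous_on X gf"
    and \<delta>: "0 < \<delta>" and c: "c \<in> V" "\<And>z. z \<in> V \<Longrightarrow> norm (z - c) < \<delta> \<Longrightarrow> z \<in> X"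
    and d: "0 < d" and M: "0 \<le> M" and taylor: "\<And>u v. u \<in> X \<Longrightarrow> v \<in> X \<Longrightarrow> norm (v - u) \<le> d \<Longrightarrow>
      \<bar>f v - f u - gf u \<bullet> (v - u)\<bar> \<le> M * (norm (v - u))\<^sup>2"
  shows "(6 * M)-lipschitz_on X gf"
proof (rule lipschitz_onI)
  fix u' u assume u: "u' \<in> X" "u \<in> X"
  have cX: "c \<in> X" using c \<delta> by auto
  define t where "t n = inverse (real (Suc n))" for n
  have t: "0 < t n" "t n \<le> 1" for n by (auto simp: t_def inverse_le_1_iff)
  have t0: "t \<longlonglongrightarrow> 0" unfolding t_def by (rule LIMSEQ_inverse_real_of_nat)
  define p where "p v n = (1 - t n) *\<^sub>R v + t n *\<^sub>R c" for v n
  have pX: "p v n \<in> X" if "v \<in> X" for v n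
    using X(2) that cX t[of n] by (simp add: p_def convex_alt)
  have lim: "(\<lambda>n. gf (p v n)) \<longlonglongrightarrow> gf v" if "v \<in> X" for v
  proof -
    have "p v \<longlonglongrightarrow> (1 - 0) *\<^sub>R v + 0 *\<^sub>R c" unfolding p_def by (intro tendsto_intros t0)
    then have "p v \<longlonglongrightarrow> v" by simp
    then show ?thesis
      by (intro continuous_on_tendsto_compose[OF cont]) (auto simp: that pX)
  qed
  have bd: "norm (gf (p u' n) - gf (p u n)) \<le> 6 * M * norm (u' - u)" for n
  proof -
    have ball: "z \<in> X" if v: "v \<in> X" and z: "z \<in> V" "norm (z - p v n) < t n * \<delta>" for v z
    proof -
      \<comment> \<open>\<open>z\<close> is displaced from \<open>p v n\<close> by
        \<open>t n\<close> times the displacement of \<open>y\<close> from \<open>c\<close>; so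
        \<open>z\<close> is a convex combination of \<open>v\<close> and \<open>y\<close>.\<close>
      define y where "y = c + (1 / t n) *\<^sub>R (z - p v n)"
      have "norm (y - c) = norm (z - p v n) / t n" using t(1)[of n] by (simp add: y_def)
      then have "norm (y - c) < \<delta>" using z(2) t(1)[of n] by (simp add: pos_divide_less_eq mult.commute)
      moreover have "y \<in> V"
        unfolding y_def using V c z pX[OF v, of n] X by (intro subspace_add subspace_scale subspace_diff) auto
      ultimately have "y \<in> X" by (intro c)
      then have "(1 - t n) *\<^sub>R v + t n *\<^sub>R y \<in> X" using X(2) v t[of n] by (simp add: convex_alt)
      also have "(1 - t n) *\<^sub>R v + t n *\<^sub>R y = z"
        using t(1)[of n] by (simp add: y_def p_def scaleR_add_right)
      finally show ?thesis .
    qed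
    have "norm (gf (p u' n) - gf (p u n)) \<le> 6 * M * norm (p u' n - p u n)"
    proof (rule gradient_lipschitz_interior[where X = X and V = V and d = d and \<delta> = "t n * \<delta>" and f = f])
      show "0 < t n * \<delta>" using t(1)[of n] \<delta> by simp
      show "z \<in> X" if "z \<in> V" "norm (z - p u n) < t n * \<delta>" for z by (rule ball[OF u(2) that])
      show "z \<in> X" if "z \<in> V" "norm (z - p u' n) < t n * \<delta>" for z by (rule ball[OF u(1) that])
    qed (assumption | rule V X gf pX u d M taylor)+
    also have "p u' n - p u n = (1 - t n) *\<^sub>R (u' - u)" by (simp add: p_def algebra_simps)
    also have "6 * M * norm \<dots> \<le> 6 * M * norm (u' - u)"
      using M t[of n] by (intro mult_left_mono) (auto intro: mult_left_le_one_le)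
    finally show ?thesis .
  qed
  have "norm (gf u' - gf u) \<le> 6 * M * norm (u' - u)"
    using bd by (intro LIMSEQ_le_const2[OF tendsto_norm[OF tendsto_diff[OF lim[OF u(1)] lim[OF u(2)]]]]) auto
  then show "dist (gf u') (gf u) \<le> 6 * M * dist u' u" by (simp add: dist_norm)
qed (use M in simp)

section \<open>Smooth strongly convex functions on a ball\<close>

text \<open>\<open>\<sigma>\<close> is the distance from a point to the midpoint of two points which are at distance \<open>R\<close>
  from it and span the angle \<open>2 * pi / 3\<close>. In the flat case it would be \<open>R / 2\<close>.\<close>

definition midpoint_dist :: "real \<Rightarrow> real \<Rightarrow> real \<Rightarrow> bool" where
  "midpoint_dist K R \<sigma> \<longleftrightarrow>
    0 < \<sigma> \<and> \<sigma> \<le> R \<and> 2 * sinK K \<sigma> * cosK K R = sinK K R * cosK K \<sigma> \<and> R - 2 * \<sigma> \<noteq> 0"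

lemma midpoint_dist_exists:
  assumes K: "K = 1 \<or> K = - 1" and R: "0 < R" "K = 1 \<longrightarrow> R < pi / 2"
  shows "\<exists>\<sigma>. midpoint_dist K R \<sigma>"
proof -
  have sp: "0 < sinK K t" if "0 < t" "t \<le> R" for t
    using that R by (auto simp: sinK_def intro!: sin_gt_zero)
  have cp: "0 < cosK K R" using R by (auto simp: cosK_def intro!: cos_gt_zero_pi)
  \<comment> \<open>A zero of \<open>h\<close> is a point where tan (or tanh) takes half of its
    value at \<open>R\<close>, as in a right triangle with hypotenuse \<open>R\<close> and angle pi
    / 3.\<close>
  define h where "h t = 2 * sinK K t * cosK K R - sinK K R * cosK K t" for t
  have h0: "h 0 = - sinK K R" by (simp add: h_def sinK_def cosK_def)
  then have "h 0 \<le> 0" using sp[of R] R by linarith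
  moreover have "0 \<le> h R" using sp[of R] cp R by (simp add: h_def)
  moreover have "isCont h t" for t unfolding h_def sinK_def cosK_def by (cases "K = 1"; simp; (intro continuous_intros)?)
  ultimately obtain \<sigma> where \<sigma>: "0 \<le> \<sigma>" "\<sigma> \<le> R" "h \<sigma> = 0"
    using IVT[of h 0 0 R] R by auto
  have "\<sigma> \<noteq> 0" using \<sigma>(3) sp[of R] R h0 by auto
  then have pos: "0 < \<sigma>" using \<sigma> by simp
  \<comment> \<open>Here curvature enters: if \<open>R\<close> were twice \<sigma>, the double-angle
    formulas would force the cube of \<open>sinK K \<sigma>\<close> to vanish.\<close>
  have "R - 2 * \<sigma> \<noteq> 0"
  proof
    assume "R - 2 * \<sigma> = 0"
    then have R2: "R = 2 * \<sigma>" by simp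
    have d: "cosK K R = (cosK K \<sigma>)\<^sup>2 - K * (sinK K \<sigma>)\<^sup>2" "sinK K R = 2 * sinK K \<sigma> * cosK K \<sigma>"
      unfolding R2 using K by (auto simp: cosK_def sinK_def cos_double sin_double cosh_double sinh_double)
    have "2 * sinK K \<sigma> * (K * (sinK K \<sigma>)\<^sup>2) = 0"
      using \<sigma>(3) unfolding h_def d by (simp add: algebra_simps power2_eq_square)
    then show False using sp[OF pos \<sigma>(2)] K by auto
  qed
  then show ?thesis using pos \<sigma> by (auto simp: midpoint_dist_def h_def)
qed

locale objective = curved +
  fixes x0 :: "real \<times> 'a" and R :: real and M :: "(real \<times> 'a) set" and F :: "real \<times> 'a \<Rightarrow> real"
    and L \<mu> \<sigma> :: real
  assumes x0: "x0 \<in> S" and R: "0 < R" "K = 1 \<longrightarrow> R < pi / 2"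
    and M: "openin (top_of_set S) M" and DM: "rcball K V x0 R \<subseteq> M"
    and F: "F differentiable_on M" and G: "continuous_on M (rgrad K V M F)"
    and smooth: "smooth_in K V M F L (rcball K V x0 R)"
    and strong: "strongly_gconvex_in K V M F \<mu> (rcball K V x0 R)" and mu: "0 < \<mu>"
    and dim: "2 \<le> dim V" and sigma: "midpoint_dist K R \<sigma>"
begin

abbreviation "D \<equiv> rcball K V x0 R"
abbreviation "Gr \<equiv> rgrad K V M F"
abbreviation "k \<equiv> kappa K R"

lemma D_eq: "D = {y \<in> S. K * cosK K R \<le> frm x0 y}"
  by (rule rcball_eq[OF x0]) (use R pi_gt_zero in auto)

lemma D_S: "x \<in> D \<Longrightarrow> x \<in> S"
  by (simp add: D_eq)

lemma D_iff: "x \<in> S \<Longrightarrow> x \<in> D \<longleftrightarrow> rdist K x0 x \<le> R"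
  using rdist_le_iff[OF x0, of x R] R pi_gt_zero by (auto simp: D_eq)

lemma x0_D: "x0 \<in> D"
  using D_iff[OF x0] rdist_self[OF x0] R by simp

lemma Gr_tangent: "x \<in> D \<Longrightarrow> Gr x \<in> Tan x"
  using rgrad_tangent[OF M _ F] DM by blast

lemma F_lower: "x \<in> D \<Longrightarrow> y \<in> D \<Longrightarrow> F x + frm (Gr x) (exp_inv K V x y) + \<mu> / 2 * (rdist K x y)\<^sup>2 \<le> F y"
  using strong by (simp add: strongly_gconvex_in_def)

lemma F_upper: "x \<in> D \<Longrightarrow> y \<in> D \<Longrightarrow> F y \<le> F x + frm (Gr x) (exp_inv K V x y) + L / 2 * (rdist K x y)\<^sup>2"
  using smooth by (simp add: smooth_in_def)

lemma F_convex: "x \<in> D \<Longrightarrow> y \<in> D \<Longrightarrow> F x + frm (Gr x) (exp_inv K V x y) \<le> F y"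
  using F_lower[of x y] mu by (smt (verit) divide_nonneg_nonneg mult_nonneg_nonneg zero_le_power2)

definition E0 where "E0 = (SOME E. frame K V x0 E)"

lemma frame_E0: "frame K V x0 E0"
  unfolding E0_def using frame_exists[OF x0] by (metis someI_ex)

sublocale ch0: chart K V B x0 E0 R
  using x0 frame_E0 R by unfold_locales

lemma kappa_ge: "1 \<le> k"
  by (rule ch0.kappa_ge_1)

lemma D_pt0:
  assumes "x \<in> D"
  obtains u where "u \<in> ch0.U" "ch0.pt u = x"
  using ch0.pt_surj[of x] assms by (auto simp: D_eq)

text \<open>The third claim bounds the ambient functional \<open>form K g\<close> at
  \<open>y\<close> by the derivative along the geodesic to \<open>y\<close>. The scalar between them
  is at least \<open>1 / k ^ 5\<close>: \<open>ratio\<close> is at least \<open>1 / k ^ 3\<close>,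
  and the quotient of the two normalising factors is at most \<open>k ^ 2\<close>.\<close>

lemma
  assumes "x \<in> D" "y \<in> D"
  shows D_rdist_le: "rdist K x y \<le> 4 * k ^ 9"
    and D_rdist_lt_pi: "K = 1 \<longrightarrow> rdist K x y < pi"
    and D_form_le: "g \<in> Tan x \<Longrightarrow> \<bar>frm g y\<bar> \<le> k ^ 5 * \<bar>frm g (exp_inv K V x y)\<bar>"
proof -
  obtain u v where uv: "u \<in> ch0.U" "ch0.pt u = x" "v \<in> ch0.U" "ch0.pt v = y"
    using D_pt0 assms by metis
  note su = ch0.s_bounds[OF uv(1)] and sv = ch0.s_bounds[OF uv(3)]
  have k: "0 < k" "1 \<le> k" using kappa_ge by auto
  have "rdist K x y \<le> 2 * k ^ 8 * norm (v - u)" using ch0.rdist_pt_le[OF uv(1,3)] uv by simp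
  also have "norm (v - u) \<le> 2 * k"
    using uv ch0.tau_le_kappa norm_triangle_ineq4[of v u] by (auto simp: ch0.U_def)
  finally show "rdist K x y \<le> 4 * k ^ 9" using k by (simp add: power_def mult_left_mono)
  show lt: "K = 1 \<longrightarrow> rdist K x y < pi"
    using ch0.rdist_pt_bounds(2)[OF uv(1,3)] uv rdist_self[OF D_S[OF assms(1)]] by (cases "u = v") auto
  show "\<bar>frm g y\<bar> \<le> k ^ 5 * \<bar>frm g (exp_inv K V x y)\<bar>" if g: "g \<in> Tan x"
  proof (cases "u = v")
    case True
    then have "frm g y = 0" using g uv form_commute[of K g x] by (auto simp: tangent_def)
    then show ?thesis using k by simp
  next
    case False
    define A where "A = rdist K x y / sinK K (rdist K x y)"
    have "1 / k ^ 3 \<le> gamma_p K R"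
      using ch0.inv_gamma_le(2) ch0.gammas(3) k by (simp add: field_simps)
    also have "\<dots> \<le> A * (ch0.s u / ch0.s v)"
      using ch0.ratio_bounds(1)[OF uv(1,3) False] uv by (simp add: ch0.ratio_def A_def)
    finally have 1: "1 / k ^ 3 \<le> A * (ch0.s u / ch0.s v)" .
    have q: "0 < ch0.s u / ch0.s v" using su sv by simp
    have q': "ch0.s u / ch0.s v \<le> k / (1 / k)" by (rule frac_le) (use su sv k in auto)
    have A0: "0 < A"
    proof (rule ccontr)
      assume "\<not> 0 < A"
      then have "A * (ch0.s u / ch0.s v) \<le> 0" using q by (intro mult_nonpos_nonneg) auto
      moreover have "0 < 1 / k ^ 3" using k by simp
      ultimately show False using 1 by linarith
    qed
    have "1 / k ^ 3 \<le> A * (k / (1 / k))"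
      using 1 mult_left_mono[OF q', of A] A0 by linarith
    then have "1 \<le> k ^ 5 * A" using k by (simp add: field_simps power_def)
    then have "1 * \<bar>frm g y\<bar> \<le> (k ^ 5 * A) * \<bar>frm g y\<bar>" by (intro mult_right_mono) auto
    also have "A * frm g y = frm g (exp_inv K V x y)"
      unfolding form_exp_inv[OF D_S[OF assms(1)] D_S[OF assms(2)] lt g] A_def by simp
    then have "A * \<bar>frm g y\<bar> = \<bar>frm g (exp_inv K V x y)\<bar>" using A0 by (metis abs_mult abs_of_pos)
    then have "(k ^ 5 * A) * \<bar>frm g y\<bar> = k ^ 5 * \<bar>frm g (exp_inv K V x y)\<bar>" by (simp add: mult.assoc)
    finally show ?thesis by simp
  qed
qed

lemma sinK_R_pos: "0 < sinK K R"
  using sinK_pos R pi_gt_zero by auto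

lemma
  assumes e: "e \<in> V" "e \<bullet> e = 1" and t: "0 < t" "t \<le> R"
  defines "y \<equiv> exp_map K x0 (t *\<^sub>R E0 e)"
  shows ray_eq: "y = cosK K t *\<^sub>R x0 + sinK K t *\<^sub>R E0 e" and ray_D: "y \<in> D"
    and ray_dist: "rdist K x0 y = t"
    and ray_form: "g \<in> Tan x0 \<Longrightarrow> frm g (exp_inv K V x0 y) = t * frm g (E0 e)"
proof -
  have n: "rnorm K (t *\<^sub>R E0 e) = t" using t e by (simp add: rnorm_def ch0.E_form)
  have T: "t *\<^sub>R E0 e \<in> Tan x0" by (intro subspace_scale tangent_subspace ch0.E_tangent e)
  show eq: "y = cosK K t *\<^sub>R x0 + sinK K t *\<^sub>R E0 e" using t by (simp add: y_def exp_map_def n)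
  show yD: "y \<in> D" unfolding rcball_def y_def using T n t by auto
  have tpi: "K = 1 \<longrightarrow> t < pi" using t R by auto
  show d: "rdist K x0 y = t"
    by (rule rdist_eqI) (use t tpi exp_map_in(2)[OF x0 T] n in \<open>auto simp: y_def\<close>)
  show "frm g (exp_inv K V x0 y) = t * frm g (E0 e)" if g: "g \<in> Tan x0"
  proof -
    have lt: "K = 1 \<longrightarrow> rdist K x0 y < pi" unfolding d by (rule tpi)
    have "0 < sinK K t" using t tpi by (intro sinK_pos) auto
    moreover have "frm g x0 = 0" using g form_commute[of K g x0] by (simp add: tangent_def)
    ultimately show ?thesis
      unfolding form_exp_inv[OF x0 D_S[OF yD] lt g] d unfolding eq by simp
  qed
qed

text \<open>Lower and upper model are compared between \<open>x0\<close> and a boundary point of the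
  ball, where the first-order terms agree.\<close>

lemma mu_le_L: "\<mu> \<le> L"
proof -
  obtain e where e: "e \<in> V" "e \<bullet> e = 1"
    using exists_orthogonal_unit[OF V dim, of 0] V by (metis subspace_0)
  note y = ray_D[OF e, of R] ray_dist[OF e, of R]
  have "\<mu> / 2 * R\<^sup>2 \<le> L / 2 * R\<^sup>2"
    using F_lower[OF x0_D y(1)] F_upper[OF x0_D y(1)] R unfolding y(2)[OF R(1) order_refl] by linarith
  then show ?thesis using R by simp
qed

lemma L_pos: "0 < L"
  using mu_le_L mu by simp

section \<open>Gradient bounds on the ball\<close>

definition C0 :: real where "C0 = (16 * k ^ 18 + 2 * R\<^sup>2) / \<bar>R - 2 * \<sigma>\<bar>"

text \<open>A function whose Hessian is bounded by \<open>L\<close> is affine along geodesics up to \<open>O(L)\<close>. In flat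
  space this does not bound its gradient. Here the values at the vertices of a geodesic triangle
  with apex \<open>x0\<close> and at the midpoint of its base determine the gradient, since the distance
  from \<open>x0\<close> to this midpoint is not the Euclidean one.\<close>

lemma gradient_center_bound: "rnorm K (Gr x0) \<le> C0 * L"
proof -
  define g where "g = Gr x0"
  have g: "g \<in> Tan x0" unfolding g_def by (rule Gr_tangent[OF x0_D])
  then have "g \<in> E0 ` V" using frame_E0 by (simp add: frame_def)
  then obtain a where a: "a \<in> V" "g = E0 a" by blast
  define n where "n = norm a"
  have gn: "rnorm K g = n" using a by (simp add: rnorm_def ch0.E_form n_def norm_eq_sqrt_inner)
  obtain w where w: "w \<in> V" "w \<bullet> a = 0" "w \<bullet> w = 1" by (rule exists_orthogonal_unit[OF V dim a(1)])
  \<comment> \<open>\<open>h\<close> is the direction of the gradient, or any unit vector orthogonal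
    to \<open>w\<close> if the gradient vanishes.\<close>
  obtain h where h: "h \<in> V" "h \<bullet> h = 1" "h \<bullet> w = 0" "a \<bullet> h = n"
  proof (cases "a = 0")
    case False
    show ?thesis
      by (rule that[of "(1 / n) *\<^sub>R a"])
        (use False w a V in \<open>auto simp: n_def subspace_scale dot_square_norm power2_eq_square inner_commute\<close>)
  next
    case True
    obtain h where "h \<in> V" "h \<bullet> w = 0" "h \<bullet> h = 1" by (rule exists_orthogonal_unit[OF V dim w(1)])
    then show ?thesis using that True by (simp add: n_def)
  qed
  have sg: "0 < \<sigma>" "\<sigma> \<le> R" "2 * sinK K \<sigma> * cosK K R = sinK K R * cosK K \<sigma>" "R - 2 * \<sigma> \<noteq> 0"
    using sigma by (auto simp: midpoint_dist_def)
  \<comment> \<open>\<open>e 1\<close> and \<open>e (- 1)\<close> make angles of pi / 3 with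
    \<open>h\<close> on either side, so their sum is \<open>h\<close>.\<close>
  define e where "e b = (1 / 2) *\<^sub>R h + (b * sqrt 3 / 2) *\<^sub>R w" for b :: real
  have e: "e b \<in> V" "e b \<bullet> e b = 1" "a \<bullet> e b = n / 2" "e b \<bullet> h = 1 / 2" if "b = 1 \<or> b = - 1" for b
  proof -
    show "e b \<in> V" unfolding e_def using V h(1) w(1) by (intro subspace_add subspace_scale)
    have o: "a \<bullet> w = 0" "w \<bullet> h = 0" using w(2) h(3) by (simp_all add: inner_commute)
    have b2: "b * sqrt 3 * (b * sqrt 3) = 3" using that by auto
    show "e b \<bullet> e b = 1" "a \<bullet> e b = n / 2" "e b \<bullet> h = 1 / 2"
      using b2 by (simp_all add: e_def inner_add_left inner_add_right o h w)
  qed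
  define y where "y b = exp_map K x0 (R *\<^sub>R E0 (e b))" for b
  define m where "m = exp_map K x0 (\<sigma> *\<^sub>R E0 h)"
  have y: "y b = cosK K R *\<^sub>R x0 + sinK K R *\<^sub>R E0 (e b)" "y b \<in> D" "rdist K x0 (y b) = R"
      "frm g (exp_inv K V x0 (y b)) = R * (n / 2)" if b: "b = 1 \<or> b = - 1" for b
    unfolding y_def using ray_eq[OF e(1,2)[OF b], of R] ray_D[OF e(1,2)[OF b], of R]
      ray_dist[OF e(1,2)[OF b], of R] ray_form[OF e(1,2)[OF b] _ _ g, of R] R
      ch0.E_form[OF a(1) e(1)[OF b]] e(3)[OF b] a(2) by auto
  have m: "m = cosK K \<sigma> *\<^sub>R x0 + sinK K \<sigma> *\<^sub>R E0 h" "m \<in> D" "rdist K x0 m = \<sigma>"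
      "frm g (exp_inv K V x0 m) = \<sigma> * n"
    unfolding m_def using ray_eq[OF h(1,2) sg(1,2)] ray_D[OF h(1,2) sg(1,2)]
      ray_dist[OF h(1,2) sg(1,2)] ray_form[OF h(1,2) sg(1,2) g]
      ch0.E_form[OF a(1) h(1)] h(4) a(2) by auto
  have cs: "cosK K \<sigma> \<noteq> 0" 
  proof -
    have "0 < cosK K \<sigma>" using sg R by (auto simp: cosK_def intro!: cos_gt_zero_pi)
    then show ?thesis by simp
  qed
  \<comment> \<open>The equation for \<sigma> makes the sum of the base vertices a multiple of
    \<open>m\<close>, so \<open>m\<close> is the midpoint of the base.\<close>
  define \<nu> where "\<nu> = 2 * cosK K R / cosK K \<sigma>"
  have sum: "y 1 + y (- 1) = \<nu> *\<^sub>R m"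
  proof -
    have "e 1 + e (- 1) = h" by (simp add: e_def algebra_simps flip: scaleR_add_left)
    then have "E0 (e 1) + E0 (e (- 1)) = E0 h" using ch0.E_linear by (metis linear_add)
    moreover have "y 1 + y (- 1) = (cosK K R *\<^sub>R x0 + cosK K R *\<^sub>R x0) + sinK K R *\<^sub>R (E0 (e 1) + E0 (e (- 1)))"
      using y(1)[of 1] y(1)[of "- 1"] by (simp add: scaleR_add_right)
    ultimately have "y 1 + y (- 1) = (2 * cosK K R) *\<^sub>R x0 + sinK K R *\<^sub>R E0 h"
      by (simp only: scaleR_add_left[symmetric] mult_2)
    moreover have "\<nu> * cosK K \<sigma> = 2 * cosK K R" "\<nu> * sinK K \<sigma> = sinK K R"
      using cs sg(3) by (simp_all add: \<nu>_def field_simps)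
    ultimately show ?thesis by (simp add: m(1) scaleR_add_right)
  qed
  define \<delta> where "\<delta> = rdist K m (y 1)"
  have \<delta>: "rdist K m (y b) = \<delta>" if b: "b = 1 \<or> b = - 1" for b
  proof -
    have "frm m (y b) = cosK K \<sigma> * cosK K R * K + sinK K \<sigma> * sinK K R / 2" if b: "b = 1 \<or> b = - 1" for b
      unfolding m(1) y(1)[OF b] using h(1) e[OF b] x0
      by (simp add: S_form ch0.form_c_E ch0.E_form inner_commute[of h] algebra_simps)
    from this[of 1] this[OF b] have "frm m (y b) = frm m (y 1)" by simp
    then show ?thesis unfolding \<delta>_def rdist_def by (simp only:)
  qed
  have \<delta>_le: "0 \<le> \<delta>" "\<delta> \<le> 4 * k ^ 9"
    unfolding \<delta>_def using D_rdist_le[OF m(2) y(2)] rdist_nonneg[OF D_S[OF m(2)] D_S[OF y(2)]] by auto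
  have "\<delta>\<^sup>2 \<le> (4 * k ^ 9)\<^sup>2" using \<delta>_le by (intro power_mono)
  then have \<delta>2: "\<delta>\<^sup>2 \<le> 16 * k ^ 18" by (simp add: power_mult_distrib flip: power_mult)
  define q where "q b = frm (Gr m) (exp_inv K V m (y b))" for b
  \<comment> \<open>The half-bases leave \<open>m\<close> in opposite directions, so the first-order
    terms at \<open>m\<close> cancel.\<close>
  have "q 1 + q (- 1) = 0"
  proof -
    have T: "Gr m \<in> Tan m" by (rule Gr_tangent[OF m(2)])
    have "q b = \<delta> / sinK K \<delta> * frm (Gr m) (y b)" if b: "b = 1 \<or> b = - 1" for b
      unfolding q_def form_exp_inv[OF D_S[OF m(2)] D_S[OF y(2)[OF b]] D_rdist_lt_pi[OF m(2) y(2)[OF b]] T] \<delta>[OF b] ..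
    from this[of 1] this[of "- 1"] have "q 1 + q (- 1) = \<delta> / sinK K \<delta> * frm (Gr m) (y 1 + y (- 1))"
      by (simp add: distrib_left)
    also have "\<dots> = 0" unfolding sum using T form_commute[of K "Gr m" m] by (simp add: tangent_def)
    finally show ?thesis .
  qed
  moreover have "F m + q b \<le> F (y b)" "F (y b) \<le> F m + q b + L / 2 * \<delta>\<^sup>2" if b: "b = 1 \<or> b = - 1" for b
    using F_convex[OF m(2) y(2)[OF b]] F_upper[OF m(2) y(2)[OF b]] \<delta>[OF b] by (auto simp: q_def)
  from this[of 1] this[of "- 1"]
  have "F m + q 1 \<le> F (y 1)" "F (y 1) \<le> F m + q 1 + L / 2 * \<delta>\<^sup>2"
    "F m + q (- 1) \<le> F (y (- 1))" "F (y (- 1)) \<le> F m + q (- 1) + L / 2 * \<delta>\<^sup>2" by auto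
  moreover have "F x0 + R * (n / 2) \<le> F (y b)" "F (y b) \<le> F x0 + R * (n / 2) + L / 2 * R\<^sup>2" if b: "b = 1 \<or> b = - 1" for b
    using F_convex[OF x0_D y(2)[OF b]] F_upper[OF x0_D y(2)[OF b]] y(3,4)[OF b] by (auto simp: g_def)
  from this[of 1] this[of "- 1"]
  have "F x0 + R * (n / 2) \<le> F (y 1)" "F (y 1) \<le> F x0 + R * (n / 2) + L / 2 * R\<^sup>2"
    "F x0 + R * (n / 2) \<le> F (y (- 1))" "F (y (- 1)) \<le> F x0 + R * (n / 2) + L / 2 * R\<^sup>2" by auto
  moreover have "F x0 + \<sigma> * n \<le> F m" "F m \<le> F x0 + \<sigma> * n + L / 2 * \<sigma>\<^sup>2"
    using F_convex[OF x0_D m(2)] F_upper[OF x0_D m(2)] m(3,4) by (auto simp: g_def)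
  moreover have "(R - 2 * \<sigma>) * n = 2 * (R * (n / 2)) - 2 * (\<sigma> * n)" by (simp add: algebra_simps)
  \<comment> \<open>Up to \<open>O(L)\<close>, \<open>F (y 1) + F (y (- 1))\<close> is
    \<open>2 * F x0 + R * n\<close> along the legs, and \<open>2 * F m\<close>, hence
    \<open>2 * F x0 + 2 * \<sigma> * n\<close>, through the midpoint. The three errors belong to the
    half-bases, the segment to \<open>m\<close> and the legs; the half-bases are bounded by the
    diameter bound \<open>4 * k ^ 9\<close>.\<close>
  ultimately have "\<bar>(R - 2 * \<sigma>) * n\<bar> \<le> L * \<delta>\<^sup>2 + L * \<sigma>\<^sup>2 + L * R\<^sup>2"
    using L_pos by (auto simp: abs_le_iff) 
  also have "\<dots> \<le> L * (16 * k ^ 18) + L * R\<^sup>2 + L * R\<^sup>2"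
    using \<delta>2 sg L_pos by (intro add_mono mult_left_mono power_mono) auto
  also have "\<dots> = (16 * k ^ 18 + 2 * R\<^sup>2) * L" by (simp add: algebra_simps)
  finally have "\<bar>R - 2 * \<sigma>\<bar> * n \<le> (16 * k ^ 18 + 2 * R\<^sup>2) * L" by (simp add: abs_mult n_def)
  then have "n \<le> C0 * L" unfolding C0_def using sg(4) by (simp add: field_simps)
  then show ?thesis using gn by (simp add: g_def)
qed

definition C1 :: real where "C1 = C0 * R + R\<^sup>2 / 2"
definition C2 :: real where "C2 = k ^ 5 * (2 * C1 + 8 * k ^ 18)"
definition CG :: real where "CG = C2 + C2 * (1 + cosK K R) / sinK K R"

lemma F_center_bound:
  assumes y: "y \<in> D"
  shows "\<bar>F y - F x0\<bar> \<le> C1 * L"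
proof -
  have lt: "K = 1 \<longrightarrow> rdist K x0 y < pi" by (rule D_rdist_lt_pi[OF x0_D y])
  have t: "0 \<le> rdist K x0 y" "rdist K x0 y \<le> R" using rdist_nonneg[OF x0 D_S[OF y]] D_iff[OF D_S[OF y]] y by auto
  have "exp_inv K V x0 y \<in> Tan x0" "rnorm K (exp_inv K V x0 y) = rdist K x0 y"
    using exp_inv_tangent[OF x0 D_S[OF y] lt] exp_inv_norm[OF x0 D_S[OF y] lt]
    unfolding exp_inv_eq[OF x0 D_S[OF y] lt] by auto
  then have "\<bar>frm (Gr x0) (exp_inv K V x0 y)\<bar> \<le> rnorm K (Gr x0) * rdist K x0 y"
    using tangent_cauchy_schwarz[OF x0 Gr_tangent[OF x0_D]] by metis
  also have "\<dots> \<le> (C0 * L) * R"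
  proof (intro mult_mono gradient_center_bound t)
    have "0 \<le> rnorm K (Gr x0)" using tangent_form_nonneg[OF x0 Gr_tangent[OF x0_D]] by (simp add: rnorm_def)
    then show "0 \<le> C0 * L" using gradient_center_bound by linarith
  qed
  finally have 1: "\<bar>frm (Gr x0) (exp_inv K V x0 y)\<bar> \<le> C0 * L * R" .
  have "L / 2 * (rdist K x0 y)\<^sup>2 \<le> L / 2 * R\<^sup>2" using t L_pos by (intro mult_left_mono power_mono) auto
  then have "\<bar>F y - F x0\<bar> \<le> C0 * L * R + L / 2 * R\<^sup>2"
    using 1 F_convex[OF x0_D y] F_upper[OF x0_D y] L_pos
    by (smt (verit) mult_nonneg_nonneg divide_nonneg_nonneg zero_le_power2)
  then show ?thesis by (simp add: C1_def algebra_simps)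
qed

text \<open>\<open>F\<close> oscillates by \<open>O(L)\<close> on the ball, so the expansion from
  \<open>x\<close> to \<open>y\<close> leaves a first-order term of that size. Stating this for the
  ambient functional \<open>form K (Gr x)\<close> avoids a division by the distance from
  \<open>x\<close> to \<open>y\<close>.\<close>

lemma gradient_form_bound:
  assumes x: "x \<in> D" and y: "y \<in> D"
  shows "\<bar>frm (Gr x) y\<bar> \<le> C2 * L"
proof -
  have t: "0 \<le> rdist K x y" "rdist K x y \<le> 4 * k ^ 9"
    using rdist_nonneg[OF D_S[OF x] D_S[OF y]] D_rdist_le[OF x y] by auto
  have "(rdist K x y)\<^sup>2 \<le> (4 * k ^ 9)\<^sup>2" using t by (intro power_mono)
  also have "\<dots> = 16 * k ^ 18" by (simp add: power_mult_distrib flip: power_mult)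
  finally have "L / 2 * (rdist K x y)\<^sup>2 \<le> L / 2 * (16 * k ^ 18)" using L_pos by (intro mult_left_mono) auto
  then have r: "L / 2 * (rdist K x y)\<^sup>2 \<le> 8 * k ^ 18 * L" by (simp add: mult_ac)
  have o: "\<bar>F y - F x\<bar> \<le> 2 * (C1 * L)" using F_center_bound[OF x] F_center_bound[OF y] by linarith
  have "0 < k ^ 18" using kappa_ge by simp
  then have "0 \<le> 8 * k ^ 18 * L" using L_pos by simp
  then have "\<bar>frm (Gr x) (exp_inv K V x y)\<bar> \<le> 2 * (C1 * L) + 8 * k ^ 18 * L"
    using F_convex[OF x y] F_upper[OF x y] o r by (simp add: abs_le_iff)
  then have "k ^ 5 * \<bar>frm (Gr x) (exp_inv K V x y)\<bar> \<le> k ^ 5 * (2 * (C1 * L) + 8 * k ^ 18 * L)"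
    using kappa_ge by (intro mult_left_mono) auto
  then show ?thesis
    using D_form_le[OF x y Gr_tangent[OF x]] by (simp add: C2_def algebra_simps)
qed

text \<open>The functional \<open>form K (Gr x)\<close> is bounded at \<open>x0\<close> and at the
  boundary points in all directions from \<open>x0\<close>, which span the ambient space. These test
  points do not depend on \<open>x\<close>, so the bound does not deteriorate when \<open>x\<close>
  approaches the boundary.\<close>

lemma gradient_bound:
  assumes x: "x \<in> D"
  shows "rnorm K (Gr x) \<le> CG * L"
proof -
  define g where "g = Gr x"
  have g: "g \<in> Tan x" unfolding g_def by (rule Gr_tangent[OF x])
  define P where "P = g - (K * frm x0 g) *\<^sub>R x0"
  have P: "P \<in> Tan x0" unfolding P_def by (rule normal_part[OF x0]) (use g in \<open>simp add: tangent_def\<close>)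
  then have "P \<in> E0 ` V" using frame_E0 by (simp add: frame_def)
  then obtain b where b: "b \<in> V" "P = E0 b" by blast
  define C3 where "C3 = C2 * (1 + cosK K R) / sinK K R"
  have c: "\<bar>frm g x0\<bar> \<le> C2 * L" unfolding g_def by (rule gradient_form_bound[OF x x0_D])
  have C2L: "0 \<le> C2 * L" using c by linarith
  have C3L: "0 \<le> C3 * L"
  proof -
    have "C3 * L = (C2 * L) * ((1 + cosK K R) / sinK K R)" by (simp add: C3_def)
    then show ?thesis using C2L ch0.cosK_pos sinK_R_pos by simp
  qed
  have nb: "norm b \<le> C3 * L"
  proof (cases "b = 0")
    case True
    then show ?thesis using C3L by simp
  next
    case False
    \<comment> \<open>The boundary point in the direction of the tangential part \<open>b\<close>
      reads off the norm of \<open>b\<close>.\<close>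
    define e where "e = (1 / norm b) *\<^sub>R b"
    have e: "e \<in> V" "e \<bullet> e = 1" using False V b by (auto simp: e_def subspace_scale dot_square_norm power2_eq_square)
    note y = ray_D[OF e R(1) order_refl] ray_eq[OF e R(1) order_refl]
    have "\<bar>frm g (cosK K R *\<^sub>R x0 + sinK K R *\<^sub>R E0 e)\<bar> \<le> C2 * L"
      using gradient_form_bound[OF x y(1)] unfolding y(2) g_def .
    then have "\<bar>cosK K R * frm g x0 + sinK K R * frm g (E0 e)\<bar> \<le> C2 * L" by simp
    moreover have "\<bar>cosK K R * frm g x0\<bar> \<le> cosK K R * (C2 * L)"
      using ch0.cosK_pos c by (simp add: abs_mult)
    ultimately have "sinK K R * frm g (E0 e) \<le> (1 + cosK K R) * (C2 * L)" by (simp add: algebra_simps abs_le_iff)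
    then have 1: "frm g (E0 e) \<le> C3 * L" using sinK_R_pos by (simp add: C3_def field_simps)
    have "frm P (E0 e) = frm g (E0 e)" by (simp add: P_def ch0.form_c_E e)
    moreover have "frm P (E0 e) = norm b"
      unfolding b(2) using ch0.E_form[OF b(1) e(1)] False by (simp add: e_def dot_square_norm power2_eq_square)
    ultimately show ?thesis using 1 by simp
  qed
  have "frm P P = (norm b)\<^sup>2" unfolding b(2) using ch0.E_form[OF b(1,1)] by (simp add: dot_square_norm)
  then have "frm g g = K * (frm x0 g)\<^sup>2 + (norm b)\<^sup>2"
    using normal_part_form[OF x0, of g] by (simp add: P_def)
  also have "\<dots> \<le> (C2 * L)\<^sup>2 + (C3 * L)\<^sup>2"
  proof (intro add_mono)
    have "K * (frm x0 g)\<^sup>2 \<le> (frm x0 g)\<^sup>2" using K by auto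
    also have "\<dots> \<le> (C2 * L)\<^sup>2" using c C2L by (simp add: form_commute[of K x0 g] abs_le_square_iff[symmetric])
    finally show "K * (frm x0 g)\<^sup>2 \<le> (C2 * L)\<^sup>2" .
    show "(norm b)\<^sup>2 \<le> (C3 * L)\<^sup>2" using nb by (simp add: power_mono)
  qed
  also have "\<dots> \<le> (C2 * L + C3 * L)\<^sup>2" using C2L C3L by (simp add: power2_sum)
  finally have "rnorm K g \<le> C2 * L + C3 * L"
    unfolding rnorm_def using C2L C3L by (intro real_le_lsqrt) auto
  then show ?thesis by (simp add: g_def CG_def C3_def algebra_simps)
qed

end

section \<open>Convergence of the accelerated iteration in coordinates\<close>

locale tilted_problem =
  fixes X :: "'a::real_inner set" and f :: "'a \<Rightarrow> real" and gf :: "'a \<Rightarrow> 'a"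
    and \<gamma>n \<gamma>p Lt :: real
  assumes X: "compact X" "convex X" "0 \<in> X"
    and gn: "0 < \<gamma>n" "\<gamma>n \<le> 1" and gp: "0 < \<gamma>p" "\<gamma>p \<le> 1"
    and Lt: "0 < Lt" and lip: "Lt-lipschitz_on X gf"
    and tilt: "\<And>u v. u \<in> X \<Longrightarrow> v \<in> X \<Longrightarrow>
      \<exists>\<rho>\<ge>\<gamma>p. \<rho> \<le> 1 / \<gamma>n \<and> f u + \<rho> * (gf u \<bullet> (v - u)) \<le> f v"
begin

abbreviation "Astep \<equiv> step_coeff \<gamma>n \<gamma>p Lt"
abbreviation "Asum \<equiv> sum_coeff \<gamma>n \<gamma>p Lt"
abbreviation "Lam \<equiv> lam_of \<gamma>n \<gamma>p Lt"
abbreviation "Next \<equiv> next_x X gf \<gamma>n \<gamma>p Lt"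
abbreviation "Slope \<equiv> slope X gf \<gamma>n \<gamma>p Lt"

lemma X_nonempty: "X \<noteq> {}"
  using X(3) by auto

lemma step_pos: "0 < Astep (Suc i)"
  using gn gp Lt by (simp add: step_coeff_def)

lemma sum_coeff_Suc: "Asum (Suc i) = Asum i + Astep (Suc i)"
  by (simp add: sum_coeff_def)

lemma sum_coeff_closed: "Asum i = real i * (real i + 1) * \<gamma>n\<^sup>2 * \<gamma>p / (4 * Lt)"
proof (induction i)
  case 0
  then show ?case by (simp add: sum_coeff_def)
next
  case (Suc i)
  show ?case
    unfolding sum_coeff_Suc Suc step_coeff_def using Lt by (simp add: field_simps)
qed

lemma sum_coeff_mono: "i \<le> j \<Longrightarrow> Asum i \<le> Asum j"
  unfolding sum_coeff_closed using gn gp Lt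
  by (intro divide_right_mono mult_right_mono mult_mono) auto

lemma sum_coeff_pos: "0 < i \<Longrightarrow> 0 < Asum i"
  unfolding sum_coeff_closed using gn gp Lt by simp

lemma sum_coeff_0: "Asum 0 = 0"
  by (simp add: sum_coeff_def)

lemma sum_coeff_nonneg: "0 \<le> Asum i"
  unfolding sum_coeff_closed using gn gp Lt by simp

lemma gp_le_gn: "\<gamma>p \<le> 1 / \<gamma>n"
proof -
  have "1 \<le> 1 / \<gamma>n" using gn by simp
  then show ?thesis using gp by linarith
qed

lemma gf_diff: "u \<in> X \<Longrightarrow> v \<in> X \<Longrightarrow> norm (gf u - gf v) \<le> Lt * norm (u - v)"
  using lip by (auto simp: lipschitz_on_def dist_norm)

lemma convex_mem: "u \<in> X \<Longrightarrow> v \<in> X \<Longrightarrow> 0 \<le> l \<Longrightarrow> l \<le> 1 \<Longrightarrow> (1 - l) *\<^sub>R u + l *\<^sub>R v \<in> X"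
  using X(2) by (simp add: convex_alt)

lemma proj_mem: "proj X z \<in> X"
  by (rule proj_in[OF X(1) X_nonempty])

lemma chi_mem: "x \<in> X \<Longrightarrow> 0 \<le> l \<Longrightarrow> l \<le> 1 \<Longrightarrow> chi_pt X x z l \<in> X"
  unfolding chi_pt_def by (intro convex_mem proj_mem)

lemma next_mem: "x \<in> X \<Longrightarrow> 0 \<le> l \<Longrightarrow> l \<le> 1 \<Longrightarrow> Next i x z l \<in> X"
  unfolding next_x_def by (intro convex_mem proj_mem)

text \<open>The gap in the Fenchel-Young inequality for half the squared norm on \<open>X\<close>;
  the conjugate function at \<open>z\<close> is attained at \<open>proj X z\<close>.\<close>

definition potential :: "'a \<Rightarrow> 'a \<Rightarrow> real" where
  "potential w z = z \<bullet> proj X z - (proj X z \<bullet> proj X z) / 2 - z \<bullet> w + (w \<bullet> w) / 2"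

lemma potential_nonneg: "w \<in> X \<Longrightarrow> 0 \<le> potential w z"
  unfolding potential_def using proj_three_point[OF X(1,2), of w z]
    inner_ge_zero[of "w - proj X z"] by linarith

lemma potential_0: "potential w 0 = (norm w)\<^sup>2 / 2"
  unfolding potential_def using proj_fixes[OF X(1,3)] by (simp add: dot_square_norm)

text \<open>The extragradient argument: both projections enter through strong concavity of the function
  that they maximise, and the gap between the two gradients is absorbed by these quadratic terms.\<close>

lemma potential_step:
  fixes x z w :: 'a and l :: real and i :: nat
  assumes x: "x \<in> X" and w: "w \<in> X" and l: "0 \<le> l" "l \<le> 1"
  defines "ah \<equiv> Astep (Suc i) / \<gamma>n"
  assumes small: "ah * Lt * l \<le> 1"
  defines "y \<equiv> proj X (zeta_pt X gf \<gamma>n \<gamma>p Lt i x z l)" and "g \<equiv> gf (Next i x z l)"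
  shows "ah * (g \<bullet> (y - w)) \<le> potential w z - potential w (z - ah *\<^sub>R g)"
proof -
  define g' where "g' = gf (chi_pt X x z l)"
  define p where "p = proj X z"
  define p' where "p' = proj X (z - ah *\<^sub>R g)"
  have ah: "0 \<le> ah" using step_pos[of i] gn by (simp add: ah_def)
  have y: "y = proj X (z - ah *\<^sub>R g')" by (simp add: y_def zeta_pt_def ah_def g'_def)
  have mem: "y \<in> X" "p' \<in> X" unfolding y_def p'_def by (auto intro: proj_mem)
  \<comment> \<open>The two query points differ only in the projected point, with weight
    \<open>l\<close>; this weight is what \<open>small\<close> balances against the Lipschitz
    constant.\<close>
  have "Next i x z l - chi_pt X x z l = l *\<^sub>R (y - p)"
    by (simp add: next_x_def chi_pt_def y_def p_def algebra_simps)
  then have "norm (g - g') \<le> Lt * (l * norm (y - p))"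
    using gf_diff[OF next_mem[OF x l, of i z] chi_mem[OF x l, of z]] l by (simp add: g_def g'_def)
  then have "ah * norm (g - g') \<le> ah * (Lt * (l * norm (y - p)))"
    using ah by (rule mult_left_mono)
  also have "\<dots> = (ah * Lt * l) * norm (y - p)" by simp
  also have "\<dots> \<le> norm (y - p)" using mult_right_mono[OF small norm_ge_zero[of "y - p"]] by simp
  finally have gg: "norm (ah *\<^sub>R (g - g')) \<le> norm (y - p)" using ah by simp
  have "- (ah *\<^sub>R (g - g')) \<bullet> (p' - y) \<le> ((ah *\<^sub>R (g - g')) \<bullet> (ah *\<^sub>R (g - g'))) / 2 + ((p' - y) \<bullet> (p' - y)) / 2"
    using inner_ge_zero[of "ah *\<^sub>R (g - g') + (p' - y)"]
    unfolding inner_add_left inner_add_right inner_minus_left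
      inner_commute[of "p' - y" "ah *\<^sub>R (g - g')"] by linarith
  also have "(ah *\<^sub>R (g - g')) \<bullet> (ah *\<^sub>R (g - g')) \<le> (y - p) \<bullet> (y - p)"
    using gg by (metis norm_le)
  finally have cross: "- (ah *\<^sub>R (g - g')) \<bullet> (p' - y) \<le> ((y - p) \<bullet> (y - p)) / 2 + ((p' - y) \<bullet> (p' - y)) / 2"
    by simp
  have "(z - ah *\<^sub>R g') \<bullet> p' - (p' \<bullet> p') / 2 \<le> (z - ah *\<^sub>R g') \<bullet> y - (y \<bullet> y) / 2 - ((p' - y) \<bullet> (p' - y)) / 2"
    using proj_three_point[OF X(1,2) mem(2), of "z - ah *\<^sub>R g'"] y by simp
  moreover have "z \<bullet> y - (y \<bullet> y) / 2 \<le> z \<bullet> p - (p \<bullet> p) / 2 - ((y - p) \<bullet> (y - p)) / 2"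
    using proj_three_point[OF X(1,2) mem(1), of z] by (simp add: p_def)
  ultimately show ?thesis
    using cross unfolding potential_def p_def[symmetric] p'_def[symmetric]
    by (simp add: inner_diff_left inner_diff_right inner_commute algebra_simps)
qed

lemma lam_bounds:
  assumes "0 \<le> \<gamma>"
  shows "0 < Lam i \<gamma>" "Lam i \<gamma> \<le> 1"
proof -
  have "0 < Astep (Suc i) / \<gamma>n" using step_pos gn by simp
  moreover have "0 \<le> Asum i * \<gamma>" using sum_coeff_nonneg assms by simp
  moreover have "0 < b / (a + b)" "b / (a + b) \<le> 1" if "0 < b" "0 \<le> a" for a b :: real
    using that by auto
  ultimately show "0 < Lam i \<gamma>" "Lam i \<gamma> \<le> 1" unfolding lam_of_def by blast+
qed

lemma lam_antimono:
  assumes "0 \<le> \<gamma>" "\<gamma> \<le> \<gamma>'"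
  shows "Lam i \<gamma>' \<le> Lam i \<gamma>"
proof -
  have "0 < Astep (Suc i) / \<gamma>n" using step_pos gn by simp
  moreover have "0 \<le> Asum i * \<gamma>" "Asum i * \<gamma> \<le> Asum i * \<gamma>'"
    using sum_coeff_nonneg[of i] assms by (auto intro: mult_left_mono)
  ultimately show ?thesis unfolding lam_of_def by (intro divide_left_mono) auto
qed

text \<open>Solving for \<gamma> shows that every \<lambda> between two values of
  \<open>Lam i\<close> is again a value, for an intermediate \<gamma>. Hence bisection over
  \<lambda> never leaves the admissible factors.\<close>

lemma lam_surj:
  assumes i: "0 < i" and g: "0 \<le> \<gamma>1" "0 \<le> \<gamma>2" and l: "Lam i \<gamma>2 \<le> l" "l \<le> Lam i \<gamma>1"
  obtains \<gamma> where "\<gamma>1 \<le> \<gamma>" "\<gamma> \<le> \<gamma>2" "l = Lam i \<gamma>"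
proof -
  define b where "b = Astep (Suc i) / \<gamma>n"
  have b: "0 < b" using step_pos gn by (simp add: b_def)
  have A: "0 < Asum i" using sum_coeff_pos i by simp
  have l0: "0 < l" using lam_bounds(1)[OF g(2), of i] l by linarith
  define \<gamma> where "\<gamma> = (b / l - b) / Asum i"
  have den: "Asum i * \<gamma> + b = b / l" using A by (simp add: \<gamma>_def)
  have p: "0 < Asum i * \<gamma>1 + b" "0 < Asum i * \<gamma>2 + b"
    using A b g by (auto intro: add_nonneg_pos)
  have "b / l \<le> Asum i * \<gamma>2 + b" "Asum i * \<gamma>1 + b \<le> b / l"
    using l p l0 by (simp_all add: lam_of_def b_def[symmetric] field_simps)
  then have "Asum i * \<gamma> \<le> Asum i * \<gamma>2" "Asum i * \<gamma>1 \<le> Asum i * \<gamma>" using den by auto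
  then have "\<gamma> \<le> \<gamma>2" "\<gamma>1 \<le> \<gamma>" using A by auto
  moreover have "l = Lam i \<gamma>"
    unfolding lam_of_def b_def[symmetric] den using b l0 by simp
  ultimately show ?thesis using that by blast
qed

text \<open>With \<open>b\<close> the scaled step, the claim is
  \<open>b * b * Lt \<le> Asum i * \<gamma> + b\<close>. Steps growing linearly make
  \<open>b * b\<close> and \<open>Asum i\<close> both quadratic in \<open>i\<close>, and the summand
  \<open>b\<close> pays for the shift from \<open>i\<close> to \<open>i + 1\<close>.\<close>

lemma step_lam_le:
  assumes "\<gamma>p \<le> \<gamma>"
  shows "Astep (Suc i) / \<gamma>n * Lt * Lam i \<gamma> \<le> 1"
proof -
  define b where "b = Astep (Suc i) / \<gamma>n"
  have b: "0 < b" using step_pos gn by (simp add: b_def)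
  have bL: "b * Lt = (real i + 1) * \<gamma>n * \<gamma>p / 2"
    using gn Lt by (simp add: b_def step_coeff_def power2_eq_square)
  have den: "0 < Asum i * \<gamma> + b"
    using b sum_coeff_nonneg[of i] assms gp by (intro add_nonneg_pos) auto
  have prod: "\<gamma>n * \<gamma>p \<le> 1" using gn gp by (simp add: mult_le_one)
  have "(b * Lt) * (b * Lt) = (real i + 1) * (\<gamma>n * \<gamma>p) / 4 * ((real i + 1) * (\<gamma>n * \<gamma>p))"
    unfolding bL by (simp add: algebra_simps)
  also have "\<dots> \<le> (real i + 1) * (\<gamma>n * \<gamma>p) / 4 * (real i * (\<gamma>n * \<gamma>p) + 2)"
    using prod gn gp by (intro mult_left_mono) (auto simp: algebra_simps)
  also have "\<dots> = Lt * (Asum i * \<gamma>p) + b * Lt"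
    unfolding sum_coeff_closed bL using Lt by (simp add: field_simps power2_eq_square)
  also have "\<dots> \<le> Lt * (Asum i * \<gamma>) + b * Lt"
    using Lt sum_coeff_nonneg assms by (intro add_right_mono mult_left_mono) auto
  finally have "Lt * (b * b * Lt) \<le> Lt * (Asum i * \<gamma> + b)"
    by (simp add: algebra_simps)
  then have "b * b * Lt \<le> Asum i * \<gamma> + b"
    using Lt by simp
  then show ?thesis
    unfolding lam_of_def b_def[symmetric] using den by (simp add: field_simps)
qed

lemma tilt_below:
  assumes "w \<in> X" "x \<in> X" "f w \<le> f x"
  shows "f x + 1 / \<gamma>n * (gf x \<bullet> (w - x)) \<le> f w"
proof -
  obtain \<rho> where r: "\<gamma>p \<le> \<rho>" "\<rho> \<le> 1 / \<gamma>n" "f x + \<rho> * (gf x \<bullet> (w - x)) \<le> f w"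
    using tilt[OF assms(2,1)] by blast
  have "\<rho> * (gf x \<bullet> (w - x)) \<le> 0" "0 < \<rho>" using r assms(3) gp by auto
  then have "gf x \<bullet> (w - x) \<le> 0" by (simp add: mult_le_0_iff)
  then have "1 / \<gamma>n * (gf x \<bullet> (w - x)) \<le> \<rho> * (gf x \<bullet> (w - x))"
    using r(2) by (rule mult_right_mono_neg[rotated])
  then show ?thesis using r(3) by linarith
qed

text \<open>The formula for \<lambda> makes \<open>x' - x\<close>, weighted by
  \<open>Asum i * \<gamma>\<close>, equal to \<open>y - x'\<close>, weighted by the scaled step. So
  the gradient terms of the acceptance test at \<open>x\<close>, of \<open>tilt_below\<close> at
  \<open>w\<close> and of \<open>potential_step\<close> fit together.\<close>

lemma energy_step:
  fixes x z w :: 'a and \<gamma> e :: real and i :: nat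
  assumes x: "x \<in> X" and w: "w \<in> X" "\<And>v. v \<in> X \<Longrightarrow> f w \<le> f v" and g: "\<gamma>p \<le> \<gamma>"
  defines "l \<equiv> Lam i \<gamma>"
  defines "x' \<equiv> Next i x z l"
  assumes acc: "Asum i * (f x' - f x) \<le> Asum i * (\<gamma> * (gf x' \<bullet> (x' - x))) + e"
  shows "Asum (Suc i) * (f x' - f w) + potential w (z - (Astep (Suc i) / \<gamma>n) *\<^sub>R gf x')
    \<le> Asum i * (f x - f w) + potential w z + e"
proof -
  define b where "b = Astep (Suc i) / \<gamma>n"
  define y where "y = proj X (zeta_pt X gf \<gamma>n \<gamma>p Lt i x z l)"
  have g0: "0 \<le> \<gamma>" using g gp by simp
  have l: "0 < l" "l \<le> 1" unfolding l_def by (rule lam_bounds[OF g0])+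
  have x': "x' \<in> X" unfolding x'_def using x l by (intro next_mem) auto
  have b0: "0 < b" using step_pos gn by (simp add: b_def)
  have den: "0 < Asum i * \<gamma> + b"
    using b0 sum_coeff_nonneg[of i] g0 by (intro add_nonneg_pos) auto
  have nx: "x' = (1 - l) *\<^sub>R x + l *\<^sub>R y" by (simp add: x'_def next_x_def y_def)
  have lb: "l * (Asum i * \<gamma>) = b * (1 - l)"
    unfolding l_def lam_of_def b_def[symmetric] using den by (simp add: field_simps)
  have "l *\<^sub>R ((Asum i * \<gamma>) *\<^sub>R (x' - x)) = l *\<^sub>R (b *\<^sub>R (y - x'))"
  proof -
    have "l *\<^sub>R ((Asum i * \<gamma>) *\<^sub>R (x' - x)) = (b * (1 - l)) *\<^sub>R (x' - x)"
      unfolding scaleR_scaleR lb ..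
    also have "\<dots> = (b * (1 - l)) *\<^sub>R (l *\<^sub>R (y - x))"
      by (simp add: nx algebra_simps)
    also have "\<dots> = (l * b) *\<^sub>R ((1 - l) *\<^sub>R (y - x))"
      by (simp add: mult_ac)
    also have "\<dots> = (l * b) *\<^sub>R (y - x')"
      by (simp add: nx algebra_simps)
    finally show ?thesis by (simp only: scaleR_scaleR)
  qed
  then have coupling: "(Asum i * \<gamma>) *\<^sub>R (x' - x) = b *\<^sub>R (y - x')"
    using l(1) by (simp only: scaleR_cancel_left) simp
  have couple: "Asum i * (\<gamma> * (gf x' \<bullet> (x' - x))) = b * (gf x' \<bullet> (y - x'))"
    using arg_cong[OF coupling, of "\<lambda>v. gf x' \<bullet> v"] by (simp add: mult_ac)
  have "Astep (Suc i) * (f x' - f w) \<le> Astep (Suc i) * (- (1 / \<gamma>n * (gf x' \<bullet> (w - x'))))"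
    using tilt_below[OF w(1) x' w(2)[OF x']] step_pos[of i] by (intro mult_left_mono) auto
  also have "\<dots> = b * (gf x' \<bullet> (x' - w))"
    by (simp add: b_def inner_diff_right algebra_simps)
  also have "\<dots> = b * (gf x' \<bullet> (y - w)) - Asum i * (\<gamma> * (gf x' \<bullet> (x' - x)))"
    unfolding couple by (simp add: inner_diff_right algebra_simps)
  also have "b * (gf x' \<bullet> (y - w)) \<le> potential w z - potential w (z - b *\<^sub>R gf x')"
    using potential_step[OF x w(1), of l i z] l step_lam_le[OF g, of i]
    unfolding b_def l_def[symmetric] x'_def[symmetric] y_def[symmetric] by simp
  finally show ?thesis
    using acc unfolding sum_coeff_Suc b_def[symmetric] by (simp add: algebra_simps)
qed

end

locale accelerated = tilted_problem +
  fixes \<eta> :: real and T :: nat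
  assumes eta: "0 < \<eta>"
begin

abbreviation "Acc \<equiv> acceptable X f gf \<gamma>n \<gamma>p Lt \<eta> T"
abbreviation "Bis \<equiv> bisection X f gf \<gamma>n \<gamma>p Lt \<eta> T"
abbreviation "Choose \<equiv> choose_lam X f gf \<gamma>n \<gamma>p Lt \<eta> T"
abbreviation "Iter \<equiv> iterate X f gf \<gamma>n \<gamma>p Lt \<eta> T"

lemma bisection_acceptable: "Bis i x z a b l k \<Longrightarrow> Acc i x z l"
  by (induction rule: bisection.induct)

lemma choose_lam_cases:
  assumes "Choose i x z l k"
  shows "i = 0 \<and> l = 1 \<or> 0 < i \<and> Acc i x z l"
  using assms by cases (auto dest: bisection_acceptable)

lemma acceptable_lam: "Acc i x z l \<Longrightarrow> 0 < l \<and> l \<le> 1"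
  using gp lam_bounds unfolding acceptable_def by (meson less_imp_le order_trans)

lemma choose_lam_range: "Choose i x z l k \<Longrightarrow> 0 < l \<and> l \<le> 1"
  using choose_lam_cases acceptable_lam by fastforce

lemma iterate_mem: "Iter i x z q \<Longrightarrow> x \<in> X"
proof (induction rule: iterate.induct)
  case start
  show ?case by (rule X(3))
next
  case (step i x z q l k)
  then show ?case using choose_lam_range[of i x z l k] by (intro next_mem) auto
qed

text \<open>The tolerance has \<open>Asum i\<close> in its denominator, so after multiplication by
  \<open>Asum i\<close> every accepted step adds the same error.\<close>

lemma iterate_energy:
  assumes "Iter i x z q" and w: "w \<in> X" "\<And>v. v \<in> X \<Longrightarrow> f w \<le> f v"
  shows "i \<le> T \<Longrightarrow> Asum i * (f x - f w) + potential w z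
    \<le> (norm w)\<^sup>2 / 2 + real (i - 1) * (Asum T * \<eta> / (2 * (real T - 1)))"
  using assms(1)
proof (induction rule: iterate.induct)
  case start
  then show ?case by (simp add: sum_coeff_0 potential_0)
next
  case (step i x z q l k)
  have x: "x \<in> X" by (rule iterate_mem[OF step.hyps(1)])
  \<comment> \<open>The first step adds no error: \<open>Asum 0 = 0\<close>, and \<lambda> = 1 is
    \<open>Lam 0 \<gamma>\<close> for any \<gamma>. Hence the count \<open>i - 1\<close>, truncated
    at 0.\<close>
  define e where "e = (if i = 0 then 0 else Asum T * \<eta> / (2 * (real T - 1)))"
  define x' where "x' = Next i x z l"
  have "\<exists>\<gamma>\<ge>\<gamma>p. l = Lam i \<gamma> \<and>
    Asum i * (f x' - f x) \<le> Asum i * (\<gamma> * (gf x' \<bullet> (x' - x))) + e"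
  proof (cases "i = 0")
    case True
    then have "l = Lam i \<gamma>p"
      using choose_lam_cases[OF step.hyps(2)] step_pos[of 0] gn by (simp add: lam_of_def sum_coeff_0)
    then show ?thesis using True by (intro exI[of _ \<gamma>p]) (simp add: e_def sum_coeff_0)
  next
    case False
    then obtain \<gamma> where g: "\<gamma>p \<le> \<gamma>" "l = Lam i \<gamma>"
      "f x' - f x \<le> \<gamma> * (gf x' \<bullet> (x' - x)) + Asum T * \<eta> / (2 * (real T - 1) * Asum i)"
      using choose_lam_cases[OF step.hyps(2)] by (auto simp: acceptable_def slope_def x'_def)
    have A: "0 < Asum i" using False by (simp add: sum_coeff_pos)
    have "Asum i * (f x' - f x) \<le> Asum i * (\<gamma> * (gf x' \<bullet> (x' - x)) + Asum T * \<eta> / (2 * (real T - 1) * Asum i))"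
      using g(3) A by (intro mult_left_mono) auto
    also have "\<dots> = Asum i * (\<gamma> * (gf x' \<bullet> (x' - x))) + e"
      using A False by (simp add: e_def distrib_left)
    finally show ?thesis using g by blast
  qed
  then obtain \<gamma> where g: "\<gamma>p \<le> \<gamma>" "l = Lam i \<gamma>"
    "Asum i * (f x' - f x) \<le> Asum i * (\<gamma> * (gf x' \<bullet> (x' - x))) + e" by blast
  have "Asum (Suc i) * (f x' - f w) + potential w (z - (Astep (Suc i) / \<gamma>n) *\<^sub>R gf x')
    \<le> Asum i * (f x - f w) + potential w z + e"
    unfolding x'_def g(2) using g(3) unfolding x'_def g(2) by (intro energy_step x w g(1))
  also have "\<dots> \<le> (norm w)\<^sup>2 / 2 + real (i - 1) * (Asum T * \<eta> / (2 * (real T - 1))) + e"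
    using step.IH step.prems by simp
  also have "\<dots> = (norm w)\<^sup>2 / 2 + real (Suc i - 1) * (Asum T * \<eta> / (2 * (real T - 1)))"
    by (cases i) (simp_all add: e_def algebra_simps add_divide_distrib)
  finally show ?case by (simp add: x'_def)
qed

text \<open>The initial potential and the accumulated tolerances contribute at most half of
  \<open>Asum T * \<eta>\<close> each; \<open>num_iterations\<close> is calibrated for the former.
  For \<open>w = 0\<close> no iteration is run, and the starting point is the minimizer. For
  \<open>T = 1\<close> the tolerance is a division by zero, hence 0.\<close>

lemma iterate_accuracy:
  assumes "Iter T x z q" and w: "w \<in> X" "\<And>v. v \<in> X \<Longrightarrow> f w \<le> f v"
    and T: "T = num_iterations \<gamma>n \<gamma>p Lt \<eta> w"
  shows "f x - f w \<le> \<eta>"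
proof (cases "w = 0")
  case True
  then have "T = 0" using T by (simp add: num_iterations_def)
  then have "x = 0" using assms(1) by (auto elim: iterate.cases)
  then show ?thesis using True eta by simp
next
  case False
  define D where "D = \<gamma>n\<^sup>2 * \<gamma>p * \<eta>"
  have D: "0 < D" using gn gp eta by (simp add: D_def)
  have pos: "0 < 4 * Lt * (norm w)\<^sup>2 / D" using False Lt D by simp
  have sq: "sqrt (4 * Lt * (norm w)\<^sup>2 / D) \<le> real T"
    unfolding T num_iterations_def D_def by linarith
  then have T0: "0 < T" using pos real_sqrt_gt_zero[OF pos] by (cases T) auto
  have "4 * Lt * (norm w)\<^sup>2 / D \<le> (real T)\<^sup>2"
    using sq pos by (metis order_less_imp_le real_sqrt_le_iff real_sqrt_ge_zero real_sqrt_pow2 power_mono)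
  then have "(norm w)\<^sup>2 \<le> (real T)\<^sup>2 * D / (4 * Lt)"
    using D Lt by (simp add: field_simps)
  also have "\<dots> \<le> real T * (real T + 1) * D / (4 * Lt)"
    using D Lt by (intro divide_right_mono mult_right_mono) (auto simp: power2_eq_square algebra_simps)
  also have "\<dots> = Asum T * \<eta>"
    unfolding sum_coeff_closed D_def by simp
  finally have AT: "(norm w)\<^sup>2 \<le> Asum T * \<eta>" .
  have A: "0 < Asum T" by (rule sum_coeff_pos[OF T0])
  have "Asum T * (f x - f w) \<le> (norm w)\<^sup>2 / 2 + real (T - 1) * (Asum T * \<eta> / (2 * (real T - 1)))"
    using iterate_energy[OF assms(1) w] potential_nonneg[OF w(1), of z] by simp
  also have "real (T - 1) * (Asum T * \<eta> / (2 * (real T - 1))) \<le> Asum T * \<eta> / 2"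
  proof (cases "T = 1")
    case False
    then have "real T - 1 \<noteq> 0" "real (T - 1) = real T - 1" using T0 by (auto simp: of_nat_diff)
    moreover have "t * (Q / (2 * t)) = Q / 2" if "t \<noteq> 0" for t Q :: real
      using that by simp
    ultimately show ?thesis by (metis order_refl)
  qed (use A eta in simp)
  finally have "Asum T * (f x - f w) \<le> Asum T * \<eta>" using AT by simp
  then show ?thesis using A by simp
qed

section \<open>Termination of the line search\<close>

lemma tolerance_ge:
  assumes "0 < i" "i < T"
  shows "\<eta> / (2 * real T) \<le> Asum T * \<eta> / (2 * (real T - 1) * Asum i)"
proof -
  have A: "0 < Asum i" "Asum i \<le> Asum T" using assms sum_coeff_pos sum_coeff_mono by auto
  have T: "0 < real T - 1" using assms by auto
  have "\<eta> / (2 * real T) \<le> \<eta> / (2 * (real T - 1))"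
    using T eta by (intro divide_left_mono) auto
  also have "\<dots> \<le> Asum T / Asum i * (\<eta> / (2 * (real T - 1)))"
    using mult_right_mono[of 1 "Asum T / Asum i" "\<eta> / (2 * (real T - 1))"] A T eta by simp
  finally show ?thesis by (simp add: mult_ac)
qed

lemma tolerance_pos:
  assumes "0 < i" "i < T"
  shows "0 < Asum T * \<eta> / (2 * (real T - 1) * Asum i)"
proof -
  have "0 < \<eta> / (2 * real T)" using assms eta by simp
  then show ?thesis using tolerance_ge[OF assms] by linarith
qed

lemma line_search_tilt:
  assumes "x \<in> X" "0 \<le> l" "l \<le> 1"
  shows "\<exists>\<rho>\<ge>\<gamma>p. \<rho> \<le> 1 / \<gamma>n \<and> f (Next i x z l) - f x \<le> \<rho> * Slope i x z l"
  using tilt[OF next_mem[OF assms, of i z] assms(1)]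
  unfolding slope_def inner_diff_right by (fastforce simp: algebra_simps)

text \<open>\<open>tilt\<close> provides some factor \<rho>, whereas the test uses the \<gamma>
  belonging to \<open>l\<close>. The mismatch costs at most \<open>1 / \<gamma>n\<close> times the
  slope, which is below the tolerance of every iteration.\<close>

lemma acceptable_small_slope:
  assumes i: "0 < i" "i < T" and x: "x \<in> X" and l: "Lam i (1 / \<gamma>n) \<le> l" "l \<le> Lam i \<gamma>p"
    and s: "\<bar>Slope i x z l\<bar> \<le> \<gamma>n * \<eta> / (2 * real T)"
  shows "Acc i x z l"
proof -
  obtain \<gamma> where g: "\<gamma>p \<le> \<gamma>" "\<gamma> \<le> 1 / \<gamma>n" "l = Lam i \<gamma>"
    using lam_surj[OF i(1) _ _ l] gp gn by auto
  have g0: "0 \<le> \<gamma>" using g gp by simp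
  obtain \<rho> where r: "\<gamma>p \<le> \<rho>" "\<rho> \<le> 1 / \<gamma>n" "f (Next i x z l) - f x \<le> \<rho> * Slope i x z l"
    using line_search_tilt[OF x, of l i z] lam_bounds[OF g0, of i] g(3) by auto
  have "\<rho> * Slope i x z l = \<gamma> * Slope i x z l + (\<rho> - \<gamma>) * Slope i x z l"
    by (simp add: algebra_simps)
  also have "(\<rho> - \<gamma>) * Slope i x z l \<le> \<bar>\<rho> - \<gamma>\<bar> * \<bar>Slope i x z l\<bar>"
    by (metis abs_ge_self abs_mult)
  also have "\<dots> \<le> 1 / \<gamma>n * (\<gamma>n * \<eta> / (2 * real T))"
    using r g gp s gn by (intro mult_mono) (auto simp: abs_le_iff)
  also have "\<dots> = \<eta> / (2 * real T)" using gn by simp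
  also have "\<dots> \<le> Asum T * \<eta> / (2 * (real T - 1) * Asum i)" by (rule tolerance_ge[OF i])
  finally show ?thesis using r(3) g unfolding acceptable_def by fastforce
qed

text \<open>For a nonnegative slope, \<open>1 / \<gamma>n\<close> is at least as favourable as the
  unknown factor of \<open>tilt\<close>, so the test would pass. With the mirror image at
  \<open>\<gamma>p\<close>, two rejected endpoints bracket a sign change.\<close>

lemma slope_neg_left:
  assumes i: "0 < i" "i < T" and x: "x \<in> X" and n: "\<not> Acc i x z (Lam i (1 / \<gamma>n))"
  shows "Slope i x z (Lam i (1 / \<gamma>n)) < 0"
proof (rule ccontr)
  assume "\<not> ?thesis"
  then have s: "0 \<le> Slope i x z (Lam i (1 / \<gamma>n))" by simp
  obtain \<rho> where r: "\<rho> \<le> 1 / \<gamma>n"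
    "f (Next i x z (Lam i (1 / \<gamma>n))) - f x \<le> \<rho> * Slope i x z (Lam i (1 / \<gamma>n))"
    using line_search_tilt[OF x, of "Lam i (1 / \<gamma>n)" i z] lam_bounds[of "1 / \<gamma>n" i] gn by auto
  note r(2)
  also have "\<rho> * Slope i x z (Lam i (1 / \<gamma>n)) \<le> 1 / \<gamma>n * Slope i x z (Lam i (1 / \<gamma>n))"
    using r(1) s by (rule mult_right_mono)
  finally have "f (Next i x z (Lam i (1 / \<gamma>n))) - f x \<le> 1 / \<gamma>n * Slope i x z (Lam i (1 / \<gamma>n))
      + Asum T * \<eta> / (2 * (real T - 1) * Asum i)"
    using tolerance_pos[OF i] by linarith
  moreover note gp_le_gn
  ultimately show False using n unfolding acceptable_def by blast
qed

lemma slope_pos_right: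
  assumes i: "0 < i" "i < T" and x: "x \<in> X" and n: "\<not> Acc i x z (Lam i \<gamma>p)"
  shows "0 < Slope i x z (Lam i \<gamma>p)"
proof (rule ccontr)
  assume "\<not> ?thesis"
  then have s: "Slope i x z (Lam i \<gamma>p) \<le> 0" by simp
  obtain \<rho> where r: "\<gamma>p \<le> \<rho>"
    "f (Next i x z (Lam i \<gamma>p)) - f x \<le> \<rho> * Slope i x z (Lam i \<gamma>p)"
    using line_search_tilt[OF x, of "Lam i \<gamma>p" i z] lam_bounds[of \<gamma>p i] gp by auto
  note r(2)
  also have "\<rho> * Slope i x z (Lam i \<gamma>p) \<le> \<gamma>p * Slope i x z (Lam i \<gamma>p)"
    using r(1) s by (rule mult_right_mono_neg)
  finally have "f (Next i x z (Lam i \<gamma>p)) - f x \<le> \<gamma>p * Slope i x z (Lam i \<gamma>p)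
      + Asum T * \<eta> / (2 * (real T - 1) * Asum i)"
    using tolerance_pos[OF i] by linarith
  moreover note gp_le_gn
  ultimately show False using n unfolding acceptable_def by blast
qed

end

locale accelerated_bounded = accelerated +
  fixes d G :: real
  assumes diam: "\<And>u v. u \<in> X \<Longrightarrow> v \<in> X \<Longrightarrow> norm (u - v) \<le> d"
    and grad_bound: "\<And>u. u \<in> X \<Longrightarrow> norm (gf u) \<le> G"
begin

lemma d_nonneg: "0 \<le> d"
  using diam[OF X(3) X(3)] by simp

lemma G_nonneg: "0 \<le> G"
  using grad_bound[OF X(3)] norm_ge_zero order_trans by blast

text \<open>A change of \<open>l\<close> acts directly, which costs \<open>d\<close>, and through
  the gradient at \<open>chi_pt\<close>, which costs \<open>real T * d\<close>: the scaled step
  times \<open>Lt\<close> is at most \<open>T\<close>, and projections are nonexpansive.\<close>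

lemma next_lipschitz:
  assumes x: "x \<in> X" and i: "i < T" and l: "0 \<le> l" "l \<le> 1" and l': "0 \<le> l'" "l' \<le> 1"
  shows "norm (Next i x z l - Next i x z l') \<le> (1 + real T) * d * \<bar>l - l'\<bar>"
proof -
  define b where "b = Astep (Suc i) / \<gamma>n"
  have b0: "0 < b" using step_pos gn by (simp add: b_def)
  have bL: "b * Lt = (real i + 1) * (\<gamma>n * \<gamma>p) / 2"
    using gn Lt by (simp add: b_def step_coeff_def power2_eq_square)
  also have "\<dots> \<le> real T * 1"
    using i gn gp mult_le_one[of \<gamma>n \<gamma>p] mult_mono[of "real i + 1" "real T" "\<gamma>n * \<gamma>p" 1] by auto
  finally have bT: "b * Lt \<le> real T" by simp
  define Y where "Y l = proj X (zeta_pt X gf \<gamma>n \<gamma>p Lt i x z l)" for l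
  have chi: "chi_pt X x z l - chi_pt X x z l' = (l - l') *\<^sub>R (proj X z - x)"
    by (simp add: chi_pt_def algebra_simps)
  have "norm (Y l - Y l') \<le> norm (zeta_pt X gf \<gamma>n \<gamma>p Lt i x z l - zeta_pt X gf \<gamma>n \<gamma>p Lt i x z l')"
    unfolding Y_def by (rule proj_nonexpansive[OF X(1,2) X_nonempty])
  also have "\<dots> = norm (b *\<^sub>R (gf (chi_pt X x z l) - gf (chi_pt X x z l')))"
    unfolding zeta_pt_def b_def[symmetric] by (simp add: scaleR_diff_right norm_minus_commute)
  also have "\<dots> = b * norm (gf (chi_pt X x z l) - gf (chi_pt X x z l'))"
    using b0 by simp
  also have "\<dots> \<le> b * (Lt * norm (chi_pt X x z l - chi_pt X x z l'))"
    using b0 by (intro mult_left_mono gf_diff chi_mem x l l') auto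
  also have "\<dots> = (b * Lt) * (\<bar>l - l'\<bar> * norm (proj X z - x))"
    unfolding chi by simp
  also have "\<dots> \<le> real T * (\<bar>l - l'\<bar> * d)"
    using bT b0 Lt diam[OF proj_mem x] by (intro mult_mono) auto
  finally have YY: "norm (Y l - Y l') \<le> real T * (\<bar>l - l'\<bar> * d)" .
  have "Next i x z l - Next i x z l' = (l - l') *\<^sub>R (Y l - x) + l' *\<^sub>R (Y l - Y l')"
    by (simp add: next_x_def Y_def algebra_simps)
  then have "norm (Next i x z l - Next i x z l') \<le> \<bar>l - l'\<bar> * norm (Y l - x) + l' * norm (Y l - Y l')"
    using norm_triangle_ineq[of "(l - l') *\<^sub>R (Y l - x)" "l' *\<^sub>R (Y l - Y l')"] l' by simp
  also have "\<dots> \<le> \<bar>l - l'\<bar> * d + 1 * (real T * (\<bar>l - l'\<bar> * d))"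
    using YY l' diam[OF proj_mem x] d_nonneg unfolding Y_def by (intro add_mono mult_mono) auto
  finally show ?thesis by (simp add: algebra_simps)
qed

lemma slope_lipschitz:
  assumes x: "x \<in> X" and i: "i < T" and l: "0 \<le> l" "l \<le> 1" and l': "0 \<le> l'" "l' \<le> 1"
  shows "\<bar>Slope i x z l - Slope i x z l'\<bar> \<le> (1 + real T) * d * (Lt * d + G) * \<bar>l - l'\<bar>"
proof -
  define u where "u = Next i x z l"
  define v where "v = Next i x z l'"
  have uv: "u \<in> X" "v \<in> X" unfolding u_def v_def by (intro next_mem x l l')+
  have "Slope i x z l - Slope i x z l' = (gf u - gf v) \<bullet> (u - x) + gf v \<bullet> (u - v)"
    unfolding slope_def u_def[symmetric] v_def[symmetric] by (simp add: inner_diff_left inner_diff_right)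
  then have "\<bar>Slope i x z l - Slope i x z l'\<bar> \<le> norm (gf u - gf v) * norm (u - x) + norm (gf v) * norm (u - v)"
    using Cauchy_Schwarz_ineq2[of "gf u - gf v" "u - x"] Cauchy_Schwarz_ineq2[of "gf v" "u - v"]
    by linarith
  also have "\<dots> \<le> (Lt * norm (u - v)) * d + G * norm (u - v)"
    using gf_diff[OF uv] diam[OF uv(1) x] grad_bound[OF uv(2)] Lt G_nonneg
    by (intro add_mono mult_mono) auto
  also have "\<dots> = (Lt * d + G) * norm (u - v)" by (simp add: algebra_simps)
  also have "\<dots> \<le> (Lt * d + G) * ((1 + real T) * d * \<bar>l - l'\<bar>)"
    unfolding u_def v_def using Lt d_nonneg G_nonneg
    by (intro mult_left_mono next_lipschitz x i l l') auto
  finally show ?thesis by (simp add: mult_ac)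
qed

text \<open>After \<open>N\<close> halvings the slope at the midpoint is within \<sigma> of a
  negative and of a positive number, hence small, and the midpoint is accepted. Strictly opposite
  signs at the endpoints leave only one branch applicable, which bounds every run.\<close>

lemma bisection_terminates:
  fixes x z :: 'a and a b :: real and i N :: nat
  assumes i: "0 < i" "i < T" and x: "x \<in> X"
  defines "\<Lambda> \<equiv> (1 + real T) * d * (Lt * d + G)" and "\<sigma> \<equiv> \<gamma>n * \<eta> / (2 * real T)"
  assumes "Lam i (1 / \<gamma>n) \<le> a" "a \<le> b" "b \<le> Lam i \<gamma>p"
    and "Slope i x z a < 0" "0 < Slope i x z b" "\<Lambda> * (b - a) \<le> 2 ^ Suc N * \<sigma>"
  shows "(\<exists>l k. Bis i x z a b l k) \<and> (\<forall>l k. Bis i x z a b l k \<longrightarrow> k \<le> Suc N)"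
  using assms(6-)
proof (induction N arbitrary: a b)
  case (0 a b)
  define m where "m = (a + b) / 2"
  have m: "a \<le> m" "m \<le> b" using 0 by (auto simp: m_def)
  have rng: "0 \<le> a" "b \<le> 1" 
    using 0 lam_bounds[of "1 / \<gamma>n" i] lam_bounds[of \<gamma>p i] gn gp by auto
  have "\<bar>Slope i x z m - Slope i x z a\<bar> \<le> \<Lambda> * \<bar>m - a\<bar>" "\<bar>Slope i x z m - Slope i x z b\<bar> \<le> \<Lambda> * \<bar>m - b\<bar>"
    unfolding \<Lambda>_def using m rng by (intro slope_lipschitz x i; simp)+
  moreover have "\<Lambda> * \<bar>m - a\<bar> \<le> \<sigma>" "\<Lambda> * \<bar>m - b\<bar> \<le> \<sigma>"
    using 0 by (auto simp: m_def field_simps)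
  ultimately have "\<bar>Slope i x z m\<bar> \<le> \<sigma>" using 0 by linarith
  then have acc: "Acc i x z m"
    unfolding \<sigma>_def using m 0 by (intro acceptable_small_slope i x) auto
  have "Bis i x z a b m 1" using bisection.stop[of X f gf \<gamma>n \<gamma>p Lt \<eta> T i x z a b] acc
    by (simp add: m_def)
  moreover have "k \<le> Suc 0" if "Bis i x z a b l k" for l k
    using that acc by cases (auto simp: m_def)
  ultimately show ?case by blast
next
  case (Suc N a b)
  define m where "m = (a + b) / 2"
  have m: "a \<le> m" "m \<le> b" using Suc by (auto simp: m_def)
  have half: "\<Lambda> * (m - a) \<le> 2 ^ Suc N * \<sigma>" "\<Lambda> * (b - m) \<le> 2 ^ Suc N * \<sigma>"
    using Suc.prems(6) by (auto simp: m_def field_simps)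
  have sig: "0 < \<sigma>" unfolding \<sigma>_def using gn eta i by simp
  show ?case
  proof (cases "Acc i x z m")
    case True
    have "Bis i x z a b m 1" using bisection.stop[of X f gf \<gamma>n \<gamma>p Lt \<eta> T i x z a b] True
      by (simp add: m_def)
    moreover have "k \<le> Suc 0" if "Bis i x z a b l k" for l k
      using that True by cases (auto simp: m_def)
    ultimately show ?thesis by (meson le_trans Suc_le_mono zero_le)
  next
    case nacc: False
    have nz: "Slope i x z m \<noteq> 0"
    proof
      assume "Slope i x z m = 0"
      then have "\<bar>Slope i x z m\<bar> \<le> \<gamma>n * \<eta> / (2 * real T)" using sig by (simp add: \<sigma>_def)
      moreover have "Lam i (1 / \<gamma>n) \<le> m" "m \<le> Lam i \<gamma>p" using m Suc.prems(1,3) by linarith+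
      ultimately have "Acc i x z m" by (intro acceptable_small_slope i x)
      then show False using nacc by blast
    qed
    show ?thesis
    proof (cases "Slope i x z m > 0")
      case True
      have ih: "(\<exists>l k. Bis i x z a m l k) \<and> (\<forall>l k. Bis i x z a m l k \<longrightarrow> k \<le> Suc N)"
        by (rule Suc.IH) (use Suc.prems m half True in auto)
      then obtain l k where "Bis i x z a m l k" by blast
      moreover have "Slope i x z a * Slope i x z m < 0"
        using True Suc.prems(4) by (simp add: mult_neg_pos)
      ultimately have "Bis i x z a b l (Suc k)"
        using bisection.left[of X f gf \<gamma>n \<gamma>p Lt \<eta> T i x z a b l k] nacc by (simp add: m_def)
      moreover have "k \<le> Suc (Suc N)" if "Bis i x z a b l k" for l k
        using that
      proof cases
        case stop
        then show ?thesis by simp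
      next
        case (left k')
        then show ?thesis using ih by (auto simp: m_def)
      next
        case (right k')
        then have "Slope i x z m * Slope i x z b < 0" by (simp add: m_def)
        then show ?thesis using True Suc.prems(5) by (simp add: mult_less_0_iff)
      qed
      ultimately show ?thesis by blast
    next
      case False
      then have neg: "Slope i x z m < 0" using nz by simp
      have ih: "(\<exists>l k. Bis i x z m b l k) \<and> (\<forall>l k. Bis i x z m b l k \<longrightarrow> k \<le> Suc N)"
        by (rule Suc.IH) (use Suc.prems m half neg in auto)
      then obtain l k where "Bis i x z m b l k" by blast
      moreover have "Slope i x z m * Slope i x z b < 0"
        using neg Suc.prems(5) by (simp add: mult_neg_pos)
      ultimately have "Bis i x z a b l (Suc k)"
        using bisection.right[of X f gf \<gamma>n \<gamma>p Lt \<eta> T i x z a b l k] nacc by (simp add: m_def)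
      moreover have "k \<le> Suc (Suc N)" if "Bis i x z a b l k" for l k
        using that
      proof cases
        case stop
        then show ?thesis by simp
      next
        case (left k')
        then have "Slope i x z a * Slope i x z m < 0" by (simp add: m_def)
        then show ?thesis using neg Suc.prems(4) by (simp add: mult_less_0_iff)
      next
        case (right k')
        then show ?thesis using ih by (auto simp: m_def)
      qed
      ultimately show ?thesis by blast
    qed
  qed
qed

text \<open>\<open>N + 3\<close> counts the two endpoint values and at most \<open>Suc N\<close>
  midpoints.\<close>

lemma choose_lam_terminates:
  assumes i: "i < T" and x: "x \<in> X"
    and N: "(1 + real T) * d * (Lt * d + G) \<le> 2 ^ Suc N * (\<gamma>n * \<eta> / (2 * real T))"
  shows "(\<exists>l k. Choose i x z l k) \<and> (\<forall>l k. Choose i x z l k \<longrightarrow> k \<le> N + 3)"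
proof (cases "i = 0")
  case True
  then show ?thesis by (auto intro: choose_lam.first elim: choose_lam.cases)
next
  case False
  then have i0: "0 < i" by simp
  show ?thesis
  proof (cases "Acc i x z (Lam i (1 / \<gamma>n)) \<or> Acc i x z (Lam i \<gamma>p)")
    case True
    then have "\<exists>l k. Choose i x z l k"
      using i0 choose_lam.try_n[of i X f gf \<gamma>n \<gamma>p Lt \<eta> T x z]
        choose_lam.try_p[of i X f gf \<gamma>n \<gamma>p Lt \<eta> T x z] by blast
    moreover have "k \<le> N + 3" if "Choose i x z l k" for l k
      using that True by cases auto
    ultimately show ?thesis by blast
  next
    case False
    then have n: "\<not> Acc i x z (Lam i (1 / \<gamma>n))" "\<not> Acc i x z (Lam i \<gamma>p)" by auto
    have le: "Lam i (1 / \<gamma>n) \<le> Lam i \<gamma>p"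
      using gp gn by (intro lam_antimono) (auto intro: order_trans[of _ 1])
    have "Lam i \<gamma>p - Lam i (1 / \<gamma>n) \<le> 1"
      using lam_bounds[of "1 / \<gamma>n" i] lam_bounds[of \<gamma>p i] gn gp by auto
    then have "(1 + real T) * d * (Lt * d + G) * (Lam i \<gamma>p - Lam i (1 / \<gamma>n)) \<le> (1 + real T) * d * (Lt * d + G)"
      using d_nonneg G_nonneg Lt by (intro mult_left_le) auto
    then have "(1 + real T) * d * (Lt * d + G) * (Lam i \<gamma>p - Lam i (1 / \<gamma>n)) \<le> 2 ^ Suc N * (\<gamma>n * \<eta> / (2 * real T))"
      using N by linarith
    then have b: "(\<exists>l k. Bis i x z (Lam i (1 / \<gamma>n)) (Lam i \<gamma>p) l k) \<and>
      (\<forall>l k. Bis i x z (Lam i (1 / \<gamma>n)) (Lam i \<gamma>p) l k \<longrightarrow> k \<le> Suc N)"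
      by (intro bisection_terminates i0 i x le slope_neg_left slope_pos_right n order_refl)
    then have "\<exists>l k. Choose i x z l k"
      using choose_lam.bisect[OF i0 n] by blast
    moreover have "k \<le> N + 3" if "Choose i x z l k" for l k
      using that
    proof cases
      case (bisect k')
      then show ?thesis using b by auto
    qed (use n i0 in auto)
    ultimately show ?thesis by blast
  qed
qed

lemma iterate_exists:
  assumes N: "(1 + real T) * d * (Lt * d + G) \<le> 2 ^ Suc N * (\<gamma>n * \<eta> / (2 * real T))"
  shows "i \<le> T \<Longrightarrow> \<exists>x z q. Iter i x z q"
proof (induction i)
  case 0
  then show ?case by (blast intro: iterate.start)
next
  case (Suc i)
  then obtain x z q where it: "Iter i x z q" by auto
  then obtain l k where "Choose i x z l k"
    using choose_lam_terminates[OF _ iterate_mem[OF it] N] Suc.prems by (meson Suc_le_lessD)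
  then show ?case using iterate.step[OF it] by blast
qed

lemma iterate_queries:
  assumes N: "(1 + real T) * d * (Lt * d + G) \<le> 2 ^ Suc N * (\<gamma>n * \<eta> / (2 * real T))"
    and "Iter i x z q"
  shows "i \<le> T \<Longrightarrow> q \<le> 2 * i * (N + 3)"
  using assms(2)
proof (induction rule: iterate.induct)
  case start
  then show ?case by simp
next
  case (step i x z q l k)
  then have "k \<le> N + 3"
    using choose_lam_terminates[OF _ iterate_mem[OF step.hyps(1)] N] by (meson Suc_le_lessD)
  then show ?case using step by (simp add: algebra_simps)
qed

end

section \<open>The subproblem of one stage\<close>

context objective
begin

definition Gbd :: real where "Gbd = 2 * k ^ 3 * CG * L"

lemma CG_L_nonneg: "0 \<le> CG * L"
  using gradient_bound[OF x0_D] tangent_form_nonneg[OF x0 Gr_tangent[OF x0_D]]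
  by (simp add: rnorm_def) (meson order_trans real_sqrt_ge_zero)

text \<open>The outer 6 is the constant of \<open>gradient_lipschitz\<close>. Inside,
  \<open>6 * k ^ 13 * CG\<close> is \<open>3 * k ^ 10\<close> from \<open>ratio_near_1\<close> times
  \<open>Gbd / L\<close>, and \<open>2 * k ^ 16\<close> is half the square of the distance factor
  \<open>2 * k ^ 8\<close>.\<close>

definition CL :: real where "CL = 6 * (6 * k ^ 13 * CG + 2 * k ^ 16)"

lemma CL_L_nonneg: "0 \<le> CL * L"
proof -
  have "CL * L = 36 * k ^ 13 * (CG * L) + 12 * k ^ 16 * L" by (simp add: CL_def algebra_simps)
  then show ?thesis using kappa_ge CG_L_nonneg L_pos by simp
qed

end

text \<open>One stage: the chart is centered at the current point \<open>c\<close>, whereas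
  \<open>F\<close> is controlled on the fixed ball around \<open>x0\<close>.\<close>

locale region = objective K V B x0 R M F L \<mu> \<sigma> + ch: chart K V B c E r
  for K :: real and V B :: "'a::real_inner set" and x0 R M F L \<mu> \<sigma> c E r +
  assumes c_D: "c \<in> rcball K V x0 R" and rR: "r \<le> R"
begin

definition X :: "'a set" where "X = h_image K V c E (rcball K V c r \<inter> D)"

abbreviation "pt \<equiv> h_inv K c E"
abbreviation "f \<equiv> F \<circ> pt"
abbreviation "gf \<equiv> grad_in V f"

lemma kappa_le: "ch.\<kappa> \<le> k"
proof (cases "K = 1")
  case True
  have "0 < cos R" "cos R \<le> cos r"
    using True R ch.r rR by (auto intro!: cos_gt_zero_pi cos_monotone_0_pi_le)
  then show ?thesis using True by (simp add: kappa_def frac_le)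
next
  case False
  then show ?thesis using rR ch.r by (simp add: kappa_def cosh_real_nonneg_le_iff)
qed

section \<open>The coordinate domain of a stage\<close>

lemma X_eq: "X = {u \<in> ch.U. pt u \<in> D}"
proof -
  have ball: "rcball K V c r = {y \<in> S. K * cosK K r \<le> frm c y}"
    by (rule rcball_eq[OF ch.c]) (use ch.r pi_gt_zero in auto)
  have "u \<in> V \<and> 0 < 1 + K * (u \<bullet> u) \<and> pt u \<in> rcball K V c r \<longleftrightarrow> u \<in> ch.U" for u
  proof
    assume u: "u \<in> V \<and> 0 < 1 + K * (u \<bullet> u) \<and> pt u \<in> rcball K V c r"
    then show "u \<in> ch.U"
      using ch.chart_radius_iff[of u] ch.form_c_pt[of u] by (simp add: ball ch.U_def)
  next
    assume u: "u \<in> ch.U"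
    then show "u \<in> V \<and> 0 < 1 + K * (u \<bullet> u) \<and> pt u \<in> rcball K V c r"
      using ch.chart_radius_iff[OF ch.U_dom_pos[OF u]] ch.form_c_pt[of u] ch.U_dom_pos[OF u] ch.pt_S[OF u]
      by (simp add: ball ch.U_def)
  qed
  then show ?thesis unfolding X_def h_image_def by auto
qed

lemma X_U: "u \<in> X \<Longrightarrow> u \<in> ch.U"
  and X_D: "u \<in> X \<Longrightarrow> pt u \<in> D"
  by (simp_all add: X_eq)

lemma X_facts:
  assumes "u \<in> X"
  shows "u \<in> V" "u \<in> ch.dom" "pt u \<in> M"
  using X_U[OF assms] X_D[OF assms] ch.U_V ch.U_dom_pos DM by (auto simp: ch.dom_def)

text \<open>The inequality that defines the ball around \<open>x0\<close>, at \<open>pt u\<close>,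
  with the positive denominator \<open>s u\<close> cleared. This makes it concave.\<close>

definition phi :: "'a \<Rightarrow> real" where "phi u = frm x0 (c + E u) - cosK K R * (K * ch.s u)"

lemma phi_D:
  assumes "u \<in> V" "0 < 1 + K * (u \<bullet> u)"
  shows "pt u \<in> D \<longleftrightarrow> 0 \<le> phi u"
proof -
  have s: "0 < ch.s u" using assms by (simp add: ch.s_def)
  have "pt u \<in> D \<longleftrightarrow> K * cosK K R \<le> frm x0 (c + E u) / ch.s u"
    using ch.pt_in_S[OF assms] by (simp add: D_eq ch.pt_eq)
  then show ?thesis using s by (simp add: phi_def pos_le_divide_eq mult_ac)
qed

lemma phi_concave:
  assumes u: "u \<in> V" "0 < 1 + K * (u \<bullet> u)" and v: "v \<in> V" "0 < 1 + K * (v \<bullet> v)"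
    and t: "0 \<le> t" "t \<le> 1"
  shows "(1 - t) * phi u + t * phi v \<le> phi ((1 - t) *\<^sub>R u + t *\<^sub>R v)"
proof -
  define w where "w = (1 - t) *\<^sub>R u + t *\<^sub>R v"
  have "E w = (1 - t) *\<^sub>R E u + t *\<^sub>R E v"
    using ch.E_linear by (simp add: w_def linear_add linear_scale)
  then have a: "frm x0 (c + E w) = (1 - t) * frm x0 (c + E u) + t * frm x0 (c + E v)"
    by (simp only: form_linear) (simp add: algebra_simps)
  have "cosK K R * (K * ch.s w) \<le> cosK K R * (K * ((1 - t) * ch.s u + t * ch.s v))"
    unfolding w_def using mult_left_mono[OF ch.s_convex[OF u v t], of "cosK K R"] ch0.cosK_pos by simp
  then show ?thesis unfolding phi_def w_def[symmetric] a by (simp add: algebra_simps)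
qed

lemma X_phi: "X = {u \<in> ch.U. 0 \<le> phi u}"
  using phi_D ch.U_V ch.U_dom_pos by (auto simp: X_eq)

lemma X_convex: "convex X"
  unfolding convex_alt
proof (intro ballI allI impI)
  fix u v t assume uv: "u \<in> X" "v \<in> X" and t: "0 \<le> t \<and> t \<le> (1::real)"
  have U: "u \<in> ch.U" "v \<in> ch.U" using uv X_U by auto
  have "norm ((1 - t) *\<^sub>R u + t *\<^sub>R v) \<le> (1 - t) * norm u + t * norm v"
    using norm_triangle_ineq[of "(1 - t) *\<^sub>R u" "t *\<^sub>R v"] t by simp
  also have "\<dots> \<le> (1 - t) * ch.\<tau> + t * ch.\<tau>"
    using U t by (intro add_mono mult_left_mono) (auto simp: ch.U_def)
  finally have "(1 - t) *\<^sub>R u + t *\<^sub>R v \<in> ch.U"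
    using U V by (auto simp: ch.U_def algebra_simps intro!: subspace_add subspace_diff subspace_scale)
  moreover have "0 \<le> phi ((1 - t) *\<^sub>R u + t *\<^sub>R v)"
  proof -
    have "0 \<le> (1 - t) * phi u + t * phi v" using uv t by (simp add: X_phi)
    also have "\<dots> \<le> phi ((1 - t) *\<^sub>R u + t *\<^sub>R v)"
      using U t by (intro phi_concave ch.U_V ch.U_dom_pos) auto
    finally show ?thesis .
  qed
  ultimately show "(1 - t) *\<^sub>R u + t *\<^sub>R v \<in> X" by (simp add: X_phi)
qed

lemma zero_V: "0 \<in> V" "0 < 1 + K * ((0::'a) \<bullet> 0)"
  using V by (auto simp: subspace_0)

lemma pt_0: "pt 0 = c"
  using ch.E_linear by (simp add: h_inv_def linear_0)

lemma zero_X: "0 \<in> X"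
  using c_D pt_0 zero_V ch.tau_nonneg by (simp add: X_eq ch.U_def)

text \<open>A version of \<open>phi\<close> that is continuous off \<open>V\<close> too, where the
  frame is arbitrary.\<close>

definition phic :: "'a \<Rightarrow> real" where "phic u = frm x0 (c + ch.Ec u) - cosK K R * (K * ch.s u)"

lemma phic_eq: "u \<in> V \<Longrightarrow> phic u = phi u"
  by (simp add: phic_def phi_def ch.Ec_eq)

lemma continuous_on_phic: "continuous_on A phic"
  unfolding phic_def
  by (intro continuous_intros ch.continuous_on_s linear_continuous_on ch.bounded_linear_Ec)

lemma X_compact: "compact X"
proof -
  have "X = (span B \<inter> cball 0 ch.\<tau>) \<inter> {u. 0 \<le> phic u}"
    unfolding X_phi B(2) by (auto simp: ch.U_def phic_eq)
  moreover have "closed {u. 0 \<le> phic u}"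
    by (intro closed_Collect_le continuous_on_phic continuous_intros)
  ultimately show ?thesis
    using compact_Int_closed[OF compact_orthonormal_span_cball[OF B(1)]] by simp
qed

text \<open>The center \<open>c\<close> may lie on the boundary of the ball around
  \<open>x0\<close>, so 0 need not be interior. At the coordinates \<open>u0\<close> of
  \<open>x0\<close> the function \<open>phi\<close> is strictly positive; by concavity it is
  positive at a small multiple of \<open>u0\<close>, which also fits into the ball around
  \<open>c\<close>.\<close>

lemma X_interior:
  obtains w \<delta> where "w \<in> V" "0 < \<delta>" "\<And>z. z \<in> V \<Longrightarrow> norm (z - w) < \<delta> \<Longrightarrow> z \<in> X"
proof -
  \<comment> \<open>The radius is enlarged to \<open>R\<close> because \<open>x0\<close> need not
    lie within \<open>r\<close> of \<open>c\<close>.\<close>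
  interpret cR: chart K V B c E R
    using ch.c ch.frame R by unfold_locales
  have "K * cosK K R \<le> frm c x0" using c_D form_commute[of K c x0] by (simp add: D_eq)
  then obtain u0 where u0: "u0 \<in> cR.U" "pt u0 = x0" by (rule cR.pt_surj[OF x0])
  have dom0: "u0 \<in> V" "0 < 1 + K * (u0 \<bullet> u0)" using u0 cR.U_V cR.U_dom_pos by auto
  have su: "0 < ch.s u0" using dom0 by (simp add: ch.s_def)
  have "c + E u0 = ch.s u0 *\<^sub>R x0" using u0(2) su by (auto simp: ch.pt_eq)
  then have "phi u0 = ch.s u0 * (K * (1 - cosK K R))"
    using x0 by (simp add: phi_def S_form algebra_simps)
  moreover have "0 < K * (1 - cosK K R)"
  proof (cases "K = 1")
    case True
    have "cos R < cos 0" using True R pi_gt_zero by (intro cos_monotone_0_pi) auto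
    then show ?thesis using True by (simp add: cosK_def)
  next
    case False
    have "cosh 0 < cosh R" using R by (subst cosh_real_nonneg_less_iff) auto
    then show ?thesis using False K by (auto simp: cosK_def)
  qed
  ultimately have p0: "0 < phi u0" using su by simp
  define t where "t = min 1 (ch.\<tau> / (2 * (norm u0 + 1)))"
  have t: "0 < t" "t \<le> 1" using ch.tau_pos by (auto simp: t_def add_nonneg_pos)
  define w where "w = t *\<^sub>R u0"
  have wV: "w \<in> V" using V dom0 by (simp add: w_def subspace_scale)
  have "norm w = t * norm u0" using t by (simp add: w_def)
  also have "\<dots> \<le> ch.\<tau> / (2 * (norm u0 + 1)) * norm u0"
    by (intro mult_right_mono) (simp_all add: t_def)
  also have "\<dots> = ch.\<tau> * (norm u0 / (2 * (norm u0 + 1)))" by simp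
  also have "\<dots> < ch.\<tau> * 1"
    using ch.tau_pos norm_ge_zero[of u0] by (intro mult_strict_left_mono) (auto simp: divide_less_eq add_nonneg_pos)
  also have "\<dots> = ch.\<tau>" by simp
  finally have wn: "norm w < ch.\<tau>" .
  have "0 < t * phi u0" using t p0 by simp
  also have "\<dots> \<le> (1 - t) * phi 0 + t * phi u0" using zero_X t by (simp add: X_phi)
  also have "\<dots> \<le> phi w"
    using phi_concave[OF zero_V dom0, of t] t by (simp add: w_def)
  finally have "0 < phic w" using phic_eq[OF wV] by simp
  moreover have "open {z. 0 < phic z}"
    by (intro open_Collect_less continuous_on_phic continuous_intros)
  ultimately obtain d where d': "0 < d" "ball w d \<subseteq> {z. 0 < phic z}"
    unfolding open_contains_ball by blast
  then have d: "0 < d" "\<And>z. dist w z < d \<Longrightarrow> 0 < phic z" by auto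
  show ?thesis
  proof (rule that[OF wV])
    show "0 < min d (ch.\<tau> - norm w)" using d wn by simp
    fix z assume z: "z \<in> V" "norm (z - w) < min d (ch.\<tau> - norm w)"
    have "norm z \<le> ch.\<tau>" using z(2) norm_triangle_ineq2[of z w] by simp
    moreover have "0 < phi z" using d(2)[of z] z phic_eq by (simp add: dist_norm norm_minus_commute)
    ultimately show "z \<in> X" using z(1) by (simp add: X_phi ch.U_def)
  qed
qed

section \<open>Gradient bound and expansion in coordinates\<close>

lemma gf_V: "u \<in> X \<Longrightarrow> gf u \<in> V"
  by (intro ch.grad_in_V[OF M F] X_facts)

lemma gf_inner: "u \<in> X \<Longrightarrow> w \<in> V \<Longrightarrow> gf u \<bullet> w = frm (Gr (pt u)) (E w) / ch.s u"
  by (rule ch.grad_in_inner[OF M F X_facts])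

lemma gf_exp_inv:
  assumes "u \<in> X" "v \<in> X"
  shows "frm (Gr (pt u)) (exp_inv K V (pt u) (pt v)) = ch.ratio u v * (gf u \<bullet> (v - u))"
proof -
  have "v - u \<in> V" using V X_facts(1)[OF assms(1)] X_facts(1)[OF assms(2)] by (simp add: subspace_diff)
  then show ?thesis
    using ch.form_tangent_exp_inv[OF X_U X_U Gr_tangent[OF X_D], OF assms(1,2,1)] gf_inner[OF assms(1)] by simp
qed

text \<open>The gradient is paired with itself. Its image under \<open>E\<close> is tangent at
  \<open>c\<close> rather than at \<open>pt u\<close>, so Cauchy-Schwarz is applied to the
  tangential part \<open>P\<close> at \<open>pt u\<close>.\<close>

lemma gf_bound:
  assumes u: "u \<in> X"
  shows "norm (gf u) \<le> Gbd"
proof -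
  define x where "x = pt u"
  define g where "g = Gr x"
  define w where "w = gf u"
  have w: "w \<in> V" unfolding w_def by (rule gf_V[OF u])
  note uU = X_U[OF u] and uV = X_facts(1)[OF u]
  note s = ch.s_bounds[OF uU]
  have xS: "x \<in> S" unfolding x_def by (rule ch.pt_S[OF uU])
  have g: "g \<in> Tan x" unfolding g_def x_def by (rule Gr_tangent[OF X_D[OF u]])
  have kk: "0 < ch.\<kappa>" "1 \<le> ch.\<kappa>" using ch.kappa_ge_1 by auto
  define P where "P = E w - (K * frm x (E w)) *\<^sub>R x"
  have P: "P \<in> Tan x"
    unfolding P_def using ch.E_tangent[OF w] by (intro normal_part[OF xS]) (simp add: tangent_def)
  have xE: "frm x (E w) = (u \<bullet> w) / ch.s u"
    unfolding x_def ch.pt_eq using ch.form_c_E[OF w] ch.E_form[OF uV w] by simp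
  have "frm P P = w \<bullet> w - K * ((u \<bullet> w) / ch.s u)\<^sup>2"
    unfolding P_def normal_part_form[OF xS] unfolding xE ch.E_form[OF w w] ..
  also have "\<dots> \<le> (norm w)\<^sup>2 + ((u \<bullet> w) / ch.s u)\<^sup>2"
    using K by (auto simp: dot_square_norm)
  also have "((u \<bullet> w) / ch.s u)\<^sup>2 \<le> (ch.\<kappa>\<^sup>2 * norm w)\<^sup>2"
  proof -
    have "\<bar>u \<bullet> w\<bar> \<le> norm u * norm w" by (rule Cauchy_Schwarz_ineq2)
    also have "\<dots> \<le> ch.\<kappa> * norm w"
      using uU ch.tau_le_kappa by (intro mult_right_mono) (auto simp: ch.U_def)
    finally have "\<bar>u \<bullet> w\<bar> / ch.s u \<le> (ch.\<kappa> * norm w) / (1 / ch.\<kappa>)"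
      using s kk by (intro frac_le) auto
    then have "\<bar>(u \<bullet> w) / ch.s u\<bar> \<le> ch.\<kappa>\<^sup>2 * norm w"
      using s by (simp add: abs_divide power2_eq_square mult_ac)
    from power_mono[OF this abs_ge_zero, of 2] show ?thesis by (simp only: power2_abs)
  qed
  also have "(norm w)\<^sup>2 \<le> (ch.\<kappa>\<^sup>2 * norm w)\<^sup>2"
    using mult_right_mono[OF one_le_power[OF kk(2), of 2] norm_ge_zero[of w]] by (intro power_mono) auto
  also have "a\<^sup>2 + a\<^sup>2 \<le> (2 * a)\<^sup>2" for a :: real by simp
  finally have "frm P P \<le> (2 * ch.\<kappa>\<^sup>2 * norm w)\<^sup>2" by (simp only: mult.assoc)
  then have Pn: "rnorm K P \<le> 2 * ch.\<kappa>\<^sup>2 * norm w"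
    unfolding rnorm_def using kk by (intro real_le_lsqrt) auto
  have gx: "frm g x = 0" using g form_commute[of K g x] by (simp add: tangent_def)
  have "(norm w)\<^sup>2 = gf u \<bullet> w" by (simp add: w_def dot_square_norm)
  also have "\<dots> = frm g P / ch.s u" unfolding gf_inner[OF u w] P_def using gx by (simp add: g_def x_def)
  also have "\<dots> \<le> \<bar>frm g P\<bar> / ch.s u" using s by (intro divide_right_mono) auto
  also have "\<dots> \<le> (rnorm K g * rnorm K P) / (1 / ch.\<kappa>)"
    using tangent_cauchy_schwarz[OF xS g P] s kk
    by (intro frac_le) (auto intro: order_trans[OF abs_ge_zero])
  also have "\<dots> \<le> ((CG * L) * (2 * ch.\<kappa>\<^sup>2 * norm w)) / (1 / ch.\<kappa>)"
  proof (intro divide_right_mono mult_mono Pn)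
    show "rnorm K g \<le> CG * L" unfolding g_def x_def by (rule gradient_bound[OF X_D[OF u]])
    show "0 \<le> rnorm K P" unfolding rnorm_def using tangent_form_nonneg[OF xS P] by simp
  qed (use kk CG_L_nonneg in auto)
  also have "\<dots> = (2 * ch.\<kappa> ^ 3 * (CG * L)) * norm w" by (simp add: power3_eq_cube power2_eq_square)
  finally have "norm w * norm w \<le> (2 * ch.\<kappa> ^ 3 * (CG * L)) * norm w" by (simp add: power2_eq_square)
  moreover have "0 \<le> 2 * ch.\<kappa> ^ 3 * (CG * L)" using CG_L_nonneg kk by simp
  ultimately have "norm w \<le> 2 * ch.\<kappa> ^ 3 * (CG * L)"
    by (cases "norm w = 0") (auto simp: mult_le_cancel_right)
  also have "\<dots> \<le> 2 * k ^ 3 * (CG * L)"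
    using kappa_le kk CG_L_nonneg by (intro mult_right_mono mult_left_mono power_mono) auto
  finally show ?thesis by (simp add: w_def Gbd_def mult.assoc)
qed

text \<open>There are two errors: the deviation of \<open>ratio\<close> from 1 times a gradient
  bounded by \<open>Gbd\<close>, and the quadratic term of smoothness. The bound in
  \<open>small\<close> keeps the distance below 1, as \<open>ratio_near_1\<close> requires.\<close>

lemma taylor:
  assumes u: "u \<in> X" "v \<in> X" and small: "norm (v - u) \<le> 1 / (2 * k ^ 8)"
  shows "\<bar>f v - f u - gf u \<bullet> (v - u)\<bar> \<le> (CL / 6 * L) * (norm (v - u))\<^sup>2"
proof (cases "u = v")
  case False
  define n where "n = norm (v - u)"
  define \<theta> where "\<theta> = rdist K (pt u) (pt v)"
  note U = X_U[OF u(1)] X_U[OF u(2)]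
  have kk: "1 \<le> ch.\<kappa>" "1 \<le> k" using ch.kappa_ge_1 kappa_ge by auto
  have \<theta>0: "0 \<le> \<theta>" unfolding \<theta>_def using ch.rdist_pt_bounds(1)[OF U False] by simp
  have "\<theta> \<le> 2 * ch.\<kappa> ^ 8 * n" unfolding \<theta>_def n_def by (rule ch.rdist_pt_le[OF U])
  also have "\<dots> \<le> 2 * k ^ 8 * n"
    using kappa_le kk by (intro mult_right_mono mult_left_mono power_mono) (auto simp: n_def)
  finally have \<theta>: "\<theta> \<le> 2 * k ^ 8 * n" .
  also have "\<dots> \<le> 1" using small kk by (simp add: n_def field_simps)
  finally have \<theta>1: "\<theta> \<le> 1" .
  have "\<bar>ch.ratio u v - 1\<bar> \<le> 3 * ch.\<kappa> ^ 10 * n"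
    unfolding n_def using ch.ratio_near_1[OF U False] \<theta>1 by (simp add: \<theta>_def)
  also have "\<dots> \<le> 3 * k ^ 10 * n"
    using kappa_le kk by (intro mult_right_mono mult_left_mono power_mono) (auto simp: n_def)
  finally have \<rho>: "\<bar>ch.ratio u v - 1\<bar> \<le> 3 * k ^ 10 * n" .
  have "\<bar>gf u \<bullet> (v - u)\<bar> \<le> norm (gf u) * n" unfolding n_def by (rule Cauchy_Schwarz_ineq2)
  also have "\<dots> \<le> Gbd * n" using gf_bound[OF u(1)] by (intro mult_right_mono) (auto simp: n_def)
  finally have g: "\<bar>gf u \<bullet> (v - u)\<bar> \<le> Gbd * n" .
  have e1: "\<bar>(ch.ratio u v - 1) * (gf u \<bullet> (v - u))\<bar> \<le> (3 * k ^ 10 * n) * (Gbd * n)"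
    unfolding abs_mult using \<rho> g by (intro mult_mono) (auto simp: n_def intro: order_trans[OF abs_ge_zero])
  have "\<theta>\<^sup>2 \<le> (2 * k ^ 8 * n)\<^sup>2" using \<theta> \<theta>0 by (intro power_mono)
  then have "L / 2 * \<theta>\<^sup>2 \<le> L / 2 * (2 * k ^ 8 * n)\<^sup>2" using L_pos by (intro mult_left_mono) auto
  also have "\<dots> = 2 * k ^ 16 * L * n\<^sup>2" by (simp add: power_mult_distrib flip: power_mult)
  finally have e2: "L / 2 * \<theta>\<^sup>2 \<le> 2 * k ^ 16 * L * n\<^sup>2" .
  have "f u + ch.ratio u v * (gf u \<bullet> (v - u)) \<le> f v"
    "f v \<le> f u + ch.ratio u v * (gf u \<bullet> (v - u)) + L / 2 * \<theta>\<^sup>2"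
    using F_convex[OF X_D X_D, OF u] F_upper[OF X_D X_D, OF u] unfolding gf_exp_inv[OF u] \<theta>_def by auto
  moreover have "ch.ratio u v * (gf u \<bullet> (v - u)) = gf u \<bullet> (v - u) + (ch.ratio u v - 1) * (gf u \<bullet> (v - u))"
    by (simp add: algebra_simps)
  moreover have "0 \<le> L / 2 * \<theta>\<^sup>2" using L_pos by simp
  ultimately have "\<bar>f v - f u - gf u \<bullet> (v - u)\<bar> \<le> (3 * k ^ 10 * n) * (Gbd * n) + 2 * k ^ 16 * L * n\<^sup>2"
    using e1 e2 unfolding abs_le_iff by linarith
  also have "\<dots> = (CL / 6 * L) * n\<^sup>2"
    by (simp add: Gbd_def CL_def power_def algebra_simps)
  finally show ?thesis by (simp add: n_def)
qed simp

lemma gf_lipschitz: "(CL * L)-lipschitz_on X gf"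
proof -
  obtain w \<delta> where w: "w \<in> V" "0 < \<delta>" "\<And>z. z \<in> V \<Longrightarrow> norm (z - w) < \<delta> \<Longrightarrow> z \<in> X"
    using X_interior by blast
  have "(6 * (CL / 6 * L))-lipschitz_on X gf"
  proof (rule gradient_lipschitz[OF V _ X_convex _ _ w(2,1)])
    show "X \<subseteq> V" using X_facts(1) by blast
    show "gf u \<in> V" if "u \<in> X" for u by (rule gf_V[OF that])
    show "continuous_on X gf"
      by (rule ch.continuous_on_grad_in[OF M F G]) (use X_facts in auto)
    show "z \<in> X" if "z \<in> V" "norm (z - w) < \<delta>" for z by (rule w(3)[OF that])
    show "0 < 1 / (2 * k ^ 8)" using kappa_ge by simp
    show "0 \<le> CL / 6 * L" using CL_L_nonneg by simp
  qed (rule taylor)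
  then show ?thesis by simp
qed

lemma tilted:
  assumes "CL * L \<le> Lt" "0 < Lt"
  shows "tilted_problem X f gf (gamma_n K r) (gamma_p K r) Lt"
proof
  show "Lt-lipschitz_on X gf" using gf_lipschitz assms(1) by (rule lipschitz_on_le)
  fix u v assume uv: "u \<in> X" "v \<in> X"
  have le: "gamma_p K r \<le> 1 / gamma_n K r"
    using ch.gammas by (simp add: field_simps mult_le_one)
  show "\<exists>\<rho>\<ge>gamma_p K r. \<rho> \<le> 1 / gamma_n K r \<and> f u + \<rho> * (gf u \<bullet> (v - u)) \<le> f v"
  proof (cases "u = v")
    case True
    then show ?thesis using le by auto
  next
    case False
    have "f u + ch.ratio u v * (gf u \<bullet> (v - u)) \<le> f v"
      using F_convex[OF X_D X_D, OF uv] unfolding gf_exp_inv[OF uv] by simp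
    then show ?thesis using ch.ratio_bounds[OF X_U X_U, OF uv False] by blast
  qed
qed (rule X_compact X_convex zero_X ch.gammas assms(2))+

lemma X_norm: "u \<in> X \<Longrightarrow> norm u \<le> k * r"
proof -
  assume "u \<in> X"
  then have "norm u \<le> ch.\<tau>" using X_U by (simp add: ch.U_def)
  also have "\<dots> \<le> ch.\<kappa> * r" by (rule ch.tau_le)
  also have "\<dots> \<le> k * r" using kappa_le ch.r by (intro mult_right_mono) auto
  finally show ?thesis .
qed

lemma f_continuous: "continuous_on X f"
  by (rule ch.continuous_on_chart[OF M F]) (use X_facts in auto)

lemma arg_min_exists: "\<exists>w. is_arg_min f (\<lambda>u. u \<in> X) w"
proof -
  obtain w where "w \<in> X" "\<forall>v\<in>X. f w \<le> f v"
    using continuous_attains_inf[OF X_compact _ f_continuous] zero_X by blast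
  then show ?thesis by (auto simp: is_arg_min_def not_less)
qed

end

section \<open>Iteration count and outcome of one stage\<close>

context region
begin

text \<open>\<open>k ^ 11\<close> is \<open>k ^ 9\<close> from the three reciprocal gammas times
  \<open>k ^ 2\<close> from the norm of \<open>xs\<close>; the 1 is for rounding up.\<close>

lemma num_iterations_le:
  assumes xs: "xs \<in> X" and Lt: "0 < Lt" and eta: "0 < \<eta>"
  shows "real (num_iterations (gamma_n K r) (gamma_p K r) Lt \<eta> xs) \<le> sqrt (4 * Lt * k ^ 11 * r\<^sup>2 / \<eta>) + 1"
proof -
  define D where "D = (gamma_n K r)\<^sup>2 * gamma_p K r"
  have D: "0 < D" using ch.gammas by (simp add: D_def)
  have kk: "0 < k" "0 < ch.\<kappa>" using kappa_ge ch.kappa_ge_1 by auto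
  have k3: "ch.\<kappa> ^ 3 \<le> k ^ 3" using kappa_le kk by (intro power_mono) auto
  have g3: "1 / gamma_n K r \<le> k ^ 3" "1 / gamma_p K r \<le> k ^ 3"
    using ch.inv_gamma_le k3 by linarith+
  have "1 / D = 1 / gamma_n K r * (1 / gamma_n K r) * (1 / gamma_p K r)"
    by (simp add: D_def power2_eq_square)
  also have "\<dots> \<le> k ^ 3 * k ^ 3 * k ^ 3"
    using g3 ch.gammas kk by (intro mult_mono) auto
  finally have D9: "1 / D \<le> k ^ 9" by (simp add: power_def mult_ac)
  have "(norm xs)\<^sup>2 \<le> (k * r)\<^sup>2" using X_norm[OF xs] by (intro power_mono) auto
  then have "(norm xs)\<^sup>2 * (1 / D) \<le> (k * r)\<^sup>2 * k ^ 9"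
    using D9 D by (intro mult_mono) auto
  also have "\<dots> = k ^ 11 * r\<^sup>2" by (simp add: power_mult_distrib power_def mult_ac)
  finally have "(4 * Lt / \<eta>) * ((norm xs)\<^sup>2 * (1 / D)) \<le> (4 * Lt / \<eta>) * (k ^ 11 * r\<^sup>2)"
    using Lt eta by (intro mult_left_mono) auto
  then have "4 * Lt * (norm xs)\<^sup>2 / (D * \<eta>) \<le> 4 * Lt * k ^ 11 * r\<^sup>2 / \<eta>" by (simp add: mult_ac)
  then have "sqrt (4 * Lt * (norm xs)\<^sup>2 / (D * \<eta>)) \<le> sqrt (4 * Lt * k ^ 11 * r\<^sup>2 / \<eta>)" by simp
  moreover have "0 \<le> sqrt (4 * Lt * (norm xs)\<^sup>2 / (D * \<eta>))" using Lt D eta by simp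
  ultimately show ?thesis
    unfolding num_iterations_def D_def by linarith
qed

lemma accelerated_instance:
  assumes "CL * L \<le> Lt" "0 < Lt" "0 < \<eta>"
  shows "accelerated_bounded X f gf (gamma_n K r) (gamma_p K r) Lt \<eta> (2 * k * r) Gbd"
proof -
  interpret tilted_problem X f gf "gamma_n K r" "gamma_p K r" Lt by (rule tilted[OF assms(1,2)])
  show ?thesis
  proof
    show "norm (u - v) \<le> 2 * k * r" if "u \<in> X" "v \<in> X" for u v
      using norm_triangle_ineq4[of u v] X_norm[OF that(1)] X_norm[OF that(2)] by linarith
  qed (use assms(3) gf_bound in auto)
qed

lemma stage_exists:
  assumes Lt: "CL * L \<le> Lt" "0 < Lt" and eta: "0 < \<eta>"
  shows "\<exists>y q. algorithm1 K V M F D Lt c r \<eta> y q"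
proof -
  interpret ab: accelerated_bounded X f gf "gamma_n K r" "gamma_p K r" Lt \<eta> T "2 * k * r" Gbd for T
    by (rule accelerated_instance[OF Lt eta])
  obtain xs where xs: "is_arg_min f (\<lambda>u. u \<in> X) xs" using arg_min_exists by blast
  define T where "T = num_iterations (gamma_n K r) (gamma_p K r) Lt \<eta> xs"
  have "\<exists>x z q. iterate X f gf (gamma_n K r) (gamma_p K r) Lt \<eta> T T x z q"
  proof (cases "T = 0")
    case True
    then show ?thesis by (metis iterate.start)
  next
    case False
    define b where "b = gamma_n K r * \<eta> / (2 * real T)"
    have b: "0 < b" using False eta ch.gammas by (simp add: b_def)
    define Q where "Q = (1 + real T) * (2 * k * r) * (Lt * (2 * k * r) + Gbd)"
    obtain N where N: "Q / b < 2 ^ N" using real_arch_pow[of 2 "Q / b"] by auto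
    have "Q \<le> 2 ^ N * b" using N b by (simp add: pos_divide_less_eq)
    also have "\<dots> \<le> 2 ^ Suc N * b" using b by simp
    finally show ?thesis using ab.iterate_exists[of T N T] by (simp add: Q_def b_def)
  qed
  then obtain x z q where it: "iterate X f gf (gamma_n K r) (gamma_p K r) Lt \<eta> T T x z q" by blast
  have "algorithm1 K V M F D Lt c r \<eta> (pt x) q"
    unfolding algorithm1_def
  proof (intro exI conjI)
    show "frame K V c E" by (rule ch.frame)
    show "X = h_image K V c E (rcball K V c r \<inter> D)" by (rule X_def)
    show "is_arg_min f (\<lambda>u. u \<in> X) xs" by (rule xs)
    show "Lt-lipschitz_on X (grad_in V f)" by (rule ab.lip)
    show "T = num_iterations (gamma_n K r) (gamma_p K r) Lt \<eta> xs" by (rule T_def)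
    show "iterate X f gf (gamma_n K r) (gamma_p K r) Lt \<eta> T T x z q" by (rule it)
  qed auto
  then show ?thesis by blast
qed

text \<open>\<open>Tb\<close> bounds the number of iterations, and \<open>N\<close> the number of bisection steps.\<close>

lemma stage_result:
  assumes Lt: "CL * L \<le> Lt" "0 < Lt" and eta: "0 < \<eta>"
    and xs: "is_arg_min f (\<lambda>u. u \<in> X) xs"
    and T: "T = num_iterations (gamma_n K r) (gamma_p K r) Lt \<eta> xs"
    and it: "iterate X f gf (gamma_n K r) (gamma_p K r) Lt \<eta> T T x z q"
  shows "pt x \<in> D"
    and "w \<in> D \<Longrightarrow> rdist K c w \<le> r \<Longrightarrow> F (pt x) \<le> F w + \<eta>"
    and "sqrt (4 * Lt * k ^ 11 * r\<^sup>2 / \<eta>) + 1 \<le> Tb \<Longrightarrow>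
      (1 + Tb) * (2 * k * r) * (Lt * (2 * k * r) + Gbd) \<le> 2 ^ Suc N * (\<eta> / (2 * k ^ 3 * Tb)) \<Longrightarrow>
      real q \<le> 2 * Tb * (real N + 3)"
proof -
  interpret ab: accelerated_bounded X f gf "gamma_n K r" "gamma_p K r" Lt \<eta> T "2 * k * r" Gbd
    by (rule accelerated_instance[OF Lt eta])
  have xsX: "xs \<in> X" "\<And>v. v \<in> X \<Longrightarrow> f xs \<le> f v" using xs by (auto simp: is_arg_min_def not_less)
  show "pt x \<in> D" by (rule X_D[OF ab.iterate_mem[OF it]])
  show "F (pt x) \<le> F w + \<eta>" if w: "w \<in> D" "rdist K c w \<le> r"
  proof -
    have "K * cosK K r \<le> frm c w"
      using rdist_le_iff[OF ch.c D_S[OF w(1)], of r] w(2) ch.r by auto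
    then obtain u where u: "u \<in> ch.U" "pt u = w" by (rule ch.pt_surj[OF D_S[OF w(1)]])
    then have "f xs \<le> F w" using xsX(2)[of u] w(1) by (simp add: X_eq)
    moreover have "f x - f xs \<le> \<eta>" by (rule ab.iterate_accuracy[OF it xsX T])
    ultimately show ?thesis by simp
  qed
  show "real q \<le> 2 * Tb * (real N + 3)"
    if Tb: "sqrt (4 * Lt * k ^ 11 * r\<^sup>2 / \<eta>) + 1 \<le> Tb"
      and N: "(1 + Tb) * (2 * k * r) * (Lt * (2 * k * r) + Gbd) \<le> 2 ^ Suc N * (\<eta> / (2 * k ^ 3 * Tb))"
  proof -
    have TT: "real T \<le> Tb" using num_iterations_le[OF xsX(1) Lt(2) eta] Tb unfolding T by linarith
    show ?thesis
    proof (cases "T = 0")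
      case True
      then have "q = 0" using it by (auto elim: iterate.cases)
      then show ?thesis using TT True by simp
    next
      case False
      then have T0: "0 < real T" by simp
      have kk: "0 < k" "0 < ch.\<kappa>" using kappa_ge ch.kappa_ge_1 by auto
      have "1 / gamma_n K r \<le> k ^ 3"
        using ch.inv_gamma_le(1) power_mono[OF kappa_le, of 3] kk by linarith
      then have g: "1 / k ^ 3 \<le> gamma_n K r" using ch.gammas kk by (simp add: field_simps)
      have "(1 + real T) * (2 * k * r) * (Lt * (2 * k * r) + Gbd)
          \<le> (1 + Tb) * (2 * k * r) * (Lt * (2 * k * r) + Gbd)"
        using TT kk ch.r Lt CG_L_nonneg by (intro mult_right_mono) (auto simp: Gbd_def mult.assoc)
      also note N
      also have "2 ^ Suc N * (\<eta> / (2 * k ^ 3 * Tb)) \<le> 2 ^ Suc N * (gamma_n K r * \<eta> / (2 * real T))"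
      proof (intro mult_left_mono)
        have "\<eta> / (2 * k ^ 3 * Tb) = (1 / k ^ 3) * \<eta> / (2 * Tb)" by simp
        also have "\<dots> \<le> gamma_n K r * \<eta> / (2 * real T)"
          using g eta T0 TT kk ch.gammas(1) by (intro frac_le mult_right_mono mult_nonneg_nonneg) auto
        finally show "\<eta> / (2 * k ^ 3 * Tb) \<le> gamma_n K r * \<eta> / (2 * real T)" .
      qed auto
      finally have "q \<le> 2 * T * (N + 3)" by (intro ab.iterate_queries[OF _ it]) auto
      then have "real q \<le> real (2 * T * (N + 3))" by (rule of_nat_mono)
      also have "\<dots> = 2 * real T * (real N + 3)" by simp
      also have "\<dots> \<le> 2 * Tb * (real N + 3)" using TT by (intro mult_right_mono) auto
      finally show ?thesis .
    qed
  qed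
qed

end

context objective
begin

lemma region_at:
  assumes "x \<in> D" "frame K V x E" "0 < r" "r \<le> R"
  shows "region K V B x0 R M F L \<mu> \<sigma> x E r"
  by unfold_locales (use assms D_S R in auto)

lemma algorithm1_exists:
  assumes "x \<in> D" "0 < r" "r \<le> R" "CL * L \<le> Lt" "0 < Lt" "0 < \<eta>"
  shows "\<exists>y q. algorithm1 K V M F D Lt x r \<eta> y q"
proof -
  obtain E where "frame K V x E" by (rule frame_exists[OF D_S[OF assms(1)]])
  then interpret region K V B x0 R M F L \<mu> \<sigma> x E r by (intro region_at assms)
  show ?thesis by (rule stage_exists[OF assms(4-6)])
qed

lemma algorithm1_result:
  assumes "x \<in> D" "0 < r" "r \<le> R" "CL * L \<le> Lt" "0 < Lt" "0 < \<eta>"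
    and alg: "algorithm1 K V M F D Lt x r \<eta> y q"
  shows "y \<in> D"
    and "w \<in> D \<Longrightarrow> rdist K x w \<le> r \<Longrightarrow> F y \<le> F w + \<eta>"
    and "sqrt (4 * Lt * k ^ 11 * r\<^sup>2 / \<eta>) + 1 \<le> Tb \<Longrightarrow>
      (1 + Tb) * (2 * k * r) * (Lt * (2 * k * r) + Gbd) \<le> 2 ^ Suc N * (\<eta> / (2 * k ^ 3 * Tb)) \<Longrightarrow>
      real q \<le> 2 * Tb * (real N + 3)"
proof -
  obtain E xs T u z where E: "frame K V x E"
    and xs: "is_arg_min (F \<circ> h_inv K x E) (\<lambda>u. u \<in> h_image K V x E (rcball K V x r \<inter> D)) xs"
    and T: "T = num_iterations (gamma_n K r) (gamma_p K r) Lt \<eta> xs"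
    and it: "iterate (h_image K V x E (rcball K V x r \<inter> D)) (F \<circ> h_inv K x E)
      (grad_in V (F \<circ> h_inv K x E)) (gamma_n K r) (gamma_p K r) Lt \<eta> T T u z q"
    and y: "y = h_inv K x E u"
    using alg unfolding algorithm1_def by blast
  interpret region K V B x0 R M F L \<mu> \<sigma> x E r by (rule region_at[OF assms(1) E assms(2,3)])
  note res = stage_result[OF assms(4-6) xs[folded X_def] T it[folded X_def]]
  show "y \<in> D" unfolding y by (rule res(1))
  show "w \<in> D \<Longrightarrow> rdist K x w \<le> r \<Longrightarrow> F y \<le> F w + \<eta>" unfolding y by (rule res(2))
  show "sqrt (4 * Lt * k ^ 11 * r\<^sup>2 / \<eta>) + 1 \<le> Tb \<Longrightarrow>
      (1 + Tb) * (2 * k * r) * (Lt * (2 * k * r) + Gbd) \<le> 2 ^ Suc N * (\<eta> / (2 * k ^ 3 * Tb)) \<Longrightarrow>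
      real q \<le> 2 * Tb * (real N + 3)" by (rule res(3))
qed

section \<open>Constrained minimizers and restarts\<close>

text \<open>In the chart at \<open>x0\<close> with radius \<open>R\<close> the compact set
  \<open>X\<close> is the image of the whole ball.\<close>

lemma minimizer_exists: "\<exists>xs. is_arg_min F (\<lambda>x. x \<in> D) xs"
proof -
  interpret region K V B x0 R M F L \<mu> \<sigma> x0 E0 R
    by (rule region_at[OF x0_D frame_E0 R(1) order_refl])
  obtain w where w: "is_arg_min f (\<lambda>u. u \<in> X) w" using arg_min_exists by blast
  have "is_arg_min F (\<lambda>x. x \<in> D) (pt w)"
    unfolding is_arg_min_def
  proof (intro conjI notI)
    show "pt w \<in> D" using w X_D by (simp add: is_arg_min_def)
    assume "\<exists>y. y \<in> D \<and> F y < F (pt w)"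
    then obtain y where y: "y \<in> D" "F y < F (pt w)" by blast
    then obtain u where "u \<in> ch0.U" "pt u = y" using D_pt0 by blast
    then have "u \<in> X" "f u < f w" using y by (auto simp: X_eq)
    then show False using w by (auto simp: is_arg_min_def)
  qed
  then show ?thesis by blast
qed

text \<open>A constrained minimizer may be a boundary point with nonzero gradient. The chord to
  \<open>y\<close> in the chart at \<open>x0\<close> stays in \<open>X\<close>, so \<open>f\<close>
  cannot decrease along it to first order, and the positive \<open>ratio\<close> transfers the
  sign.\<close>

lemma minimizer_first_order:
  assumes xs: "is_arg_min F (\<lambda>x. x \<in> D) xs" and y: "y \<in> D"
  shows "0 \<le> frm (Gr xs) (exp_inv K V xs y)"
proof -
  interpret region K V B x0 R M F L \<mu> \<sigma> x0 E0 R
    by (rule region_at[OF x0_D frame_E0 R(1) order_refl])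
  have xsD: "xs \<in> D" "\<And>z. z \<in> D \<Longrightarrow> F xs \<le> F z" using xs by (auto simp: is_arg_min_def not_less)
  obtain u v where uv: "u \<in> ch0.U" "pt u = xs" "v \<in> ch0.U" "pt v = y" using D_pt0 xsD(1) y by metis
  then have X: "u \<in> X" "v \<in> X" using xsD y by (auto simp: X_eq)
  define d where "d = v - u"
  have dV: "d \<in> V" "u \<in> V" using V X_facts(1)[OF X(1)] X_facts(1)[OF X(2)] by (auto simp: d_def subspace_diff)
  have l: "((\<lambda>t. u + t *\<^sub>R d) has_derivative (\<lambda>t. t *\<^sub>R d)) (at (0::real))"
    by (auto intro!: derivative_eq_intros)
  have sub: "(\<lambda>t. u + t *\<^sub>R d) ` UNIV \<subseteq> V" using V dV by (auto intro: subspace_add subspace_scale)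
  have "(f has_derivative (\<lambda>w. gf u \<bullet> w)) (at u within V)"
    by (rule ch0.grad_in_derivative[OF M F X_facts[OF X(1)]])
  from has_derivative_subset[OF this sub]
  have "(f has_derivative (\<lambda>w. gf u \<bullet> w)) (at (u + 0 *\<^sub>R d) within range (\<lambda>t. u + t *\<^sub>R d))" by simp
  from has_derivative_in_compose[OF l this]
  have "((\<lambda>t. f (u + t *\<^sub>R d)) has_derivative (\<lambda>t. gf u \<bullet> (t *\<^sub>R d))) (at 0)" .
  moreover have "(\<lambda>t. gf u \<bullet> (t *\<^sub>R d)) = (*) (gf u \<bullet> d)" by (auto simp: fun_eq_iff)
  ultimately have der: "((\<lambda>t. f (u + t *\<^sub>R d)) has_real_derivative gf u \<bullet> d) (at 0)"
    unfolding has_field_derivative_def by (simp only:)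
  have "0 \<le> gf u \<bullet> d"
  proof (rule ccontr)
    assume "\<not> ?thesis"
    then obtain e where e: "0 < e" "\<And>h. 0 < h \<Longrightarrow> h < e \<Longrightarrow> f (u + (0 + h) *\<^sub>R d) < f (u + 0 *\<^sub>R d)"
      using DERIV_neg_dec_right[OF der] by auto
    define h where "h = min 1 (e / 2)"
    have h: "0 < h" "h < e" "h \<le> 1" using e by (auto simp: h_def)
    have "(1 - h) *\<^sub>R u + h *\<^sub>R v \<in> X" using X_convex X h by (simp add: convex_alt)
    also have "(1 - h) *\<^sub>R u + h *\<^sub>R v = u + h *\<^sub>R d" by (simp add: d_def algebra_simps)
    finally have "F xs \<le> F (pt (u + h *\<^sub>R d))" by (intro xsD X_D)
    then show False using e(2)[OF h(1,2)] uv(2) by simp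
  qed
  moreover have "frm (Gr xs) (exp_inv K V xs y) = ch0.ratio u v * (gf u \<bullet> d)"
    using gf_exp_inv[OF X] uv by (simp add: d_def)
  moreover have "0 \<le> ch0.ratio u v \<or> d = 0"
    using ch0.ratio_pos[OF X_U X_U, OF X] by (cases "u = v") (auto simp: d_def)
  ultimately show ?thesis by auto
qed

lemma minimizer_growth:
  assumes xs: "is_arg_min F (\<lambda>x. x \<in> D) xs" and y: "y \<in> D"
  shows "\<mu> / 2 * (rdist K xs y)\<^sup>2 \<le> F y - F xs"
  using minimizer_first_order[OF assms] F_lower[of xs y] xs y by (simp add: is_arg_min_def)

text \<open>Origin of the accuracy \<open>\<mu> * r\<^sup>2 / 4\<close>: by quadratic growth it
  brings the output within \<open>r / sqrt 2\<close> of the minimizer, the radius of the next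
  stage.\<close>

lemma stage_radius:
  assumes "is_arg_min F (\<lambda>x. x \<in> D) xs" "y \<in> D" "F y \<le> F xs + \<mu> * r\<^sup>2 / 4" "0 < r"
  shows "rdist K y xs \<le> r / sqrt 2"
proof -
  have "\<mu> / 2 * (rdist K xs y)\<^sup>2 \<le> \<mu> / 2 * (r\<^sup>2 / 2)"
    using minimizer_growth[OF assms(1,2)] assms(3) by simp
  then have "(rdist K xs y)\<^sup>2 \<le> (r / sqrt 2)\<^sup>2" using mu by (simp add: power_divide)
  then have "rdist K xs y \<le> r / sqrt 2" by (rule power2_le_imp_le) (use assms(4) in simp)
  then show ?thesis by (simp add: rdist_commute)
qed

lemma radius_pos: "0 < R / sqrt 2 ^ j" and radius_le: "R / sqrt 2 ^ j \<le> R"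
proof -
  have "1 \<le> sqrt 2 ^ j" by (intro one_le_power) simp
  then show "0 < R / sqrt 2 ^ j" "R / sqrt 2 ^ j \<le> R" using R by (auto simp: divide_le_eq)
qed

context
  fixes Lt :: real
  assumes Lt: "CL * L \<le> Lt" "0 < Lt"
begin

lemma stages_D: "stages K V M F \<mu> Lt x0 R j y q \<Longrightarrow> y \<in> D"
proof (induction rule: stages.induct)
  case start
  show ?case by (rule x0_D)
next
  case (stage j c q r y k)
  show ?case
    by (rule algorithm1_result(1)[OF stage.IH _ _ Lt _ stage.hyps(3)])
      (use stage.hyps(2) radius_pos[of j] radius_le[of j] mu in auto)
qed

lemma stages_exist: "\<exists>y q. stages K V M F \<mu> Lt x0 R j y q"
proof (induction j)
  case 0
  show ?case by (blast intro: stages.start)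
next
  case (Suc j)
  then obtain c q where c: "stages K V M F \<mu> Lt x0 R j c q" by blast
  have "\<exists>y q. algorithm1 K V M F D Lt c (R / sqrt 2 ^ j) (\<mu> * (R / sqrt 2 ^ j)\<^sup>2 / 4) y q"
    using mult_pos_pos[OF mu zero_less_power[OF radius_pos[of j], of 2]]
    by (intro algorithm1_exists stages_D[OF c] radius_pos radius_le Lt) linarith
  then show ?case using stages.stage[OF c refl] by blast
qed

text \<open>The distance bound is the invariant: it keeps the minimizer over the whole ball inside
  the ball of the next stage, so every stage competes with the same \<open>xs\<close>.\<close>

lemma stages_result:
  assumes "stages K V M F \<mu> Lt x0 R j y q" and xs: "is_arg_min F (\<lambda>x. x \<in> D) xs"
  shows "rdist K y xs \<le> R / sqrt 2 ^ j"
    and "0 < j \<Longrightarrow> F y \<le> F xs + \<mu> * (R / sqrt 2 ^ (j - 1))\<^sup>2 / 4"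
proof -
  have xsD: "xs \<in> D" using xs by (simp add: is_arg_min_def)
  have "rdist K y xs \<le> R / sqrt 2 ^ j \<and> (0 < j \<longrightarrow> F y \<le> F xs + \<mu> * (R / sqrt 2 ^ (j - 1))\<^sup>2 / 4)"
    using assms(1)
  proof (induction rule: stages.induct)
    case start
    show ?case using D_iff[OF D_S[OF xsD]] xsD by simp
  next
    case (stage j c q r y k)
    have r: "0 < r" "r \<le> R" using stage.hyps(2) radius_pos radius_le by auto
    have eta: "0 < \<mu> * r\<^sup>2 / 4" using mu r by simp
    note res = algorithm1_result[OF stages_D[OF stage.hyps(1)] r Lt eta stage.hyps(3)]
    have Fy: "F y \<le> F xs + \<mu> * r\<^sup>2 / 4" by (rule res(2)[OF xsD]) (use stage.IH stage.hyps(2) in simp)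
    have "rdist K y xs \<le> r / sqrt 2" by (rule stage_radius[OF xs res(1) Fy r(1)])
    then show ?case using Fy stage.hyps(2) by (simp add: mult.commute)
  qed
  then show "rdist K y xs \<le> R / sqrt 2 ^ j"
    "0 < j \<Longrightarrow> F y \<le> F xs + \<mu> * (R / sqrt 2 ^ (j - 1))\<^sup>2 / 4" by auto
qed

text \<open>As the accuracy is proportional to the square of the radius, the iteration bound does
  not depend on the stage. The bisection condition keeps a factor \<open>1 / r\<close>, hence
  \<open>sqrt 2 ^ i\<close>, which is only felt through a logarithm.\<close>

lemma stages_queries:
  assumes Tb: "4 * sqrt (k ^ 11 * Lt / \<mu>) + 1 \<le> Tb"
    and N: "\<And>i. i < J \<Longrightarrow> 16 * k ^ 4 * ((1 + Tb) * Tb) * (2 * k * R * Lt + Gbd) * sqrt 2 ^ i / (\<mu> * R) \<le> 2 ^ Suc N"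
    and "stages K V M F \<mu> Lt x0 R j y q"
  shows "j \<le> J \<Longrightarrow> real q \<le> real j * (2 * Tb * (real N + 3))"
  using assms(3)
proof (induction rule: stages.induct)
  case start
  show ?case by simp
next
  case (stage j c q r y n)
  have r: "0 < r" "r \<le> R" "1 / r = sqrt 2 ^ j / R" using stage.hyps(2) radius_pos radius_le R by auto
  have eta: "0 < \<mu> * r\<^sup>2 / 4" using mu r by simp
  have k: "0 < k" using kappa_ge by simp
  have Gbd0: "0 \<le> Gbd" using CG_L_nonneg k by (simp add: Gbd_def mult.assoc)
  have T0: "0 < Tb"
  proof -
    have "0 \<le> sqrt (k ^ 11 * Lt / \<mu>)" using k Lt mu by simp
    then show ?thesis using Tb by linarith
  qed
  have "4 * Lt * k ^ 11 * r\<^sup>2 / (\<mu> * r\<^sup>2 / 4) = 4\<^sup>2 * (k ^ 11 * Lt / \<mu>)"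
    using r mu by (simp add: field_simps)
  then have 1: "sqrt (4 * Lt * k ^ 11 * r\<^sup>2 / (\<mu> * r\<^sup>2 / 4)) + 1 \<le> Tb"
    using Tb by (simp only: real_sqrt_mult real_sqrt_power) simp
  have 2: "(1 + Tb) * (2 * k * r) * (Lt * (2 * k * r) + Gbd) \<le> 2 ^ Suc N * ((\<mu> * r\<^sup>2 / 4) / (2 * k ^ 3 * Tb))"
  proof -
    define Y where "Y = (\<mu> * r\<^sup>2 / 4) / (2 * k ^ 3 * Tb)"
    have Y: "0 \<le> Y" unfolding Y_def using mu T0 k by simp
    have "(1 + Tb) * (2 * k * r) * (Lt * (2 * k * r) + Gbd) \<le> (1 + Tb) * (2 * k * r) * (Lt * (2 * k * R) + Gbd)"
      using T0 k r Lt by (intro mult_left_mono add_right_mono) auto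
    also have "\<dots> = (16 * k ^ 4 * ((1 + Tb) * Tb) * (2 * k * R * Lt + Gbd) * (1 / r) / \<mu>) * Y"
      unfolding Y_def using r(1) mu T0 k by (simp add: field_simps power_def)
    also have "16 * k ^ 4 * ((1 + Tb) * Tb) * (2 * k * R * Lt + Gbd) * (1 / r) / \<mu> =
        16 * k ^ 4 * ((1 + Tb) * Tb) * (2 * k * R * Lt + Gbd) * sqrt 2 ^ j / (\<mu> * R)"
      unfolding r(3) by simp
    also have "\<dots> * Y \<le> 2 ^ Suc N * Y"
      using N[of j] stage.prems Y by (intro mult_right_mono) auto
    finally show ?thesis by (simp add: Y_def)
  qed
  have "real n \<le> 2 * Tb * (real N + 3)"
    by (rule algorithm1_result(3)[OF stages_D[OF stage.hyps(1)] r(1,2) Lt eta stage.hyps(3) 1 2])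
  moreover have "real q \<le> real j * (2 * Tb * (real N + 3))" using stage.IH stage.prems by simp
  ultimately show ?case by (simp add: algebra_simps)
qed

end

lemma Gbd_le: "Gbd \<le> CL * L"
proof -
  have k: "1 \<le> k" by (rule kappa_ge)
  have "2 * k ^ 3 \<le> 36 * k ^ 13"
    using power_increasing[of 3 13 k] k by (intro mult_mono) auto
  then have "2 * k ^ 3 * (CG * L) \<le> 36 * k ^ 13 * (CG * L)" using CG_L_nonneg by (rule mult_right_mono)
  moreover have "0 \<le> 12 * k ^ 16 * L" using k L_pos by simp
  moreover have "CL * L = 36 * k ^ 13 * (CG * L) + 12 * k ^ 16 * L" by (simp add: CL_def algebra_simps)
  moreover have "Gbd = 2 * k ^ 3 * (CG * L)" by (simp add: Gbd_def mult.assoc)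
  ultimately show ?thesis by linarith
qed

end

section \<open>Complexity\<close>

text \<open>At least one stage is run even if the logarithm of
  \<open>\<mu> * R\<^sup>2 / \<epsilon>\<close> is negative; \<open>2 \<le> W\<close> makes
  \<open>log 2 W\<close> at least 1 and absorbs this stage.\<close>

lemma num_stages_bounds:
  assumes "0 < \<mu>" "0 < R" "0 < \<epsilon>" and W: "2 + \<mu> * R\<^sup>2 / \<epsilon> \<le> W"
  shows "\<mu> * R\<^sup>2 / \<epsilon> \<le> 2 ^ Suc (num_stages \<mu> R \<epsilon>)"
    and "i < num_stages \<mu> R \<epsilon> \<Longrightarrow> sqrt 2 ^ i \<le> W"
    and "real (num_stages \<mu> R \<epsilon>) \<le> 2 / ln 2 * ln W"
proof -
  define Q where "Q = \<mu> * R\<^sup>2 / \<epsilon>"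
  have Q: "0 < Q" using assms by (simp add: Q_def)
  have W2: "2 \<le> W" "Q \<le> W" using W Q by (auto simp: Q_def)
  define J where "J = num_stages \<mu> R \<epsilon>"
  have J: "J = max 1 (nat \<lceil>log 2 Q - 1\<rceil>)" by (simp add: J_def num_stages_def Q_def)
  have "log 2 Q - 1 \<le> real J" unfolding J by linarith
  then have "log 2 Q \<le> real (Suc J)" by simp
  then have "Q \<le> 2 powr real (Suc J)" using Q by (simp add: log_le_iff)
  then show "\<mu> * R\<^sup>2 / \<epsilon> \<le> 2 ^ Suc (num_stages \<mu> R \<epsilon>)"
    by (simp add: powr_realpow J_def Q_def del: of_nat_Suc power_Suc)
  have logW: "1 \<le> log 2 W" "log 2 Q \<le> log 2 W" using W2 Q by (auto simp: le_log_iff)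
  have J1: "real J - 1 \<le> log 2 W - 1 \<or> J = 1" unfolding J using logW by linarith
  show "sqrt 2 ^ i \<le> W" if "i < num_stages \<mu> R \<epsilon>"
  proof -
    have "real i \<le> log 2 W" using that J1 logW by (auto simp: J_def)
    then have "2 ^ i \<le> W" using W2 by (simp add: le_log_iff powr_realpow)
    moreover have "sqrt 2 ^ i \<le> (2::real) ^ i" by (intro power_mono) (auto simp: real_le_lsqrt)
    ultimately show ?thesis by linarith
  qed
  have "real J \<le> 2 * log 2 W" using J1 logW by auto
  then show "real (num_stages \<mu> R \<epsilon>) \<le> 2 / ln 2 * ln W" by (simp add: log_def J_def)
qed

text \<open>The degree 5 stands for two factors \<open>L * (Rg + 1) / \<mu>\<close>, each at most
  quadratic in \<open>W\<close>, and one \<open>sqrt 2 ^ i\<close>. Additive constants are absorbed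
  by \<open>1 \<le> ln W / ln 2\<close>.\<close>

lemma log_bound_polynomial:
  fixes A W :: real
  assumes A: "1 \<le> A" and W: "2 \<le> W"
  defines "N \<equiv> nat \<lceil>log 2 (A * W ^ 5)\<rceil>"
  shows "A * W ^ 5 \<le> 2 ^ N" and "real N + 3 \<le> ((ln A / ln 2 + 4) / ln 2 + 5 / ln 2) * ln W"
proof -
  have W5: "1 \<le> W ^ 5" using W by (intro one_le_power) simp
  have AW: "1 \<le> A * W ^ 5" using A W5 mult_mono[of 1 A 1 "W ^ 5"] by simp
  have N: "log 2 (A * W ^ 5) \<le> real N" "real N \<le> log 2 (A * W ^ 5) + 1"
    using AW zero_le_log_cancel_iff[of 2 "A * W ^ 5"] unfolding N_def by linarith+
  show "A * W ^ 5 \<le> 2 ^ N"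
    using N(1) AW by (simp add: log_le_iff powr_realpow)
  have l2: "0 < ln (2::real)" "ln 2 \<le> ln W" using W by auto
  have "log 2 (A * W ^ 5) = ln A / ln 2 + 5 * ln W / ln 2"
    using A W by (simp add: log_def ln_mult ln_realpow add_divide_distrib)
  then have "real N + 3 \<le> (ln A / ln 2 + 4) * 1 + 5 / ln 2 * ln W" using N(2) by simp
  also have "\<dots> \<le> (ln A / ln 2 + 4) * (ln W / ln 2) + 5 / ln 2 * ln W"
    using l2 A by (intro add_right_mono mult_left_mono) (auto simp: add_nonneg_nonneg)
  also have "a * (w / l) + 5 / l * w = (a / l + 5 / l) * w" for a w l :: real
    by (simp add: distrib_right)
  finally show "real N + 3 \<le> ((ln A / ln 2 + 4) / ln 2 + 5 / ln 2) * ln W" .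
qed

text \<open>480 is 16 from the bisection condition times 30 from the bound on
  \<open>(1 + Tb) * Tb\<close>. The leading 1 keeps the logarithm nonnegative.\<close>

definition scale_const :: "real \<Rightarrow> real \<Rightarrow> real \<Rightarrow> real" where
  "scale_const k R c = 1 + 480 * k ^ 16 * (2 * k * R + 1) * c\<^sup>2 / R"

text \<open>The factors belong, in order, to the number of stages, to two queries per tried value
  times the iterations of a stage, and to the values of \<lambda> tried per iteration.\<close>

definition query_const :: "real \<Rightarrow> real \<Rightarrow> real \<Rightarrow> real" where
  "query_const k R c = 2 / ln 2 * (2 * (5 * k ^ 6 * sqrt c) *
    ((ln (scale_const k R c) / ln 2 + 4) / ln 2 + 5 / ln 2))"

lemma scale_const_ge_1: "1 \<le> k \<Longrightarrow> 0 < R \<Longrightarrow> 1 \<le> scale_const k R c"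
  by (simp add: scale_const_def)

lemma query_const_pos:
  assumes "1 \<le> k" "0 < R" "0 < c"
  shows "0 < query_const k R c"
proof -
  have "0 \<le> ln (scale_const k R c)" using scale_const_ge_1[OF assms(1,2)] by simp
  then have "0 < (ln (scale_const k R c) / ln 2 + 4) / ln 2 + 5 / ln 2"
    by (intro add_nonneg_pos divide_nonneg_pos add_nonneg_nonneg) auto
  then show ?thesis unfolding query_const_def using assms by simp
qed

lemma (in objective) complexity:
  assumes c: "CL \<le> c" "1 \<le> c" and Rg: "0 \<le> Rg" and eps: "0 < \<epsilon>"
  defines "Lt \<equiv> c * L * (Rg + 1)" and "W \<equiv> 2 + L / \<mu> + Rg + \<mu> * R\<^sup>2 / \<epsilon>" and "J \<equiv> num_stages \<mu> R \<epsilon>"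
  shows "\<exists>y q. stages K V M F \<mu> Lt x0 R J y q"
    and "stages K V M F \<mu> Lt x0 R J y q \<Longrightarrow> y \<in> M \<and> eps_minimizer F D \<epsilon> y \<and>
      real q \<le> query_const k R c * sqrt (L * (Rg + 1) / \<mu>) * ln W ^ 2"
proof -
  have k: "1 \<le> k" "0 < k" using kappa_ge by auto
  have "L * 1 \<le> L * (Rg + 1)" using L_pos Rg by (intro mult_left_mono) auto
  then have "c * L \<le> Lt" using c unfolding Lt_def mult.assoc by (intro mult_left_mono) auto
  moreover have "CL * L \<le> c * L" "L \<le> c * L" using c L_pos by (auto intro: mult_right_mono)
  ultimately have LtL: "CL * L \<le> Lt" "L \<le> Lt" by linarith+
  then have Lt: "CL * L \<le> Lt" "0 < Lt" using L_pos by auto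
  show "\<exists>y q. stages K V M F \<mu> Lt x0 R J y q" by (rule stages_exist[OF Lt])
  assume st: "stages K V M F \<mu> Lt x0 R J y q"
  obtain xs where xs: "is_arg_min F (\<lambda>x. x \<in> D) xs" using minimizer_exists by blast
  have W: "2 + \<mu> * R\<^sup>2 / \<epsilon> \<le> W" "L / \<mu> \<le> W" "Rg + 1 \<le> W" "2 \<le> W"
    unfolding W_def using L_pos mu Rg eps by auto
  note ns = num_stages_bounds[OF mu R(1) eps W(1), folded J_def]
  have J0: "0 < J" by (simp add: J_def num_stages_def)
  have yD: "y \<in> D" by (rule stages_D[OF Lt st])
  have "F y - F xs \<le> \<mu> * (R / sqrt 2 ^ (J - 1))\<^sup>2 / 4" using stages_result(2)[OF Lt st xs J0] by simp
  also have "\<dots> \<le> \<epsilon>"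
  proof -
    obtain J' where J': "J = Suc J'" using J0 by (cases J) auto
    have "(sqrt 2 ^ J')\<^sup>2 = 2 ^ J'" by (simp add: power_mult[symmetric] mult.commute[of J'] power_mult)
    moreover have "\<mu> * R\<^sup>2 \<le> \<epsilon> * (2 ^ J' * 4)" using ns(1) eps unfolding J' by (simp add: divide_le_eq mult_ac)
    ultimately show ?thesis unfolding J' by (simp add: power_divide divide_le_eq mult_ac)
  qed
  finally have "eps_minimizer F D \<epsilon> y" using xs unfolding eps_minimizer_def by blast
  moreover have "real q \<le> query_const k R c * sqrt (L * (Rg + 1) / \<mu>) * ln W ^ 2"
  proof -
    define Z where "Z = Lt / \<mu>"
    have Z1: "1 \<le> Z" unfolding Z_def using mu_le_L LtL mu by simp
    \<comment> \<open>The 4 becomes 5 to absorb the added 1, and \<open>k ^ 11\<close> is rounded up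
      to \<open>k ^ 12\<close> to have a root.\<close>
    define Tb where "Tb = 5 * k ^ 6 * sqrt Z"
    have sZ: "1 \<le> sqrt Z" using Z1 by simp
    have k6: "1 \<le> k ^ 6" using k by (intro one_le_power)
    have kZ: "1 \<le> k ^ 6 * sqrt Z" using k6 sZ mult_mono[of 1 "k ^ 6" 1 "sqrt Z"] by simp
    have Tb1: "4 * sqrt (k ^ 11 * Lt / \<mu>) + 1 \<le> Tb"
    proof -
      have "sqrt (k ^ 11 * Lt / \<mu>) \<le> sqrt ((k ^ 6)\<^sup>2 * Z)"
      proof (rule real_sqrt_le_mono)
        have "k ^ 11 * Z \<le> k ^ 12 * Z" using k Z1 by (intro mult_right_mono power_increasing) auto
        then show "k ^ 11 * Lt / \<mu> \<le> (k ^ 6)\<^sup>2 * Z" by (simp add: Z_def flip: power_mult)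
      qed
      also have "\<dots> = k ^ 6 * sqrt Z" using k by (simp only: real_sqrt_mult real_sqrt_abs) simp
      finally show ?thesis using kZ unfolding Tb_def by linarith
    qed
    have TT: "(1 + Tb) * Tb \<le> 30 * k ^ 12 * Z"
    proof -
      have "(1 + Tb) * Tb \<le> (6 * (k ^ 6 * sqrt Z)) * (5 * (k ^ 6 * sqrt Z))"
      proof (rule mult_mono)
        show "1 + Tb \<le> 6 * (k ^ 6 * sqrt Z)" "Tb \<le> 5 * (k ^ 6 * sqrt Z)" "0 \<le> 6 * (k ^ 6 * sqrt Z)" "0 \<le> Tb"
          using kZ unfolding Tb_def by linarith+
      qed
      also have "\<dots> = 30 * (k ^ 6 * k ^ 6) * (sqrt Z * sqrt Z)" by (simp only: mult_ac)
      also have "\<dots> = 30 * k ^ 12 * Z" using Z1 by (simp flip: power_add)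
      finally show ?thesis .
    qed
    define A where "A = scale_const k R c"
    have A1: "1 \<le> A" unfolding A_def by (rule scale_const_ge_1[OF k(1) R(1)])
    define N where "N = nat \<lceil>log 2 (A * W ^ 5)\<rceil>"
    note lb = log_bound_polynomial[OF A1 W(4), folded N_def]
    \<comment> \<open>All quantities inside the logarithm are bounded by powers of \<open>W\<close>,
      so the number of bisection steps is a multiple of \<open>ln W\<close>.\<close>
    have ZW: "Z \<le> c * W\<^sup>2"
    proof -
      have "Z = c * ((L / \<mu>) * (Rg + 1))" by (simp add: Z_def Lt_def)
      also have "\<dots> \<le> c * (W * W)"
        using W c Rg L_pos mu by (intro mult_left_mono mult_mono) auto
      finally show ?thesis by (simp add: power2_eq_square)
    qed
    have bis: "16 * k ^ 4 * ((1 + Tb) * Tb) * (2 * k * R * Lt + Gbd) * sqrt 2 ^ i / (\<mu> * R) \<le> 2 ^ Suc N"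
      if "i < J" for i
    proof -
      have G0: "0 \<le> Gbd" using CG_L_nonneg k by (simp add: Gbd_def mult.assoc)
      have "2 * k * R * Lt + Gbd \<le> (2 * k * R + 1) * Lt"
        using Gbd_le LtL by (simp add: algebra_simps)
      then have a: "(2 * k * R * Lt + Gbd) / \<mu> \<le> (2 * k * R + 1) * Z"
        using mu unfolding Z_def times_divide_eq_right by (intro divide_right_mono) auto
      have a0: "0 \<le> (2 * k * R * Lt + Gbd) / \<mu>" using k R Lt G0 mu by simp
      have "0 \<le> Tb" using kZ unfolding Tb_def by linarith
      then have T0: "0 \<le> (1 + Tb) * Tb" by simp
      have "16 * k ^ 4 * ((1 + Tb) * Tb) * (2 * k * R * Lt + Gbd) * sqrt 2 ^ i / (\<mu> * R)
        = 16 * k ^ 4 * ((1 + Tb) * Tb) * ((2 * k * R * Lt + Gbd) / \<mu>) * sqrt 2 ^ i / R" by simp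
      also have "\<dots> \<le> 16 * k ^ 4 * (30 * k ^ 12 * Z) * ((2 * k * R + 1) * Z) * W / R"
      proof -
        have mono: "b * x * y * s / R \<le> b * x' * y' * w / R"
          if "0 \<le> b" "0 \<le> x" "x \<le> x'" "0 \<le> y" "y \<le> y'" "0 \<le> s" "s \<le> w" for b x x' y y' s w :: real
          using that R by (intro divide_right_mono mult_mono mult_nonneg_nonneg) auto
        show ?thesis
          using k by (intro mono[OF _ T0 TT a0 a _ ns(2)[OF that]]) auto
      qed
      also have "\<dots> = 480 * k ^ 16 * (2 * k * R + 1) / R * (Z * Z * W)" by (simp add: power_def mult_ac)
      also have "\<dots> \<le> 480 * k ^ 16 * (2 * k * R + 1) / R * ((c * W\<^sup>2) * (c * W\<^sup>2) * W)"
      proof -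
        have "Z * Z \<le> (c * W\<^sup>2) * (c * W\<^sup>2)" by (rule mult_mono[OF ZW ZW]) (use Z1 ZW in linarith)+
        then have "Z * Z * W \<le> (c * W\<^sup>2) * (c * W\<^sup>2) * W" by (rule mult_right_mono) (use W in linarith)
        then show ?thesis by (rule mult_left_mono) (use k R in simp)
      qed
      also have "\<dots> = (A - 1) * W ^ 5" by (simp add: A_def scale_const_def power_def mult_ac)
      also have "\<dots> \<le> A * W ^ 5" using W by (intro mult_right_mono) auto
      also have "\<dots> \<le> 2 ^ N" by (rule lb(1))
      also have "\<dots> \<le> 2 ^ Suc N" by simp
      finally show ?thesis .
    qed
    have "real q \<le> real J * (2 * Tb * (real N + 3))"
      by (rule stages_queries[OF Lt Tb1 bis st order_refl])
    also have "\<dots> \<le> (2 / ln 2 * ln W) * (2 * Tb * (((ln A / ln 2 + 4) / ln 2 + 5 / ln 2) * ln W))"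
    proof (rule mult_mono[OF ns(3) mult_left_mono[OF lb(2)]])
      show T2: "0 \<le> 2 * Tb" using kZ unfolding Tb_def by linarith
      show "0 \<le> 2 / ln 2 * ln W" using W(4) by simp
      show "0 \<le> 2 * Tb * (real N + 3)" using T2 by simp
    qed
    also have "Tb = (5 * k ^ 6 * sqrt c) * sqrt (L * (Rg + 1) / \<mu>)"
      unfolding Tb_def Z_def Lt_def using c by (simp add: real_sqrt_mult real_sqrt_divide)
    finally show ?thesis
      unfolding query_const_def A_def[symmetric] power2_eq_square by (simp add: mult_ac)
  qed
  ultimately show "y \<in> M \<and> eps_minimizer F D \<epsilon> y \<and>
      real q \<le> query_const k R c * sqrt (L * (Rg + 1) / \<mu>) * ln W ^ 2"
    using yD DM by blast
qed

theorem corollary9: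
  fixes K R :: real
  assumes "K \<in> {1, -1}" and "0 < R" and "K = 1 \<longrightarrow> R < pi / 2"
  shows "\<exists>c0>0. \<forall>c\<ge>c0. \<exists>C>0. \<exists>p::nat.
    \<forall>(V :: 'a::real_inner set) M (F :: real \<times> 'a \<Rightarrow> real) n x0 xg Rg L \<mu> \<epsilon>.
      subspace V \<longrightarrow> dim V = n \<longrightarrow> 2 \<le> n \<longrightarrow>
      openin (top_of_set (space_form K V)) M \<longrightarrow>
      x0 \<in> M \<longrightarrow> rcball K V x0 R \<subseteq> M \<longrightarrow> rcball K V x0 Rg \<subseteq> M \<longrightarrow>
      (K = 1 \<longrightarrow> Rg < pi / 2) \<longrightarrow>
      twice_differentiable K V M F \<longrightarrow>
      smooth_in K V M F L (rcball K V x0 R) \<longrightarrow>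
      0 < \<mu> \<longrightarrow> strongly_gconvex_in K V M F \<mu> (rcball K V x0 R) \<longrightarrow>
      is_arg_min F (\<lambda>x. x \<in> M) xg \<longrightarrow> rdist K x0 xg \<le> Rg \<longrightarrow>
      0 < \<epsilon> \<longrightarrow>
      (\<exists>y q. stages K V M F \<mu> (c * L * (Rg + 1)) x0 R (num_stages \<mu> R \<epsilon>) y q) \<and>
      (\<forall>y q. stages K V M F \<mu> (c * L * (Rg + 1)) x0 R (num_stages \<mu> R \<epsilon>) y q \<longrightarrow>
        y \<in> M \<and> eps_minimizer F (rcball K V x0 R) \<epsilon> y \<and>
        real q \<le> C * sqrt (L * (Rg + 1) / \<mu>) * ln (2 + L / \<mu> + Rg + \<mu> * R\<^sup>2 / \<epsilon>) ^ p)"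
proof -
  have K: "K = 1 \<or> K = - 1" using assms(1) by auto
  obtain \<sigma> where \<sigma>: "midpoint_dist K R \<sigma>" using midpoint_dist_exists[OF K assms(2,3)] by blast
  define k where "k = kappa K R"
  have k: "1 \<le> k"
  proof (cases "K = 1")
    case True
    then have "0 < cos R" using assms(2,3) by (intro cos_gt_zero_pi) auto
    then show ?thesis using True by (simp add: k_def kappa_def)
  qed (simp add: k_def kappa_def cosh_real_ge_1)
  \<comment> \<open>\<open>CL\<close> depends on \<open>K\<close>, \<open>R\<close> and \<sigma>
    only, and \<sigma> was chosen from \<open>K\<close> and \<open>R\<close>; so \<open>c0\<close>
    is fixed before the dimension, the manifold and the function.\<close>
  define c0 where "c0 = max 1 (objective.CL K R \<sigma>)"
  show ?thesis
  proof (rule exI[of _ c0], rule conjI[OF _ allI[OF impI]])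
    show "0 < c0" by (simp add: c0_def)
    fix c :: real assume c: "c0 \<le> c"
    then have c': "objective.CL K R \<sigma> \<le> c" "1 \<le> c" "0 < c" by (auto simp: c0_def)
    show "\<exists>C>0. \<exists>p::nat.
      \<forall>(V :: 'a::real_inner set) M (F :: real \<times> 'a \<Rightarrow> real) n x0 xg Rg L \<mu> \<epsilon>.
        subspace V \<longrightarrow> dim V = n \<longrightarrow> 2 \<le> n \<longrightarrow>
        openin (top_of_set (space_form K V)) M \<longrightarrow>
        x0 \<in> M \<longrightarrow> rcball K V x0 R \<subseteq> M \<longrightarrow> rcball K V x0 Rg \<subseteq> M \<longrightarrow>
        (K = 1 \<longrightarrow> Rg < pi / 2) \<longrightarrow>
        twice_differentiable K V M F \<longrightarrow>
        smooth_in K V M F L (rcball K V x0 R) \<longrightarrow>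
        0 < \<mu> \<longrightarrow> strongly_gconvex_in K V M F \<mu> (rcball K V x0 R) \<longrightarrow>
        is_arg_min F (\<lambda>x. x \<in> M) xg \<longrightarrow> rdist K x0 xg \<le> Rg \<longrightarrow>
        0 < \<epsilon> \<longrightarrow>
        (\<exists>y q. stages K V M F \<mu> (c * L * (Rg + 1)) x0 R (num_stages \<mu> R \<epsilon>) y q) \<and>
        (\<forall>y q. stages K V M F \<mu> (c * L * (Rg + 1)) x0 R (num_stages \<mu> R \<epsilon>) y q \<longrightarrow>
          y \<in> M \<and> eps_minimizer F (rcball K V x0 R) \<epsilon> y \<and>
          real q \<le> C * sqrt (L * (Rg + 1) / \<mu>) * ln (2 + L / \<mu> + Rg + \<mu> * R\<^sup>2 / \<epsilon>) ^ p)"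
    \<comment> \<open>The exponent 2 is one logarithm for the stages and one for the
      bisections.\<close>
    proof (rule exI[of _ "query_const k R c"], rule conjI[OF query_const_pos[OF k assms(2) c'(3)]],
        rule exI[of _ 2], (rule allI)+, (rule impI)+)
      fix V :: "'a set" and M and F :: "real \<times> 'a \<Rightarrow> real" and n x0 xg and Rg L \<mu> \<epsilon> :: real
      assume V: "subspace V" "dim V = n" "2 \<le> n"
        and M: "openin (top_of_set (space_form K V)) M" "x0 \<in> M" "rcball K V x0 R \<subseteq> M"
        and F: "twice_differentiable K V M F" "smooth_in K V M F L (rcball K V x0 R)"
          "0 < \<mu>" "strongly_gconvex_in K V M F \<mu> (rcball K V x0 R)"
        and xg: "is_arg_min F (\<lambda>x. x \<in> M) xg" "rdist K x0 xg \<le> Rg" and eps: "0 < \<epsilon>"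
      obtain B where B: "orthonormal B" "span B = V"
        using orthonormal_basis_exists[of V] V by auto
      have MS: "M \<subseteq> space_form K V" using M(1) by (rule openin_imp_subset)
      interpret objective K V B x0 R M F L \<mu> \<sigma>
        using K V B M F \<sigma> assms(2,3) MS
        by unfold_locales
          (auto simp: twice_differentiable_def intro: differentiable_imp_continuous_on)
      \<comment> \<open>A distance bounds \<open>Rg\<close> from below, so the factor
        \<open>Rg + 1\<close> only enlarges the Lipschitz constant.\<close>
      have "0 \<le> rdist K x0 xg" using xg(1) MS x0 by (intro rdist_nonneg) (auto simp: is_arg_min_def)
      then have Rg: "0 \<le> Rg" using xg(2) by simp
      show "(\<exists>y q. stages K V M F \<mu> (c * L * (Rg + 1)) x0 R (num_stages \<mu> R \<epsilon>) y q) \<and>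
        (\<forall>y q. stages K V M F \<mu> (c * L * (Rg + 1)) x0 R (num_stages \<mu> R \<epsilon>) y q \<longrightarrow>
          y \<in> M \<and> eps_minimizer F (rcball K V x0 R) \<epsilon> y \<and>
          real q \<le> query_const k R c * sqrt (L * (Rg + 1) / \<mu>) * ln (2 + L / \<mu> + Rg + \<mu> * R\<^sup>2 / \<epsilon>) ^ 2)"
        unfolding k_def
        by (rule conjI[OF complexity(1)[OF c'(1,2) Rg eps]], rule allI, rule allI, rule impI,
            rule complexity(2)[OF c'(1,2) Rg eps])
    qed
  qed
qed

end
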